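(* Assume the dual-scale cluster geometry and spectral detuning described in the context, and assume that the physical input operator $B^{\mathrm{in}}(s)$ is analytic in $\mathbb C$. Then the microscopic transfer matrix $H_b(s)$ has the following properties. (i) (Meromorphic structure) $H_b(s)$ admits a meromorphic continuation to $\mathbb C$. In particular it is meromorphic in the half-plane $\mathcal S_{-\sigma_0}:=\{s\in\mathbb C:\Re(s)>-\sigma_0\}$, and its poles are contained in $\{s:\det(\mathcal D(s)+s^2\mathcal Q(s,\varepsilon))=0\}$. (ii) (Discrete poles and asymptotic cluster separation) Let $\mathcal P$ denote the discrete set of poles of $H_b$ within $\mathcal S_{-\sigma_0}$. The dominant principal mode of each cluster $\alpha\in\{1,\dots,N\}$ corresponds to a distinguished simple pole near its local unperturbed frequency $i\omega_{M,\alpha}$, $$s^*_{\alpha,1}=-\eta_{\alpha,1}+i\omega_{\alpha,1}(\varepsilon),\qquad \eta_{\alpha,1},\ \omega_{\alpha,1}(\varepsilon)>0.$$ Moreover, there exist $\varepsilon_0>0$ and a constant $g_0>0$ such that for all $\varepsilon\in(0,\varepsilon_0]$ the pole $s^*_{\alpha,1}$ satisfies $$\operatorname{dist}\bigl(s^*_{\alpha,1},\mathcal P\setminus\{s^*_{\alpha,1}\}\bigr)\ge g_0\,\varepsilon^{1-p}>0 .$$ In addition, since $\omega_{M,\alpha}\neq\omega_{M,\beta}$ for $\alpha\ne\beta$, the principal dominant poles $s^*_{M,\alpha}(\varepsilon):=s^*_{\alpha,1}$ of distinct clusters satisfy $$|s^*_{M,\alpha}(\varepsilon)-s^*_{M,\beta}(\varepsilon)|=|\omega_{M,\alpha}-\omega_{M,\beta}|+\mathcal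 O(\varepsilon^{1-p})\ge\Delta_\omega>0,\qquad \Delta_\omega:=\tfrac12\min_{\omega_{M,\beta}\ne\omega_{M,\alpha}}|\omega_{M,\alpha}-\omega_{M,\beta}| .$$ (iii) (Residue expansion) Assume that the $m$-th resonant mode of cluster $\alpha$ is not annihilated by the input/output projections. Then in a neighborhood $U$ of $s^*_{\alpha,m}$ one has the Laurent expansion $$H_b(s)=\frac{R_{\alpha,m}}{s-s^*_{\alpha,m}}+H_{\mathrm{reg}}(s),$$ where $R_{\alpha,m}\in\mathbb C^{M\times M}\setminus\{\mathbf 0\}$ and $H_{\mathrm{reg}}(s)$ is bounded and analytic in $U$.
   Context: **Geometry.** $p\in(0,1)$, $0<\varepsilon\ll1$, $c_0>0$, $\sigma_0>0$ fixed. There are $M$ bubbles with centers $z_i\in\mathbb R^3$ and a partition $\{1,\dots,M\}=\bigsqcup_{\alpha=1}^N\mathcal I_\alpha$ into clusters, $M_\alpha=|\mathcal I_\alpha|$. (a) Each bubble has a Minnaert frequency $\omega_{M,i}>0$ (independent of $\varepsilon$), with $\omega_{M,i}=\omega_{M,\alpha}$ for all $i\in\mathcal I_\alpha$ and $\omega_{M,\alpha}\ne\omega_{M,\beta}$ for $\alpha\ne\beta$. (b) There are $\varepsilon$-independent constants $c_1,c_2,D_{\min},D_{\max}>0$ such that $d_{ij}=|z_i-z_j|\in[c_1\varepsilon^p,c_2\varepsilon^p]$ for $i\neq j$ in the same cluster and $d_{ij}\in[D_{\min},D_{\max}]$ for $i,j$ in different clusters. **Transfer matrix.** Let $\widetilde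 C_i>0$ be $\varepsilon$-independent constants (in terms of the reference shape $B_i$ and the material parameters, $\widetilde C_i=\operatorname{vol}(B_i)\rho_c/\overline\kappa_{b_i}$, where $\rho_c$ is the background density and $\overline\kappa_{b_i}\varepsilon^2$ the bubble's bulk modulus), the same within a cluster as regards the notation of the leading-order interaction, and put $C_i(\varepsilon)=\varepsilon\widetilde C_i$, $\tau_{ij}=d_{ij}/c_0$, $$\mathcal A_b=-\operatorname{diag}(C_i(\varepsilon))_{i=1}^M,\quad \mathcal D(s)=\operatorname{diag}(\omega_{M,i}^{-2}s^2+1)_{i=1}^M,\quad \mathcal Q_{ij}(s,\varepsilon)=\varepsilon\frac{\widetilde C_je^{-s\tau_{ij}}}{4\pi d_{ij}}\ (i\ne j),\quad \mathcal Q_{ii}=0,$$ $$\mathcal K_{\mathrm{dyn}}(s)=I+\mathcal D(s)^{-1}s^2\mathcal Q(s,\varepsilon),\qquad B(s)=\mathcal D(s)^{-1}s^2B^{\mathrm{in}}(s),\qquad H_b(s)=\mathcal A_b\,\mathcal K_{\mathrm{dyn}}(s)^{-1}B(s),$$ where $B^{\mathrm{in}}(s)\in\mathbb C^{M\times M}$ is the operator converting incident traces at the bubble centers into the forcing. **Modes.** Let $P(s,\varepsilon)=\mathcal D(s)+s^2\mathcal Q(s,\varepsilon)$. For small $\varepsilon$ there are exactly $M_\alpha$ zeros (with multiplicity) of $\det P(\cdot,\varepsilon)$ in a small fixed disc around $i\omega_{M,\alpha}$; they are denoted $s^*_{\alpha,m}$, $m=1,\dots,M_\alpha$, and called the resonances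 of cluster $\alpha$. The dominant principal mode is $m=1$: the resonance $s^*_{\alpha,1}$ whose leading $\varepsilon^{1-p}$ shift from $i\omega_{M,\alpha}$ is governed by the Perron–Frobenius eigenvalue of the intra-cluster interaction matrix with entries $\widetilde C_j/(4\pi\widetilde d_{ij})$, $i\ne j\in\mathcal I_\alpha$ (zero diagonal), where $d_{ij}=\widetilde d_{ij}\varepsilon^p$. The $m$-th mode is "not annihilated by the input/output projections" if, for right and left null vectors $\mathbf v,\mathbf w$ of $P(s^*_{\alpha,m},\varepsilon)$ (i.e. $P\mathbf v=0$, $\mathbf w^\top P=0$) one has $\mathcal A_b\mathbf v\ne0$ and $\mathbf w^\top B^{\mathrm{in}}(s^*_{\alpha,m})\ne0$.
   Formalization: η_{α,1}>0 is claimed only for clusters with at least two bubbles; s*_{α,1} is a simple pole of H_b only if its mode is not annihilated (always a simple zero of det P); (iii) for m≥2 assumes the zero's algebraic and geometric multiplicities agree. *)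

theory Defs
  imports
    "HOL-Complex_Analysis.Complex_Analysis"
    "HOL-Library.Landau_Symbols"
begin

text \<open>
  Bubbles are indexed by a finite type \<open>'m\<close> (so \<open>M = CARD('m)\<close>), clusters by a finite type
  \<open>'n\<close> (so \<open>N = CARD('n)\<close>). The partition into clusters is a surjection \<open>cl\<close>; cluster
  \<open>\<alpha>\<close> is the fibre of \<open>cl\<close> over \<open>\<alpha>\<close>. The centres \<open>z \<epsilon> i\<close> depend on \<open>\<epsilon>\<close>, because the
  distances inside a cluster are of order \<open>\<epsilon>\<^sup>p\<close>. The matrices below are defined for one
  configuration of centres \<open>x\<close> and one value of \<open>\<epsilon>\<close>.
\<close>

definition cluster :: "('m \<Rightarrow> 'n) \<Rightarrow> 'n \<Rightarrow> 'm set" where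
  "cluster cl \<alpha> = {i. cl i = \<alpha>}"

definition dual_scale_geometry ::
    "real \<Rightarrow> real \<Rightarrow> real \<Rightarrow> real \<Rightarrow> real \<Rightarrow> real \<Rightarrow> ('m \<Rightarrow> 'n) \<Rightarrow> (real \<Rightarrow> 'm \<Rightarrow> real ^ 3) \<Rightarrow> bool" where
  "dual_scale_geometry p \<epsilon>\<^sub>1 c\<^sub>1 c\<^sub>2 D\<^sub>m\<^sub>i\<^sub>n D\<^sub>m\<^sub>a\<^sub>x cl z \<longleftrightarrow>
     (\<forall>\<epsilon>\<in>{0<..\<epsilon>\<^sub>1}. \<forall>i j. i \<noteq> j \<longrightarrow>
        (cl i = cl j \<longrightarrow> dist (z \<epsilon> i) (z \<epsilon> j) \<in> {c\<^sub>1 * \<epsilon> powr p .. c\<^sub>2 * \<epsilon> powr p}) \<and>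
        (cl i \<noteq> cl j \<longrightarrow> dist (z \<epsilon> i) (z \<epsilon> j) \<in> {D\<^sub>m\<^sub>i\<^sub>n .. D\<^sub>m\<^sub>a\<^sub>x}))"

definition A_mat :: "('m \<Rightarrow> real) \<Rightarrow> real \<Rightarrow> complex ^ 'm ^ ('m::finite)" where
  "A_mat C \<epsilon> = (\<chi> i j. if i = j then - of_real (\<epsilon> * C i) else 0)"

definition D_mat :: "('m \<Rightarrow> real) \<Rightarrow> complex \<Rightarrow> complex ^ 'm ^ ('m::finite)" where
  "D_mat \<omega> s = (\<chi> i j. if i = j then s\<^sup>2 / (of_real (\<omega> i))\<^sup>2 + 1 else 0)"

definition Q_mat ::
    "real \<Rightarrow> ('m \<Rightarrow> real) \<Rightarrow> ('m \<Rightarrow> real ^ 3) \<Rightarrow> real \<Rightarrow> complex \<Rightarrow> complex ^ 'm ^ ('m::finite)" where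
  "Q_mat c\<^sub>0 C x \<epsilon> s = (\<chi> i j. if i = j then 0 else
     of_real \<epsilon> * (of_real (C j) * exp (- s * of_real (dist (x i) (x j) / c\<^sub>0))
       / of_real (4 * pi * dist (x i) (x j))))"

text \<open>\<^term>\<open>mat c\<close> is \<open>c\<close> times the identity, so \<^term>\<open>mat c ** A\<close> is a scalar multiple of \<open>A\<close>.\<close>

definition P_mat ::
    "real \<Rightarrow> ('m \<Rightarrow> real) \<Rightarrow> ('m \<Rightarrow> real) \<Rightarrow> ('m \<Rightarrow> real ^ 3) \<Rightarrow> real \<Rightarrow> complex
      \<Rightarrow> complex ^ 'm ^ ('m::finite)" where
  "P_mat c\<^sub>0 \<omega> C x \<epsilon> s = D_mat \<omega> s + mat (s\<^sup>2) ** Q_mat c\<^sub>0 C x \<epsilon> s"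

definition K_dyn ::
    "real \<Rightarrow> ('m \<Rightarrow> real) \<Rightarrow> ('m \<Rightarrow> real) \<Rightarrow> ('m \<Rightarrow> real ^ 3) \<Rightarrow> real \<Rightarrow> complex
      \<Rightarrow> complex ^ 'm ^ ('m::finite)" where
  "K_dyn c\<^sub>0 \<omega> C x \<epsilon> s = mat 1 + matrix_inv (D_mat \<omega> s) ** mat (s\<^sup>2) ** Q_mat c\<^sub>0 C x \<epsilon> s"

definition B_mat ::
    "('m \<Rightarrow> real) \<Rightarrow> (complex \<Rightarrow> complex ^ 'm ^ 'm) \<Rightarrow> complex \<Rightarrow> complex ^ 'm ^ ('m::finite)" where
  "B_mat \<omega> B\<^sub>i\<^sub>n s = matrix_inv (D_mat \<omega> s) ** mat (s\<^sup>2) ** B\<^sub>i\<^sub>n s"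

text \<open>
  The value of \<open>H_mat\<close> is meaningful only where \<^const>\<open>D_mat\<close> and \<^const>\<open>K_dyn\<close> are
  invertible. Elsewhere \<^const>\<open>matrix_inv\<close> is unspecified, but for \<open>\<epsilon>\<close>, \<open>C\<close>, \<open>\<omega>\<close> as
  in the theorem those points are isolated, and \<^const>\<open>meromorphic_on\<close>, \<^const>\<open>is_pole\<close> and
  \<^const>\<open>zorder\<close> do not depend on values at isolated points.
\<close>

definition H_mat ::
    "real \<Rightarrow> ('m \<Rightarrow> real) \<Rightarrow> ('m \<Rightarrow> real) \<Rightarrow> ('m \<Rightarrow> real ^ 3) \<Rightarrow> real
      \<Rightarrow> (complex \<Rightarrow> complex ^ 'm ^ 'm) \<Rightarrow> complex \<Rightarrow> complex ^ 'm ^ ('m::finite)" where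
  "H_mat c\<^sub>0 \<omega> C x \<epsilon> B\<^sub>i\<^sub>n s =
     A_mat C \<epsilon> ** matrix_inv (K_dyn c\<^sub>0 \<omega> C x \<epsilon> s) ** B_mat \<omega> B\<^sub>i\<^sub>n s"

definition half_plane :: "real \<Rightarrow> complex set" where
  "half_plane \<sigma> = {s. Re s > - \<sigma>}"

definition mat_pole :: "(complex \<Rightarrow> complex ^ 'k ^ 'l) \<Rightarrow> complex \<Rightarrow> bool" where
  "mat_pole F s \<longleftrightarrow> (\<exists>i j. is_pole (\<lambda>w. F w $ i $ j) s)"

definition mat_simple_pole :: "(complex \<Rightarrow> complex ^ 'k ^ 'l) \<Rightarrow> complex \<Rightarrow> bool" where
  "mat_simple_pole F s \<longleftrightarrow> mat_pole F s \<and>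
     (\<forall>i j. is_pole (\<lambda>w. F w $ i $ j) s \<longrightarrow> zorder (\<lambda>w. F w $ i $ j) s = -1)"

text \<open>
  The intra-cluster interaction matrix of cluster \<open>\<alpha>\<close>, with
  \<open>dist (x i) (x j) / \<epsilon> powr p\<close> the rescaled distance. It is padded with zero rows and columns
  outside the cluster, which adds only the eigenvalue \<open>0\<close> and leaves the Perron-Frobenius
  eigenvalue (the spectral radius of the nonnegative matrix) unchanged.
\<close>

definition interaction_mat ::
    "real \<Rightarrow> ('m \<Rightarrow> 'n) \<Rightarrow> ('m \<Rightarrow> real) \<Rightarrow> ('m \<Rightarrow> real ^ 3) \<Rightarrow> real \<Rightarrow> 'n
      \<Rightarrow> real ^ 'm ^ ('m::finite)" where
  "interaction_mat p cl C x \<epsilon> \<alpha> = (\<chi> i j.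
     if i \<noteq> j \<and> i \<in> cluster cl \<alpha> \<and> j \<in> cluster cl \<alpha>
     then C j / (4 * pi * (dist (x i) (x j) / \<epsilon> powr p)) else 0)"

definition eigenvalues :: "complex ^ 'k ^ ('k::finite) \<Rightarrow> complex set" where
  "eigenvalues A = {l. \<exists>v. v \<noteq> 0 \<and> A *v v = l *s v}"

definition perron_eigenvalue :: "real ^ 'k ^ ('k::finite) \<Rightarrow> real" where
  "perron_eigenvalue A = Max (cmod ` eigenvalues (\<chi> i j. of_real (A $ i $ j)))"

text \<open>
  \<open>s \<epsilon> \<alpha> m\<close>, for \<open>m = 1, \<dots>, M\<^sub>\<alpha>\<close>, enumerates with multiplicity the zeros of \<open>det P\<close> in the disc
  of radius \<open>r\<close> around \<open>\<i> \<omega>\<^sub>\<alpha>\<close> (\<^const>\<open>zorder\<close> of an analytic function vanishes where the function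
  does not). Substituting \<open>s = \<i> \<omega>\<^sub>\<alpha> + \<delta>\<close> in \<open>1 + s\<^sup>2 / \<omega>\<^sub>\<alpha>\<^sup>2 + s\<^sup>2 \<epsilon>\<^sup>1\<^sup>-\<^sup>p \<lambda> = 0\<close>, where \<open>\<lambda>\<close> is an
  eigenvalue of the interaction matrix, gives \<open>\<delta> \<approx> - (\<i> / 2) \<omega>\<^sub>\<alpha>\<^sup>3 \<lambda> \<epsilon>\<^sup>1\<^sup>-\<^sup>p\<close>; the principal mode
  \<open>m = 1\<close> is the one for which \<open>\<lambda>\<close> is the Perron-Frobenius eigenvalue.
\<close>

definition cluster_resonances ::
    "real \<Rightarrow> real \<Rightarrow> ('m::finite \<Rightarrow> 'n) \<Rightarrow> ('m \<Rightarrow> real) \<Rightarrow> ('n \<Rightarrow> real) \<Rightarrow> ('m \<Rightarrow> real)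
      \<Rightarrow> (real \<Rightarrow> 'm \<Rightarrow> real ^ 3) \<Rightarrow> real \<Rightarrow> (real \<Rightarrow> 'n \<Rightarrow> nat \<Rightarrow> complex) \<Rightarrow> bool" where
  "cluster_resonances p c\<^sub>0 cl \<omega> \<omega>\<^sub>c C z r s \<longleftrightarrow>
     (\<forall>\<^sub>F \<epsilon> in at_right 0. \<forall>\<alpha>.
        (\<forall>m\<in>{1..card (cluster cl \<alpha>)}. s \<epsilon> \<alpha> m \<in> ball (\<i> * of_real (\<omega>\<^sub>c \<alpha>)) r) \<and>
        (\<forall>w\<in>ball (\<i> * of_real (\<omega>\<^sub>c \<alpha>)) r.
           int (card {m \<in> {1..card (cluster cl \<alpha>)}. s \<epsilon> \<alpha> m = w})
             = zorder (\<lambda>u. det (P_mat c\<^sub>0 \<omega> C (z \<epsilon>) \<epsilon> u)) w)) \<and>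
     (\<forall>\<alpha>. (\<lambda>\<epsilon>. s \<epsilon> \<alpha> 1 - (\<i> * of_real (\<omega>\<^sub>c \<alpha>)
              - \<i> / 2 * of_real ((\<omega>\<^sub>c \<alpha>) ^ 3
                  * perron_eigenvalue (interaction_mat p cl C (z \<epsilon>) \<epsilon> \<alpha>) * \<epsilon> powr (1 - p))))
          \<in> o[at_right 0](\<lambda>\<epsilon>. of_real (\<epsilon> powr (1 - p))))"

text \<open>
  \<open>v\<close> and \<open>w\<close> are automatically nonzero. If the null spaces of \<open>P\<close> have dimension greater than
  one, it is enough that some pair of null vectors survives.
\<close>

definition not_annihilated ::
    "complex ^ 'm ^ 'm \<Rightarrow> complex ^ 'm ^ 'm \<Rightarrow> complex ^ 'm ^ ('m::finite) \<Rightarrow> bool" where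
  "not_annihilated A P B \<longleftrightarrow>
     (\<exists>v w. P *v v = 0 \<and> w v* P = 0 \<and> A *v v \<noteq> 0 \<and> w v* B \<noteq> 0)"

text \<open>
  Algebraic and geometric multiplicity of the zero agree, i.e. \<open>P\<close> has no Jordan chain of length
  two at \<open>s\<close>. Simple zeros of \<open>det P\<close> have this property. Where it fails, the inverse of \<open>P\<close>
  has a pole of order at least two, so no expansion with a simple pole can be expected.
\<close>

definition semisimple_at :: "(complex \<Rightarrow> complex ^ 'm ^ ('m::finite)) \<Rightarrow> complex \<Rightarrow> bool" where
  "semisimple_at P s \<longleftrightarrow> zorder (\<lambda>u. det (P u)) s = int (vec.dim {v. P s *v v = 0})"

definition detuning_gap :: "('n::finite \<Rightarrow> real) \<Rightarrow> real" where
  "detuning_gap \<omega>\<^sub>c = 1 / 2 * Min {\<bar>\<omega>\<^sub>c \<alpha> - \<omega>\<^sub>c \<beta>\<bar> | \<alpha> \<beta>. \<omega>\<^sub>c \<beta> \<noteq> \<omega>\<^sub>c \<alpha>}"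

end

theory Submission
  imports Defs
begin

unbundle no Formal_Power_Series.fps_syntax

text \<open>
  Since \<open>K\<^sub>d\<^sub>y\<^sub>n = D\<inverse> P\<close>, the transfer matrix is \<open>A P\<inverse> s\<^sup>2 B\<^sub>i\<^sub>n\<close>, and everything is read off the entire matrix
  function \<open>P\<close>. It becomes symmetric after weighting its rows with \<open>C\<close>, so left null vectors are obtained
  from right null vectors.

  Put \<open>\<eta> = \<epsilon>\<^sup>1\<^sup>-\<^sup>p\<close> and \<open>s = \<i> \<omega>\<^sub>\<alpha> + \<eta> t\<close>. After division of the rows of cluster \<open>\<alpha>\<close> by \<open>\<eta>\<close>, along any sequence
  \<open>\<epsilon> \<rightarrow> 0\<close> a subsequence of \<open>P\<close> converges to a matrix that is singular exactly when \<open>2 \<i> t / \<omega>\<^sub>\<alpha>\<^sup>3\<close> is an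
  eigenvalue of a limiting interaction matrix. Hurwitz' theorem produces the principal zero, and Rouche's
  theorem counts the zeros of \<open>det P\<close> in the disc. Normalised null vectors at the principal zero converge to
  a multiple of a Perron vector \<open>v\<close>. Simplicity of the zero and the gap of order \<open>\<eta>\<close> follow, because
  \<open>x\<^sup>T C (P a - P b) y = 0\<close> for null vectors \<open>x\<close>, \<open>y\<close> at zeros \<open>a\<close>, \<open>b\<close>, while the quotient by \<open>a - b\<close> tends to a
  nonzero multiple of \<open>\<Sum> C v\<^sup>2\<close>. The sign of the real part comes from the imaginary part of
  \<open>x\<^sup>* C P x / s\<^sup>2 = 0\<close>, in which the retardation \<open>sin (\<tau> Im s)\<close> of the kernel has positive weight.
\<close>

subsection \<open>Kernels and determinants of matrix-valued entire functions\<close>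

text \<open>The centres need not vary continuously with \<epsilon>, so the rescaled interaction
  matrices may have no limit as \<epsilon> tends to 0. What survives is compactness: their entries
  inside a cluster stay between positive constants, hence every limit point is again an interaction
  matrix. For this reason most asymptotic statements are proved by contradiction along a sequence,
  and the gap constant is not explicit. At complex s the weighted \<open>P\<close> is complex
  symmetric, not Hermitian. A null vector could be isotropic for the unconjugated form x^T C x, and
  simplicity could then fail. Convergence to a complex multiple of a positive vector rules this out,
  since the scalar factors out of the form. The leading shift is purely imaginary and says nothing
  about the sign of the real part. The imaginary-part identity is exact in \<epsilon>; its
  right-hand side divided by \<epsilon> has a positive limit as soon as two bubbles of the cluster
  interact. For a single bubble this limit is 0, which is why damping is stated for clusters with at
  least two.\<close>

lemma holomorphic_on_det:
  fixes P :: "complex \<Rightarrow> complex ^ 'm ^ ('m::finite)"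
  assumes "\<And>i j. (\<lambda>s. P s $ i $ j) holomorphic_on S"
  shows "(\<lambda>s. det (P s)) holomorphic_on S"
  unfolding det_def by (intro holomorphic_intros assms)

section \<open>Matrix algebra: diagonal factors, inverses and Cramer's rule\<close>

lemma diag_mult_entry:
  fixes A :: "'a::comm_semiring_1 ^ 'm ^ ('m::finite)"
  shows "((\<chi> i j. if i = j then d i else 0) ** A) $ i $ j = d i * A $ i $ j"
    "(A ** (\<chi> i j. if i = j then d i else 0)) $ i $ j = A $ i $ j * d j"
proof -
  have "(\<Sum>k\<in>UNIV. (if i = k then d i else 0) * A $ k $ j) = (\<Sum>k\<in>UNIV. if i = k then d i * A $ k $ j else 0)"
    by (rule sum.cong) auto
  then show "((\<chi> i j. if i = j then d i else 0) ** A) $ i $ j = d i * A $ i $ j"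
    by (simp add: matrix_matrix_mult_def)
  have "(\<Sum>k\<in>UNIV. A $ i $ k * (if k = j then d k else 0)) = (\<Sum>k\<in>UNIV. if k = j then A $ i $ k * d j else 0)"
    by (rule sum.cong) auto
  then show "(A ** (\<chi> i j. if i = j then d i else 0)) $ i $ j = A $ i $ j * d j"
    by (simp add: matrix_matrix_mult_def)
qed

lemma mat_mult_entry:
  fixes A :: "'a::comm_semiring_1 ^ 'm ^ ('m::finite)"
  shows "(mat c ** A) $ i $ j = c * A $ i $ j" "(A ** mat c) $ i $ j = A $ i $ j * c"
  unfolding mat_def by (rule diag_mult_entry)+

lemma mat_mult_commute:
  fixes A :: "'a::comm_semiring_1 ^ 'm ^ ('m::finite)"
  shows "A ** mat c = mat c ** A"
  by (simp add: vec_eq_iff mat_mult_entry mult.commute)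

text \<open>\<open>matrix_inv\<close> is defined by choice, so it can be evaluated only through
  uniqueness of inverses. A one-sided inverse is enough because the matrices are square over a
  field.\<close>

lemma matrix_inv_unique:
  fixes A B :: "'a::field ^ 'm ^ ('m::finite)"
  assumes "A ** B = mat 1"
  shows "matrix_inv A = B"
proof -
  have BA: "B ** A = mat 1"
    using assms matrix_left_right_inverse by blast
  have *: "A ** matrix_inv A = mat 1 \<and> matrix_inv A ** A = mat 1"
    unfolding matrix_inv_def by (rule someI[of _ B]) (use assms BA in auto)
  have "matrix_inv A = (B ** A) ** matrix_inv A"
    by (simp add: BA)
  also have "\<dots> = B"
    using * by (simp flip: matrix_mul_assoc)
  finally show ?thesis .
qed

lemma matrix_inv_inverse:
  fixes A :: "'a::field ^ 'm ^ ('m::finite)"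
  assumes "det A \<noteq> 0"
  shows "A ** matrix_inv A = mat 1" "matrix_inv A ** A = mat 1"
proof -
  obtain B where B: "A ** B = mat 1"
    using assms invertible_det_nz invertible_right_inverse by blast
  then show "A ** matrix_inv A = mat 1"
    using matrix_inv_unique by metis
  then show "matrix_inv A ** A = mat 1"
    using matrix_left_right_inverse by blast
qed

text \<open>Cramer's rule for the columns of the identity. Writing the inverse as a quotient of
  determinants transfers holomorphy from the entries of a matrix function to its inverse, and
  meromorphy across the zeros of the determinant.\<close>

lemma matrix_inv_entry:
  fixes A :: "'a::field ^ 'm ^ ('m::finite)"
  assumes "det A \<noteq> 0"
  shows "matrix_inv A $ k $ l = det (\<chi> i j. if j = k then mat 1 $ i $ l else A $ i $ j) / det A"
proof -
  have "A *v column l (matrix_inv A) = column l (mat 1)"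
  proof -
    have "(A *v column l (matrix_inv A)) $ i = (A ** matrix_inv A) $ i $ l" for i
      by (simp add: matrix_vector_mult_def matrix_matrix_mult_def column_def)
    then show ?thesis
      by (simp add: matrix_inv_inverse[OF assms] vec_eq_iff column_def)
  qed
  then have "column l (matrix_inv A) = (\<chi> k. det (\<chi> i j. if j = k then column l (mat 1) $ i else A $ i $ j) / det A)"
    using cramer[OF assms] by blast
  then have "column l (matrix_inv A) $ k = det (\<chi> i j. if j = k then column l (mat 1) $ i else A $ i $ j) / det A"
    by simp
  then show ?thesis
    by (simp only: column_def vec_lambda_beta)
qed

lemma matrix_inv_mult:
  fixes A B :: "'a::field ^ 'm ^ ('m::finite)"
  assumes "det A \<noteq> 0" "det B \<noteq> 0"
  shows "matrix_inv (A ** B) = matrix_inv B ** matrix_inv A"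
proof (rule matrix_inv_unique)
  have "(A ** B) ** (matrix_inv B ** matrix_inv A) = A ** (B ** matrix_inv B) ** matrix_inv A"
    by (simp add: matrix_mul_assoc)
  then show "(A ** B) ** (matrix_inv B ** matrix_inv A) = mat 1"
    using assms by (simp add: matrix_inv_inverse)
qed

lemma det_eq_0_iff_kernel:
  fixes A :: "'a::field ^ 'm ^ ('m::finite)"
  shows "det A = 0 \<longleftrightarrow> (\<exists>x. x \<noteq> 0 \<and> A *v x = 0)"
  using invertible_det_nz[of A] invertible_left_inverse[of A] matrix_left_invertible_ker[of A]
  by blast

section \<open>Order of a zero of the determinant against the dimension of the kernel\<close>

lemma holomorphic_factor_zero:
  assumes "f holomorphic_on UNIV" "f a = 0"
  obtains h where "h holomorphic_on UNIV" "\<And>s. f s = (s - a) * h s" "h a = deriv f a"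
proof -
  define h where "h = (\<lambda>s. if s = a then deriv f a else (f s - f a) / (s - a))"
  have "h holomorphic_on UNIV"
    unfolding h_def by (rule pole_lemma_open[OF assms(1) open_UNIV])
  moreover have "f s = (s - a) * h s" for s
    using assms(2) by (simp add: h_def)
  ultimately show ?thesis
    using that by (simp add: h_def)
qed

text \<open>A basis of the kernel is extended to a basis of the whole space, whose vectors become
  the columns of \<open>T\<close>; \<open>J\<close> marks the columns that came from the
  kernel.\<close>

lemma kernel_adapted_matrix:
  fixes A :: "'a::field ^ 'm ^ ('m::finite)"
  obtains T :: "'a ^ 'm ^ 'm" and J :: "'m set"
  where "det T \<noteq> 0" "card J = vec.dim {v. A *v v = 0}" "\<And>j. j \<in> J \<Longrightarrow> A *v column j T = 0"
proof -
  let ?K = "{v. A *v v = 0}"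
  obtain B0 where B0: "B0 \<subseteq> ?K" "vec.independent B0" "?K \<subseteq> vec.span B0" "card B0 = vec.dim ?K"
    using vec.basis_exists by metis
  define B where "B = vec.extend_basis B0"
  have B: "B0 \<subseteq> B" "vec.independent B" "vec.span B = UNIV"
    using vec.extend_basis_superset[OF B0(2)] vec.independent_extend_basis[OF B0(2)]
      vec.span_extend_basis[OF B0(2)] by (auto simp: B_def)
  have finB: "finite B"
    using B(2) vec.finiteI_independent by blast
  have "card B = CARD('m)"
    using B(2,3) vec_dim_card vec.dim_eq_card[of B UNIV] by (metis vec.span_UNIV)
  then obtain g :: "'m \<Rightarrow> 'a ^ 'm" where g: "bij_betw g UNIV B"
    using finite_same_card_bij[OF finite[of UNIV] finB] by metis
  define T :: "'a ^ 'm ^ 'm" where "T = (\<chi> i j. g j $ i)"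
  have col: "column j T = g j" for j
    by (simp add: column_def T_def)
  have "\<exists>S. T ** S = mat 1"
    unfolding matrix_right_invertible_span_columns
  proof -
    have "columns T = B"
      using g by (auto simp: columns_def col bij_betw_def)
    then show "vec.span (columns T) = UNIV" using B by simp
  qed
  then have "det T \<noteq> 0"
    using invertible_det_nz invertible_right_inverse by blast
  moreover define J where "J = {j. g j \<in> B0}"
  have "bij_betw g J B0"
    unfolding bij_betw_def
  proof
    show "inj_on g J" using g by (auto simp: bij_betw_def inj_on_def)
    show "g ` J = B0"
      using g B(1) unfolding J_def bij_betw_def by (auto simp: image_iff)
  qed
  then have "card J = vec.dim ?K"
    using B0(4) bij_betw_same_card by metis
  moreover have "A *v column j T = 0" if "j \<in> J" for j
    using that B0(1) by (auto simp: col J_def)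
  ultimately show ?thesis using that by blast
qed

text \<open>The columns of \<open>P T\<close> with index in \<open>J\<close> vanish at
  \<open>a\<close>, so one factor \<open>s - a\<close> splits off from each of them;
  \<open>G\<close> is what remains. This is the first step towards a local Smith normal
  form.\<close>

lemma kernel_factorization:
  fixes P :: "complex \<Rightarrow> complex ^ 'm ^ ('m::finite)"
  assumes hol: "\<And>i j. (\<lambda>s. P s $ i $ j) holomorphic_on UNIV"
  obtains T :: "complex ^ 'm ^ 'm" and J :: "'m set" and G :: "complex \<Rightarrow> complex ^ 'm ^ 'm"
  where "det T \<noteq> 0" "card J = vec.dim {v. P a *v v = 0}"
    "\<And>i j. (\<lambda>s. G s $ i $ j) holomorphic_on UNIV"
    "\<And>s. P s ** T = G s ** (\<chi> i j. if i = j then if i \<in> J then s - a else 1 else 0)"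
    "\<And>s. det (P s) * det T = det (G s) * (s - a) ^ card J"
proof -
  obtain T :: "complex ^ 'm ^ 'm" and J :: "'m set" where T: "det T \<noteq> 0"
    "card J = vec.dim {v. P a *v v = 0}" "\<And>j. j \<in> J \<Longrightarrow> P a *v column j T = 0"
    by (rule kernel_adapted_matrix[of "P a"]) blast
  have holPT: "(\<lambda>s. (P s ** T) $ i $ j) holomorphic_on UNIV" for i j
    unfolding matrix_matrix_mult_def using hol by (auto intro!: holomorphic_intros)
  have zero: "(P a ** T) $ i $ j = 0" if "j \<in> J" for i j
  proof -
    have "(P a *v column j T) $ i = 0" using T(3)[OF that] by simp
    then show ?thesis
      by (simp add: matrix_vector_mult_def matrix_matrix_mult_def column_def)
  qed
  have "\<exists>h. h holomorphic_on UNIV \<and> (\<forall>s. (P s ** T) $ i $ j = h s * (if j \<in> J then s - a else 1))" for i j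
  proof (cases "j \<in> J")
    case True
    obtain h where "h holomorphic_on UNIV" "\<And>s. (P s ** T) $ i $ j = (s - a) * h s"
      using holomorphic_factor_zero[OF holPT[of i j] zero[OF True, of i]] by blast
    then show ?thesis
      using True by (intro exI[of _ h]) (simp add: mult.commute)
  next
    case False
    then show ?thesis using holPT by auto
  qed
  then have "\<exists>h. \<forall>i j. h i j holomorphic_on UNIV \<and> (\<forall>s. (P s ** T) $ i $ j = h i j s * (if j \<in> J then s - a else 1))"
    by (intro choice allI)
  then obtain h where h: "\<And>i j. h i j holomorphic_on UNIV"
    "\<And>i j s. (P s ** T) $ i $ j = h i j s * (if j \<in> J then s - a else 1)"
    by blast
  define G where "G = (\<lambda>s. \<chi> i j. h i j s)"
  have eq: "P s ** T = G s ** (\<chi> i j. if i = j then if i \<in> J then s - a else 1 else 0)" for s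
  proof -
    have "(\<Sum>k\<in>UNIV. h i k s * (if k = j then if k \<in> J then s - a else 1 else 0)) = h i j s * (if j \<in> J then s - a else 1)" for i j
    proof -
      have "(\<Sum>k\<in>UNIV. h i k s * (if k = j then if k \<in> J then s - a else 1 else 0)) = (\<Sum>k\<in>UNIV. if k = j then h i k s * (if k \<in> J then s - a else 1) else 0)"
        by (rule sum.cong) auto
      then show ?thesis by simp
    qed
    then have "(G s ** (\<chi> i j. if i = j then if i \<in> J then s - a else 1 else 0)) $ i $ j = (P s ** T) $ i $ j" for i j
      unfolding h by (simp only: G_def matrix_matrix_mult_def vec_lambda_beta)
    then show ?thesis by (simp add: vec_eq_iff)
  qed
  have dets: "det (P s) * det T = det (G s) * (s - a) ^ card J" for s
  proof -
    have "det (P s) * det T = det (G s) * det (\<chi> i j. if i = j then if i \<in> J then s - a else 1 else (0::complex))"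
      using arg_cong[OF eq[of s], of det] by (simp only: det_mul)
    also have "det (\<chi> i j. if i = j then if i \<in> J then s - a else 1 else (0::complex)) = (\<Prod>j\<in>UNIV. if j \<in> J then s - a else 1)"
      by (subst det_diagonal) (simp_all cong: if_cong)
    also have "\<dots> = (s - a) ^ card J"
      by (simp add: prod.If_cases)
    finally show ?thesis .
  qed
  have "(\<lambda>s. G s $ i $ j) holomorphic_on UNIV" for i j
    using h by (simp add: G_def)
  then show ?thesis
    by (rule that[OF T(1,2) _ eq dets])
qed

text \<open>A single point \<open>b\<close> with nonzero value excludes the zero function, because
  the plane is connected, and so makes the order at every \<open>a\<close> finite.\<close>

lemma zorder_entire:
  assumes "f holomorphic_on UNIV" "f b \<noteq> 0"
  obtains g \<rho> where "0 \<le> zorder f a" "f a = 0 \<longleftrightarrow> 0 < zorder f a" "0 < \<rho>" "g holomorphic_on cball a \<rho>"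
    "\<And>w. w \<in> cball a \<rho> \<Longrightarrow> f w = g w * (w - a) ^ nat (zorder f a)"
    "\<And>w. w \<in> cball a \<rho> \<Longrightarrow> g w \<noteq> 0"
proof -
  have "\<exists>w\<in>UNIV. f w \<noteq> 0" using assms(2) by blast
  from zorder_exist_zero[OF assms(1) open_UNIV connected_UNIV UNIV_I this, of a]
  obtain \<rho> where *: "if f a = 0 then 0 < zorder f a else zorder f a = 0" "0 < \<rho>"
    "zor_poly f a holomorphic_on cball a \<rho>"
    "\<And>w. w \<in> cball a \<rho> \<Longrightarrow> f w = zor_poly f a w * (w - a) ^ nat (zorder f a)"
    "\<And>w. w \<in> cball a \<rho> \<Longrightarrow> zor_poly f a w \<noteq> 0"
    by blast
  show ?thesis
    by (rule that[OF _ _ *(2-5)]) (use *(1) in \<open>auto split: if_splits\<close>)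
qed

text \<open>The factor \<open>(s - a) ^ card J\<close> already accounts for the dimension of the
  kernel, and the entire cofactor \<open>f\<close> can only raise the order. This is the inequality
  between geometric and algebraic multiplicity.\<close>

lemma zorder_det_ge_kernel_dim:
  fixes P :: "complex \<Rightarrow> complex ^ 'm ^ ('m::finite)"
  assumes hol: "\<And>i j. (\<lambda>s. P s $ i $ j) holomorphic_on UNIV"
    and nz: "det (P b) \<noteq> 0"
  shows "int (vec.dim {v. P a *v v = 0}) \<le> zorder (\<lambda>s. det (P s)) a"
proof -
  obtain T :: "complex ^ 'm ^ 'm" and J :: "'m set" and G :: "complex \<Rightarrow> complex ^ 'm ^ 'm" where
    T: "det T \<noteq> 0" "card J = vec.dim {v. P a *v v = 0}"
    "\<And>i j. (\<lambda>s. G s $ i $ j) holomorphic_on UNIV"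
    "\<And>s. det (P s) * det T = det (G s) * (s - a) ^ card J"
    by (rule kernel_factorization[OF hol, of a]) blast
  define f where "f = (\<lambda>s. det (G s) / det T)"
  have detP: "det (P s) = f s * (s - a) ^ card J" for s
    using T(1) T(4)[of s] by (simp add: f_def field_simps)
  have f: "f holomorphic_on UNIV"
    unfolding f_def using T(1) by (intro holomorphic_intros holomorphic_on_det T(3)) auto
  have fb: "f b \<noteq> 0" using nz detP by auto
  obtain g \<rho> where \<rho>: "zorder f a \<ge> 0" "\<rho> > 0" "g holomorphic_on cball a \<rho>"
    "\<And>w. w \<in> cball a \<rho> \<Longrightarrow> f w = g w * (w - a) ^ nat (zorder f a)"
    "\<And>w. w \<in> cball a \<rho> \<Longrightarrow> g w \<noteq> 0"
    by (rule zorder_entire[OF f fb, of a]) blast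
  have "zorder (\<lambda>s. det (P s)) a = int (nat (zorder f a) + card J)"
  proof (rule zorder_eqI[of "ball a \<rho>" _ g])
    show "g holomorphic_on ball a \<rho>"
      using \<rho>(3) by (rule holomorphic_on_subset) auto
    show "det (P w) = g w * (w - a) powi int (nat (zorder f a) + card J)"
      if "w \<in> ball a \<rho>" for w
      using \<rho>(4)[of w] that unfolding detP power_int_of_nat power_add by simp
  qed (use \<rho> in auto)
  then show ?thesis using T(2) by simp
qed

text \<open>If the order equals the dimension of the kernel, the factors split off from the kernel
  columns exhaust the zero, so that nothing of it is left in \<open>det G\<close>.\<close>

lemma zorder_det_eq_kernel_dim_factor:
  fixes P :: "complex \<Rightarrow> complex ^ 'm ^ ('m::finite)"
  assumes hol: "\<And>i j. (\<lambda>s. P s $ i $ j) holomorphic_on UNIV"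
    and nz: "det (P b) \<noteq> 0"
    and ord: "zorder (\<lambda>s. det (P s)) a = int (vec.dim {v. P a *v v = 0})"
  obtains T :: "complex ^ 'm ^ 'm" and J :: "'m set" and G :: "complex \<Rightarrow> complex ^ 'm ^ 'm"
  where "\<And>i j. (\<lambda>s. G s $ i $ j) holomorphic_on UNIV" "det (G a) \<noteq> 0" "det T \<noteq> 0"
    "\<And>s. P s ** T = G s ** (\<chi> i j. if i = j then if i \<in> J then s - a else 1 else 0)"
proof -
  obtain T :: "complex ^ 'm ^ 'm" and J :: "'m set" and G :: "complex \<Rightarrow> complex ^ 'm ^ 'm" where
    T: "det T \<noteq> 0" "card J = vec.dim {v. P a *v v = 0}"
    "\<And>i j. (\<lambda>s. G s $ i $ j) holomorphic_on UNIV"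
    "\<And>s. P s ** T = G s ** (\<chi> i j. if i = j then if i \<in> J then s - a else 1 else 0)"
    "\<And>s. det (P s) * det T = det (G s) * (s - a) ^ card J"
    by (rule kernel_factorization[OF hol, of a]) blast
  define f where "f = (\<lambda>s. det (P s))"
  have f: "f holomorphic_on UNIV" "f b \<noteq> 0"
    using nz unfolding f_def by (auto intro: holomorphic_on_det hol)
  obtain g \<rho> where \<rho>: "\<rho> > 0" "g holomorphic_on cball a \<rho>"
    "\<And>w. w \<in> cball a \<rho> \<Longrightarrow> f w = g w * (w - a) ^ nat (zorder f a)"
    "\<And>w. w \<in> cball a \<rho> \<Longrightarrow> g w \<noteq> 0"
    by (rule zorder_entire[OF f, of a]) blast
  have P_eq: "det (P w) = g w * (w - a) ^ card J" if "w \<in> cball a \<rho>" for w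
    using \<rho>(3)[OF that] ord T(2) by (simp add: f_def)
  \<comment> \<open>The power of \<open>w - a\<close> cancels only away from \<open>a\<close>; the
    value at \<open>a\<close> is recovered below from continuity of both sides.\<close>
  have "det (G w) = g w * det T" if "w \<in> cball a \<rho>" "w \<noteq> a" for w
  proof -
    have "det (G w) * (w - a) ^ card J = g w * det T * (w - a) ^ card J"
      using T(5)[of w] P_eq[of w] that by (simp add: mult_ac)
    then show ?thesis using that by simp
  qed
  then have ev: "\<forall>\<^sub>F w in at a. det (G w) = g w * det T"
    unfolding eventually_at using \<rho>(1) by (intro exI[of _ \<rho>]) (simp add: dist_commute)
  have detG: "(\<lambda>s. det (G s)) holomorphic_on UNIV"
    by (intro holomorphic_on_det T(3))
  have "((\<lambda>w. det (G w)) \<longlongrightarrow> det (G a)) (at a)"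
    using holomorphic_on_imp_continuous_on[OF detG] by (simp add: continuous_on_def)
  moreover have "((\<lambda>w. g w * det T) \<longlongrightarrow> g a * det T) (at a)"
  proof -
    have "continuous_on (ball a \<rho>) g"
      using \<rho>(2) holomorphic_on_imp_continuous_on continuous_on_subset ball_subset_cball by metis
    then have "isCont g a"
      using \<rho>(1) by (simp add: continuous_on_eq_continuous_at)
    then show ?thesis by (intro tendsto_intros) (simp add: isCont_def)
  qed
  ultimately have "det (G a) = g a * det T"
    using ev tendsto_cong[OF ev] tendsto_unique[OF trivial_limit_at] by blast
  then have "det (G a) \<noteq> 0" using T(1) \<rho> by simp
  then show ?thesis using that T by blast
qed

text \<open>
  If the order of the zero of \<open>det P\<close> is the dimension of the kernel, then \<open>P\<inverse>\<close> has
  a simple pole: \<open>E\<close> is \<open>(s - a) P\<inverse>\<close>.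
\<close>

lemma semisimple_inverse:
  fixes P :: "complex \<Rightarrow> complex ^ 'm ^ ('m::finite)"
  assumes hol: "\<And>i j. (\<lambda>s. P s $ i $ j) holomorphic_on UNIV"
    and nz: "det (P b) \<noteq> 0"
    and ord: "zorder (\<lambda>s. det (P s)) a = int (vec.dim {v. P a *v v = 0})"
  obtains E :: "complex \<Rightarrow> complex ^ 'm ^ 'm" and \<rho>
  where "\<rho> > 0" "\<And>i j. (\<lambda>s. E s $ i $ j) holomorphic_on ball a \<rho>"
    "\<And>s. s \<in> ball a \<rho> \<Longrightarrow> P s ** E s = mat (s - a)"
proof -
  obtain T :: "complex ^ 'm ^ 'm" and J :: "'m set" and G :: "complex \<Rightarrow> complex ^ 'm ^ 'm" where
    T: "\<And>i j. (\<lambda>s. G s $ i $ j) holomorphic_on UNIV" "det (G a) \<noteq> 0" "det T \<noteq> 0"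
    "\<And>s. P s ** T = G s ** (\<chi> i j. if i = j then if i \<in> J then s - a else 1 else 0)"
    by (rule zorder_det_eq_kernel_dim_factor[OF assms]) blast
  have detG: "(\<lambda>s. det (G s)) holomorphic_on UNIV"
    by (intro holomorphic_on_det T(1))
  then have "isCont (\<lambda>s. det (G s)) a"
    using holomorphic_on_imp_continuous_on continuous_on_eq_continuous_at open_UNIV by blast
  then obtain \<rho> where \<rho>: "\<rho> > 0" "\<And>s. s \<in> ball a \<rho> \<Longrightarrow> det (G s) \<noteq> 0"
    using continuous_at_avoid[of a "\<lambda>s. det (G s)" 0] T(2) by (metis mem_ball)
  \<comment> \<open>\<open>S\<close> exchanges the entries \<open>1\<close> and \<open>s - a\<close>
    of the diagonal factor, so that their product is \<open>s - a\<close> times the identity. Thus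
    \<open>E\<close> is built without dividing by \<open>s - a\<close>.\<close>
  define S where "S = (\<lambda>s. \<chi> i j. if i = (j::'m) then if i \<in> J then 1 else s - a else (0::complex))"
  define E where "E = (\<lambda>s. T ** S s ** matrix_inv (G s))"
  have hol_inv: "(\<lambda>s. matrix_inv (G s) $ k $ l) holomorphic_on ball a \<rho>" for k l
  proof -
    have 1: "(\<lambda>s. (\<chi> i j. if j = k then mat 1 $ i $ l else G s $ i $ j) $ i $ j) holomorphic_on ball a \<rho>" for i j
      using T(1)[of i j] by (cases "j = k") (auto intro: holomorphic_on_subset)
    have "(\<lambda>s. det (\<chi> i j. if j = k then mat 1 $ i $ l else G s $ i $ j) / det (G s)) holomorphic_on ball a \<rho>"
      using \<rho>(2) holomorphic_on_subset[OF detG, of "ball a \<rho>"] holomorphic_on_det[OF 1]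
      by (intro holomorphic_on_divide) auto
    then show ?thesis
      by (rule holomorphic_transform) (simp add: matrix_inv_entry[OF \<rho>(2)])
  qed
  have "(\<lambda>s. S s $ i $ j) holomorphic_on X" for i j X
    unfolding S_def by (cases "i = j"; cases "j \<in> J") (auto intro!: holomorphic_intros)
  then have "(\<lambda>s. E s $ i $ j) holomorphic_on ball a \<rho>" for i j
    unfolding E_def matrix_matrix_mult_def using hol_inv by (auto intro!: holomorphic_intros)
  moreover have "P s ** E s = mat (s - a)" if "s \<in> ball a \<rho>" for s
  proof -
    let ?D = "(\<chi> i j. if i = j then if i \<in> J then s - a else 1 else (0::complex)) :: complex ^ 'm ^ 'm"
    have DS: "?D ** S s = mat (s - a)"
    proof -
      have "(?D ** S s) $ i $ j = mat (s - a) $ i $ j" for i j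
        unfolding diag_mult_entry(1) by (simp add: S_def mat_def)
      then show ?thesis by (simp add: vec_eq_iff)
    qed
    have "P s ** E s = (P s ** T) ** S s ** matrix_inv (G s)"
      by (simp add: E_def matrix_mul_assoc)
    also have "\<dots> = G s ** mat (s - a) ** matrix_inv (G s)"
      by (simp add: T(4) DS flip: matrix_mul_assoc)
    also have "\<dots> = mat (s - a) ** (G s ** matrix_inv (G s))"
      by (simp add: mat_mult_commute[of "G s"] matrix_mul_assoc)
    also have "\<dots> = mat (s - a)"
      using matrix_inv_inverse[OF \<rho>(2)[OF that]] by simp
    finally show ?thesis .
  qed
  ultimately show ?thesis using that \<rho>(1) by blast
qed

text \<open>\<open>coord\<close> makes the kernel of \<open>P a\<close> a line detected by
  coordinate \<open>k\<close>. Cramer's lemma replaces column \<open>k\<close> of \<open>P s\<close>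
  by \<open>P s x = (s - a) h s\<close>, which gives
  \<open>x_k det (P s) = (s - a) det (M s)\<close>. The zero is simple once \<open>det (M a)\<close>
  is nonzero: pairing \<open>M a u = 0\<close> with \<open>y\<close> kills all columns except
  \<open>k\<close> and leaves \<open>u_k\<close> times the transversality sum, so
  \<open>u_k = 0\<close>, and then \<open>coord\<close> forces \<open>u = 0\<close>.\<close>

lemma det_simple_zero:
  fixes P :: "complex \<Rightarrow> complex ^ 'm ^ ('m::finite)" and x y :: "complex ^ 'm"
  assumes hol: "\<And>i j. (\<lambda>s. P s $ i $ j) holomorphic_on UNIV"
    and right: "P a *v x = 0" and left: "y v* P a = 0"
    and coord: "\<And>u. P a *v u = 0 \<Longrightarrow> u $ k = 0 \<Longrightarrow> u = 0"
    and trans: "(\<Sum>i\<in>UNIV. \<Sum>j\<in>UNIV. y $ i * deriv (\<lambda>s. P s $ i $ j) a * x $ j) \<noteq> 0"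
  shows "zorder (\<lambda>s. det (P s)) a = 1"
proof -
  have "x \<noteq> 0" using trans by auto
  then have xk: "x $ k \<noteq> 0" using coord right by blast
  have holx: "(\<lambda>s. (P s *v x) $ i) holomorphic_on UNIV" for i
    unfolding matrix_vector_mult_def using hol by (auto intro!: holomorphic_intros)
  have "\<exists>h. h holomorphic_on UNIV \<and> (\<forall>s. (P s *v x) $ i = (s - a) * h s) \<and> h a = deriv (\<lambda>s. (P s *v x) $ i) a" for i
  proof -
    have "(P a *v x) $ i = 0" by (simp add: right)
    from holomorphic_factor_zero[OF holx this] show ?thesis by blast
  qed
  then obtain h where h: "\<And>i. h i holomorphic_on UNIV" "\<And>i s. (P s *v x) $ i = (s - a) * h i s"
    "\<And>i. h i a = deriv (\<lambda>s. (P s *v x) $ i) a"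
    by metis
  have ha: "h i a = (\<Sum>j\<in>UNIV. deriv (\<lambda>s. P s $ i $ j) a * x $ j)" for i
  proof -
    have "((\<lambda>s. \<Sum>j\<in>UNIV. P s $ i $ j * x $ j) has_field_derivative (\<Sum>j\<in>UNIV. deriv (\<lambda>s. P s $ i $ j) a * x $ j)) (at a)"
      using holomorphic_derivI[OF hol open_UNIV UNIV_I] by (auto intro!: derivative_eq_intros)
    then show ?thesis
      unfolding h(3) matrix_vector_mult_def by (auto intro!: DERIV_imp_deriv)
  qed
  define M :: "complex \<Rightarrow> complex ^ 'm ^ 'm" where "M = (\<lambda>s. \<chi> i j. if j = k then h i s else P s $ i $ j)"
  have M0: "det (M a) \<noteq> 0"
  proof
    assume "det (M a) = 0"
    then obtain u where u: "u \<noteq> 0" "M a *v u = 0" using det_eq_0_iff_kernel by metis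
    have row: "(\<Sum>j\<in>UNIV. M a $ i $ j * u $ j) = 0" for i
      using u(2) by (simp add: matrix_vector_mult_def vec_eq_iff)
    \<comment> \<open>\<open>u'\<close> removes coordinate \<open>k\<close>, so that
      \<open>M a\<close> acts on it as \<open>P a\<close> does.\<close>
    define u' where "u' = (\<chi> j. if j = k then 0 else u $ j)"
    have split: "(\<Sum>j\<in>UNIV. M a $ i $ j * u $ j) = h i a * u $ k + (P a *v u') $ i" for i
    proof -
      have "(\<Sum>j\<in>UNIV. M a $ i $ j * u $ j) = (\<Sum>j\<in>UNIV. (if j = k then h i a * u $ k else 0) + P a $ i $ j * u' $ j)"
        by (rule sum.cong) (auto simp: M_def u'_def)
      then show ?thesis by (simp add: sum.distrib matrix_vector_mult_def)
    qed
    have lft: "(\<Sum>i\<in>UNIV. y $ i * P a $ i $ j) = 0" for j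
      using left by (simp add: vector_matrix_mult_def vec_eq_iff mult.commute)
    have "0 = (\<Sum>i\<in>UNIV. y $ i * (h i a * u $ k + (P a *v u') $ i))"
      using row split by simp
    also have "\<dots> = (\<Sum>i\<in>UNIV. y $ i * h i a) * u $ k + (\<Sum>i\<in>UNIV. \<Sum>j\<in>UNIV. y $ i * P a $ i $ j * u' $ j)"
      by (simp add: distrib_left sum.distrib matrix_vector_mult_def sum_distrib_left sum_distrib_right mult.assoc)
    also have "(\<Sum>i\<in>UNIV. \<Sum>j\<in>UNIV. y $ i * P a $ i $ j * u' $ j) = (\<Sum>j\<in>UNIV. (\<Sum>i\<in>UNIV. y $ i * P a $ i $ j) * u' $ j)"
      by (subst sum.swap) (simp add: sum_distrib_right)
    also have "\<dots> = 0" by (simp add: lft)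
    also have "(\<Sum>i\<in>UNIV. y $ i * h i a) = (\<Sum>i\<in>UNIV. \<Sum>j\<in>UNIV. y $ i * deriv (\<lambda>s. P s $ i $ j) a * x $ j)"
      by (simp add: ha sum_distrib_left mult.assoc)
    finally have uk: "u $ k = 0" using trans by simp
    then have "P a *v u' = 0"
      using row split by (simp add: vec_eq_iff)
    then have "u' = 0" using coord by (simp add: u'_def)
    then show False using uk u(1) by (auto simp: u'_def vec_eq_iff split: if_splits)
  qed
  have eq: "det (P s) = det (M s) / x $ k * (s - a)" for s
  proof -
    have "x $ k * det (P s) = det (\<chi> i j. if j = k then (P s *v x) $ i else P s $ i $ j)"
      by (rule cramer_lemma[symmetric])
    also have "\<dots> = det (\<chi> i j. if j = k then (s - a) * h i s else P s $ i $ j)"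
      unfolding h(2) ..
    \<comment> \<open>The common factor \<open>s - a\<close> sits in a column; transposition makes
      it a row factor, as \<open>det_row_mul\<close> expects.\<close>
    also have "\<dots> = det (transpose (\<chi> i j. if j = k then (s - a) * h i s else P s $ i $ j))"
      by (rule det_transpose[symmetric])
    also have "transpose (\<chi> i j. if j = k then (s - a) * h i s else P s $ i $ j) =
        (\<chi> j. if j = k then (s - a) *s (\<chi> i. h i s) else (\<chi> i. P s $ i $ j))"
      by (vector transpose_def)
    also have "det \<dots> = (s - a) * det (\<chi> j. if j = k then (\<chi> i. h i s) else (\<chi> i. P s $ i $ j))"
      by (rule det_row_mul)
    also have "(\<chi> j. if j = k then (\<chi> i. h i s) else (\<chi> i. P s $ i $ j)) = transpose (M s)"
      by (auto simp: vec_eq_iff transpose_def M_def)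
    finally show ?thesis using xk by (simp add: det_transpose field_simps)
  qed
  have "(\<lambda>s. M s $ i $ j) holomorphic_on UNIV" for i j
    using h(1) hol by (cases "j = k") (auto simp: M_def)
  then have "(\<lambda>s. det (M s) / x $ k) holomorphic_on UNIV"
    using xk by (intro holomorphic_intros holomorphic_on_det) auto
  then show ?thesis
    by (rule zorder_eqI[OF open_UNIV UNIV_I]) (use M0 xk eq in auto)
qed

subsection \<open>Residues and meromorphy of the resolvent\<close>

lemma eventually_nonzero_entire:
  assumes "f holomorphic_on UNIV" "f b \<noteq> 0"
  shows "\<forall>\<^sub>F s in at a. f s \<noteq> (0::complex)"
proof -
  obtain g \<rho> where *: "0 < \<rho>" "\<And>w. w \<in> cball a \<rho> \<Longrightarrow> f w = g w * (w - a) ^ nat (zorder f a)"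
    "\<And>w. w \<in> cball a \<rho> \<Longrightarrow> g w \<noteq> 0"
    by (rule zorder_entire[OF assms, of a]) blast
  then show ?thesis
    unfolding eventually_at by (intro exI[of _ \<rho>]) (simp add: dist_commute)
qed

lemma holomorphic_on_matrix_mult:
  fixes F :: "complex \<Rightarrow> complex ^ 'k ^ 'l" and G :: "complex \<Rightarrow> complex ^ 'm ^ 'k"
  assumes "\<And>i j. (\<lambda>s. F s $ i $ j) holomorphic_on S" "\<And>i j. (\<lambda>s. G s $ i $ j) holomorphic_on S"
  shows "(\<lambda>s. (F s ** G s) $ i $ j) holomorphic_on S"
  unfolding matrix_matrix_mult_def using assms by (auto intro!: holomorphic_intros)

lemma vector_matrix_mult_entry: "(w v* A) $ j = (\<Sum>i\<in>UNIV. w $ i * A $ i $ j)"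
  for A :: "'a::comm_semiring_1 ^ 'm ^ 'n"
  by (simp add: vector_matrix_mult_def mult.commute)

text \<open>
  \<open>E a\<close> is the residue of \<open>P\<inverse>\<close>. For a left null vector \<open>w\<close> of \<open>P a\<close>, dividing
  \<open>w P(s) E(s) = (s - a) w\<close> by \<open>s - a\<close> shows that \<open>w\<close> lies in the row space of \<open>E a\<close>.
\<close>

lemma left_null_vector_in_residue_rows:
  fixes P E :: "complex \<Rightarrow> complex ^ 'm ^ ('m::finite)"
  assumes hol: "\<And>i j. (\<lambda>s. P s $ i $ j) holomorphic_on UNIV"
    and \<rho>: "\<rho> > 0" and E: "\<And>i j. (\<lambda>s. E s $ i $ j) holomorphic_on ball a \<rho>"
    and PE: "\<And>s. s \<in> ball a \<rho> \<Longrightarrow> P s ** E s = mat (s - a)"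
    and w: "w v* P a = 0"
  shows "\<exists>y. w = y v* E a"
proof -
  have holw: "(\<lambda>s. (w v* P s) $ j) holomorphic_on UNIV" for j
    unfolding vector_matrix_mult_entry using hol by (auto intro!: holomorphic_intros)
  have "\<exists>h. h holomorphic_on UNIV \<and> (\<forall>s. (w v* P s) $ j = (s - a) * h s)" for j
  proof -
    have "(w v* P a) $ j = 0" by (simp add: w)
    from holomorphic_factor_zero[OF holw this] show ?thesis by blast
  qed
  then have "\<exists>h. \<forall>j. h j holomorphic_on UNIV \<and> (\<forall>s. (w v* P s) $ j = (s - a) * h j s)"
    by (intro choice allI)
  then obtain h where h: "\<And>j. h j holomorphic_on UNIV" "\<And>j s. (w v* P s) $ j = (s - a) * h j s"
    by blast
  have eq: "(\<Sum>j\<in>UNIV. h j s * E s $ j $ l) = w $ l" if "s \<in> ball a \<rho>" "s \<noteq> a" for s l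
  proof -
    have "(s - a) * (\<Sum>j\<in>UNIV. h j s * E s $ j $ l) = ((w v* P s) v* E s) $ l"
      by (simp only: vector_matrix_mult_entry[of _ "E s"] h(2) sum_distrib_left mult.assoc)
    also have "\<dots> = (w v* mat (s - a)) $ l"
      by (simp add: PE[OF that(1)] vector_matrix_mul_assoc)
    also have "\<dots> = (\<Sum>i\<in>UNIV. if i = l then (s - a) * w $ i else 0)"
      unfolding vector_matrix_mult_entry by (rule sum.cong) (auto simp: mat_def)
    also have "\<dots> = (s - a) * w $ l"
      by simp
    finally show ?thesis using that by simp
  qed
  \<comment> \<open>Cancelling \<open>s - a\<close> proves the identity on the punctured ball only;
    continuity carries it to \<open>a\<close>.\<close>
  have "(\<Sum>j\<in>UNIV. h j a * E a $ j $ l) = w $ l" for l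
  proof -
    have "(\<lambda>s. \<Sum>j\<in>UNIV. h j s * E s $ j $ l) holomorphic_on ball a \<rho>"
      using E h(1) by (intro holomorphic_intros) (auto intro: holomorphic_on_subset)
    then have "isCont (\<lambda>s. \<Sum>j\<in>UNIV. h j s * E s $ j $ l) a"
      using holomorphic_on_imp_continuous_on continuous_on_eq_continuous_at open_ball \<rho> centre_in_ball by blast
    then have 1: "((\<lambda>s. \<Sum>j\<in>UNIV. h j s * E s $ j $ l) \<longlongrightarrow> (\<Sum>j\<in>UNIV. h j a * E a $ j $ l)) (at a)"
      by (simp add: isCont_def)
    have "\<forall>\<^sub>F s in at a. (\<Sum>j\<in>UNIV. h j s * E s $ j $ l) = w $ l"
      unfolding eventually_at using eq \<rho> by (intro exI[of _ \<rho>]) (simp add: dist_commute)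
    then have "((\<lambda>s. \<Sum>j\<in>UNIV. h j s * E s $ j $ l) \<longlongrightarrow> w $ l) (at a)"
      by (rule tendsto_eventually)
    with 1 show ?thesis using tendsto_unique[OF trivial_limit_at] by blast
  qed
  then have "w = (\<chi> j. h j a) v* E a"
    by (simp add: vec_eq_iff vector_matrix_mult_entry)
  then show ?thesis by blast
qed

text \<open>\<open>W = A E X\<close> is \<open>u - a\<close> times the function to be expanded, so
  \<open>W a\<close> is the residue and the difference quotient of \<open>W\<close> the regular
  part. The residue is nonzero: \<open>A\<close> can be cancelled, and \<open>w\<close> is a
  combination of the rows of \<open>E a\<close>, so \<open>E a X a = 0\<close> would give
  \<open>w X a = 0\<close>.\<close>

lemma simple_pole_expansion:
  fixes P X :: "complex \<Rightarrow> complex ^ 'm ^ ('m::finite)" and A :: "complex ^ 'm ^ 'm"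
  assumes hol: "\<And>i j. (\<lambda>s. P s $ i $ j) holomorphic_on UNIV"
    and nz: "det (P b) \<noteq> 0"
    and ord: "zorder (\<lambda>s. det (P s)) a = int (vec.dim {v. P a *v v = 0})"
    and holX: "\<And>i j. (\<lambda>s. X s $ i $ j) holomorphic_on UNIV"
    and A: "det A \<noteq> 0" and w: "w v* P a = 0" and wX: "w v* X a \<noteq> 0" and r: "0 < r"
  obtains R Hreg \<rho> where "0 < \<rho>" "\<rho> \<le> r" "R \<noteq> 0"
    "\<And>i j. (\<lambda>u. Hreg u $ i $ j) analytic_on ball a \<rho>" "bounded (Hreg ` ball a \<rho>)"
    "\<And>u. u \<in> ball a \<rho> - {a} \<Longrightarrow> det (P u) \<noteq> 0"
    "\<And>u. u \<in> ball a \<rho> - {a} \<Longrightarrow> A ** matrix_inv (P u) ** X u = mat (1 / (u - a)) ** R + Hreg u"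
proof -
  obtain E :: "complex \<Rightarrow> complex ^ 'm ^ 'm" and \<rho>0 where E: "\<rho>0 > 0"
    "\<And>i j. (\<lambda>s. E s $ i $ j) holomorphic_on ball a \<rho>0"
    "\<And>s. s \<in> ball a \<rho>0 \<Longrightarrow> P s ** E s = mat (s - a)"
    by (rule semisimple_inverse[OF hol nz ord]) blast
  define W where "W = (\<lambda>u. A ** E u ** X u)"
  have holW: "(\<lambda>u. W u $ i $ j) holomorphic_on ball a \<rho>0" for i j
    unfolding W_def using E(2) holomorphic_on_subset[OF holX subset_UNIV]
    by (intro holomorphic_on_matrix_mult) auto
  define Hreg :: "complex \<Rightarrow> complex ^ 'm ^ 'm" where "Hreg = (\<lambda>u. \<chi> i j. if u = a then deriv (\<lambda>u. W u $ i $ j) a else (W u $ i $ j - W a $ i $ j) / (u - a))"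
  have holH: "(\<lambda>u. Hreg u $ i $ j) holomorphic_on ball a \<rho>0" for i j
    using pole_lemma_open[OF holW open_ball, of a i j] by (simp add: Hreg_def)
  \<comment> \<open>Half the radius leaves room for the closed ball, whose compactness bounds
    \<open>Hreg\<close>; \<open>r\<close> lets a caller shrink the ball further.\<close>
  define \<rho> where "\<rho> = min (\<rho>0 / 2) r"
  have \<rho>: "0 < \<rho>" "\<rho> \<le> r" "\<rho> < \<rho>0" using E(1) r by (auto simp: \<rho>_def)
  have sub: "cball a \<rho> \<subseteq> ball a \<rho>0" using \<rho> by auto
  have "continuous_on (cball a \<rho>) (\<lambda>u. Hreg u $ i $ j)" for i j
    using holH[of i j] sub holomorphic_on_imp_continuous_on holomorphic_on_subset by metis
  then have "continuous_on (cball a \<rho>) (\<lambda>u. \<chi> i j. Hreg u $ i $ j)"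
    by (intro continuous_on_vec_lambda)
  then have "continuous_on (cball a \<rho>) Hreg"
    by simp
  then have "bounded (Hreg ` cball a \<rho>)"
    using compact_continuous_image compact_cball compact_imp_bounded by blast
  then have bdd: "bounded (Hreg ` ball a \<rho>)"
    by (rule bounded_subset) auto
  have ana: "(\<lambda>u. Hreg u $ i $ j) analytic_on ball a \<rho>" for i j
    using holH[of i j] sub ball_subset_cball analytic_on_open[OF open_ball] holomorphic_on_subset
    by (metis order_trans)
  have inv: "P u ** (mat (1 / (u - a)) ** E u) = mat 1" if "u \<in> ball a \<rho> - {a}" for u
  proof -
    have "P u ** (mat (1 / (u - a)) ** E u) = mat (1 / (u - a)) ** (P u ** E u)"
      by (simp add: mat_mult_commute matrix_mul_assoc)
    also have "P u ** E u = mat (u - a)" using that \<rho>(3) by (intro E(3)) auto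
    also have "mat (1 / (u - a)) ** mat (u - a) = (mat 1 :: complex ^ 'm ^ 'm)"
      using that by (simp add: vec_eq_iff mat_mult_entry) (simp add: mat_def)
    finally show ?thesis .
  qed
  then have detP: "det (P u) \<noteq> 0" if "u \<in> ball a \<rho> - {a}" for u
    using that invertible_det_nz invertible_right_inverse by blast
  have expansion: "A ** matrix_inv (P u) ** X u = mat (1 / (u - a)) ** W a + Hreg u" if "u \<in> ball a \<rho> - {a}" for u
  proof -
    have "A ** matrix_inv (P u) ** X u = mat (1 / (u - a)) ** W u"
      unfolding matrix_inv_unique[OF inv[OF that]] W_def
      by (simp add: matrix_mul_assoc mat_mult_commute[of A])
    also have "\<dots> = mat (1 / (u - a)) ** W a + Hreg u"
      using that by (simp add: vec_eq_iff mat_mult_entry Hreg_def diff_divide_distrib)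
    finally show ?thesis .
  qed
  have "W a \<noteq> 0"
  proof
    assume "W a = 0"
    then have "A ** (E a ** X a) = 0"
      by (simp add: W_def matrix_mul_assoc)
    then have "matrix_inv A ** (A ** (E a ** X a)) = 0"
      by (simp add: vec_eq_iff matrix_matrix_mult_def)
    then have EX: "E a ** X a = 0"
      by (simp add: matrix_mul_assoc matrix_inv_inverse[OF A])
    obtain y where "w = y v* E a"
      using left_null_vector_in_residue_rows[OF hol E w] by blast
    then have "w v* X a = y v* (E a ** X a)"
      by (simp flip: vector_matrix_mul_assoc)
    also have "\<dots> = 0" by (simp add: EX vec_eq_iff vector_matrix_mult_entry)
    finally show False using wX by simp
  qed
  then show ?thesis
    using that[OF \<rho>(1,2) _ ana bdd detP expansion] by blast
qed

text \<open>The entries behave independently: where the entry of \<open>R\<close> is nonzero the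
  order is -1, and where it vanishes the entry has a finite limit and hence no pole. Both cases
  matter, since \<open>mat_simple_pole\<close> speaks about every entry that has a pole.\<close>

lemma mat_simple_pole_expansion:
  fixes H :: "complex \<Rightarrow> complex ^ 'm ^ ('m::finite)"
  assumes U: "open U" "a \<in> U" and R: "R \<noteq> 0"
    and ana: "\<And>i j. (\<lambda>u. Hreg u $ i $ j) analytic_on U"
    and eq: "\<And>u. u \<in> U - {a} \<Longrightarrow> H u = mat (1 / (u - a)) ** R + Hreg u"
  shows "mat_simple_pole H a"
proof -
  have entry: "H u $ i $ j = R $ i $ j / (u - a) + Hreg u $ i $ j" if "u \<in> U - {a}" for u i j
    using eq[OF that] by (simp add: mat_mult_entry)
  have ev: "\<forall>\<^sub>F u in at a. u \<in> U - {a}"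
    using eventually_at_topological U by blast
  have lim: "((\<lambda>u. Hreg u $ i $ j) \<longlongrightarrow> Hreg a $ i $ j) (at a)" for i j
    using ana U(2) analytic_at_imp_isCont analytic_on_analytic_at unfolding isCont_def by blast
  have no_pole: "\<not> is_pole (\<lambda>w. H w $ i $ j) a" if "R $ i $ j = 0" for i j
  proof -
    have "\<forall>\<^sub>F u in at a. H u $ i $ j = Hreg u $ i $ j"
      using ev by eventually_elim (simp add: entry that)
    then have "((\<lambda>u. H u $ i $ j) \<longlongrightarrow> Hreg a $ i $ j) (at a)"
      using tendsto_cong[of "\<lambda>u. H u $ i $ j" "\<lambda>u. Hreg u $ i $ j"] lim by simp
    then show ?thesis
      unfolding is_pole_def using not_tendsto_and_filterlim_at_infinity[OF trivial_limit_at] by blast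
  qed
  have pole: "is_pole (\<lambda>w. H w $ i $ j) a \<and> zorder (\<lambda>w. H w $ i $ j) a = -1" if "R $ i $ j \<noteq> 0" for i j
  proof
    have "filterlim (\<lambda>u. R $ i $ j / (u - a)) at_infinity (at a)"
      using that by (auto intro!: filterlim_divide_at_infinity tendsto_eq_intros filterlim_atI
          simp: eventually_at_filter)
    then have "filterlim (\<lambda>u. Hreg u $ i $ j + R $ i $ j / (u - a)) at_infinity (at a)"
      using lim tendsto_add_filterlim_at_infinity by blast
    then show "is_pole (\<lambda>w. H w $ i $ j) a"
      unfolding is_pole_def
      by (rule filterlim_mono_eventually[OF _ order_refl order_refl])
        (use ev in eventually_elim, simp add: entry)
    show "zorder (\<lambda>w. H w $ i $ j) a = -1"
    proof (rule zorder_eqI[OF U])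
      show "(\<lambda>u. R $ i $ j + Hreg u $ i $ j * (u - a)) holomorphic_on U"
        using ana analytic_imp_holomorphic by (intro holomorphic_intros) blast
      show "H u $ i $ j = (R $ i $ j + Hreg u $ i $ j * (u - a)) * (u - a) powi - 1" if "u \<in> U" "u \<noteq> a" for u
        using that by (simp add: entry field_simps)
    qed (use that in auto)
  qed
  obtain i j where "R $ i $ j \<noteq> 0"
    using R by (auto simp: vec_eq_iff)
  then show ?thesis
    unfolding mat_simple_pole_def mat_pole_def using pole no_pole by blast
qed

text \<open>By Cramer's rule the entries agree with quotients \<open>F0\<close> of entire functions
  with denominator \<open>det P\<close>, except at zeros of \<open>det D\<close> and
  \<open>det P\<close>. These points are isolated, so \<open>H\<close> inherits meromorphy and poles
  from \<open>F0\<close>; zeros of \<open>det D\<close> alone produce no poles.\<close>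

lemma meromorphic_resolvent:
  fixes P X D H :: "complex \<Rightarrow> complex ^ 'm ^ ('m::finite)" and A :: "complex ^ 'm ^ 'm"
  assumes hol: "\<And>i j. (\<lambda>s. P s $ i $ j) holomorphic_on UNIV"
    and nz: "det (P b) \<noteq> 0"
    and holX: "\<And>i j. (\<lambda>s. X s $ i $ j) holomorphic_on UNIV"
    and holD: "\<And>i j. (\<lambda>s. D s $ i $ j) holomorphic_on UNIV"
    and nzD: "det (D c) \<noteq> 0"
    and H: "\<And>s. det (D s) \<noteq> 0 \<Longrightarrow> det (P s) \<noteq> 0 \<Longrightarrow> H s = A ** matrix_inv (P s) ** X s"
  shows "\<exists>F. (\<forall>s. det (D s) \<noteq> 0 \<and> det (P s) \<noteq> 0 \<longrightarrow> F s = H s) \<and>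
             (\<forall>i j. (\<lambda>s. F s $ i $ j) nicely_meromorphic_on UNIV) \<and>
             (\<forall>s. mat_pole F s \<longrightarrow> det (P s) = 0)" (is ?F)
    and "\<And>i j. (\<lambda>s. H s $ i $ j) meromorphic_on UNIV"
    and "{s. mat_pole H s} \<subseteq> {s. det (P s) = 0}"
    and "{s. mat_pole H s} sparse_in UNIV"
proof -
  \<comment> \<open>The adjugate of \<open>P s\<close>, entire in \<open>s\<close>.\<close>
  define adj :: "complex \<Rightarrow> complex ^ 'm ^ 'm" where "adj = (\<lambda>s. \<chi> k l. det (\<chi> i j. if j = k then mat 1 $ i $ l else P s $ i $ j))"
  define N where "N = (\<lambda>s. A ** adj s ** X s)"
  define F0 where "F0 = (\<lambda>i j s. N s $ i $ j / det (P s))"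
  have detP: "(\<lambda>s. det (P s)) holomorphic_on UNIV"
    by (intro holomorphic_on_det hol)
  have detD: "(\<lambda>s. det (D s)) holomorphic_on UNIV"
    by (intro holomorphic_on_det holD)
  have "(\<lambda>s. adj s $ k $ l) holomorphic_on UNIV" for k l
  proof -
    have "(\<lambda>s. (\<chi> i j. if j = k then mat 1 $ i $ l else P s $ i $ j) $ i $ j) holomorphic_on UNIV" for i j
      using hol[of i j] by (cases "j = k") auto
    from holomorphic_on_det[OF this] show ?thesis
       by (simp add: adj_def)
  qed
  then have holN: "(\<lambda>s. N s $ i $ j) holomorphic_on UNIV" for i j
    unfolding N_def using holX by (intro holomorphic_on_matrix_mult) auto
  have mer0: "F0 i j meromorphic_on UNIV" for i j
    unfolding F0_def using holN detP
    by (intro meromorphic_intros analytic_on_imp_meromorphic_on) (auto simp: analytic_on_open)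
  have ana0: "F0 i j analytic_on {s}" if "det (P s) \<noteq> 0" for i j s
    unfolding F0_def using holN detP that
    by (intro analytic_on_divide) (auto simp: analytic_on_open intro: analytic_on_subset[of _ UNIV])
  have F0H: "F0 i j s = H s $ i $ j" if "det (D s) \<noteq> 0" "det (P s) \<noteq> 0" for i j s
  proof -
    have "adj s = mat (det (P s)) ** matrix_inv (P s)"
      using that by (simp add: vec_eq_iff mat_mult_entry adj_def matrix_inv_entry)
    then have "N s = mat (det (P s)) ** H s"
      unfolding N_def H[OF that] by (simp add: matrix_mul_assoc mat_mult_commute[of A])
    then show ?thesis using that by (simp add: F0_def mat_mult_entry)
  qed
  have ev: "\<forall>\<^sub>F s in at a. F0 i j s = H s $ i $ j" for a i j
    using eventually_nonzero_entire[OF detD nzD, of a] eventually_nonzero_entire[OF detP nz, of a]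
    by eventually_elim (rule F0H)
  have pole_eq: "is_pole (\<lambda>s. H s $ i $ j) s \<longleftrightarrow> is_pole (F0 i j) s" for i j s
    using ev[of i j s] by (intro is_pole_cong) (auto elim: eventually_mono)
  have pole_zero: "det (P s) = 0" if "is_pole (F0 i j) s" for i j s
    using that ana0 analytic_at_imp_no_pole by blast
  show sub: "{s. mat_pole H s} \<subseteq> {s. det (P s) = 0}"
    using pole_eq pole_zero by (auto simp: mat_pole_def)
  show "(\<lambda>s. H s $ i $ j) meromorphic_on UNIV" for i j
  proof -
    have "F0 i j meromorphic_on UNIV \<longleftrightarrow> (\<lambda>s. H s $ i $ j) meromorphic_on UNIV"
      by (rule meromorphic_on_cong) (use ev in auto)
    with mer0 show ?thesis by blast
  qed
  show "{s. mat_pole H s} sparse_in UNIV"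
    unfolding sparse_in_eventually_iff[OF open_UNIV]
  proof
    fix a :: complex
    show "\<forall>\<^sub>F s in at a. s \<notin> {s. mat_pole H s}"
      using eventually_nonzero_entire[OF detP nz, of a] by (rule eventually_mono) (use sub in blast)
  qed
  \<comment> \<open>\<open>nicely_meromorphic_on\<close> prescribes the values at removable
    singularities and at poles; \<open>remove_sings\<close> supplies these values.\<close>
  define F :: "complex \<Rightarrow> complex ^ 'm ^ 'm" where "F = (\<lambda>s. \<chi> i j. remove_sings (F0 i j) s)"
  have "F s = H s" if "det (D s) \<noteq> 0" "det (P s) \<noteq> 0" for s
    using ana0[OF that(2)] F0H[OF that] by (simp add: F_def vec_eq_iff)
  moreover have "(\<lambda>s. F s $ i $ j) nicely_meromorphic_on UNIV" for i j
    using remove_sings_nicely_meromorphic[OF mer0] by (simp add: F_def)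
  moreover have "det (P s) = 0" if F_pole: "mat_pole F s" for s
  proof -
    obtain i j where "is_pole (\<lambda>s. F s $ i $ j) s" using F_pole by (auto simp: mat_pole_def)
    then have "is_pole (remove_sings (F0 i j)) s" by (simp add: F_def)
    then have "\<not> F0 i j analytic_on {s}"
      using analytic_at_imp_no_pole remove_sings_analytic_on by blast
    then show ?thesis using ana0 by blast
  qed
  ultimately show ?F by blast
qed

subsection \<open>Perron-Frobenius theory for symmetrisable interaction matrices\<close>

text \<open>Clusters stay index sets inside one matrix type, with zero padding outside
  \<open>I\<close>, so that no type depends on a cluster. Positivity of all off-diagonal entries of
  the block takes the place of irreducibility; the first clause is symmetry with respect to the
  weights \<open>C\<close>.\<close>

definition interaction_on :: "('m \<Rightarrow> real) \<Rightarrow> 'm set \<Rightarrow> real ^ 'm ^ 'm \<Rightarrow> bool" where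
  "interaction_on C I K \<longleftrightarrow> (\<forall>i j. C i * K $ i $ j = C j * K $ j $ i) \<and>
     (\<forall>i j. if i \<noteq> j \<and> i \<in> I \<and> j \<in> I then 0 < K $ i $ j else K $ i $ j = 0)"

definition perron_pair :: "'m set \<Rightarrow> real ^ 'm ^ 'm \<Rightarrow> real \<Rightarrow> real ^ ('m::finite) \<Rightarrow> bool" where
  "perron_pair I K \<mu> v \<longleftrightarrow> (\<forall>i\<in>I. 0 < v $ i) \<and> (\<forall>i. i \<notin> I \<longrightarrow> v $ i = 0) \<and>
     (\<forall>i. (\<Sum>j\<in>UNIV. K $ i $ j * v $ j) = \<mu> * v $ i)"

lemma interaction_onD:
  assumes "interaction_on C I K"
  shows "C i * K $ i $ j = C j * K $ j $ i" "0 \<le> K $ i $ j"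
    "i \<noteq> j \<Longrightarrow> i \<in> I \<Longrightarrow> j \<in> I \<Longrightarrow> 0 < K $ i $ j" "i \<notin> I \<Longrightarrow> K $ i $ j = 0" "j \<notin> I \<Longrightarrow> K $ i $ j = 0"
  using assms unfolding interaction_on_def
  by (blast, metis less_imp_le order_refl, metis, metis, metis)

lemma perron_pairD:
  assumes "perron_pair I K \<mu> v"
  shows "i \<in> I \<Longrightarrow> 0 < v $ i" "i \<notin> I \<Longrightarrow> v $ i = 0"
    "(\<Sum>j\<in>UNIV. K $ i $ j * v $ j) = \<mu> * v $ i" "0 \<le> v $ i"
  using assms unfolding perron_pair_def by (auto simp: less_imp_le) (metis less_imp_le order_refl)

text \<open>A positive coordinate \<open>k\<close> feeds every other row \<open>i\<close> of
  \<open>I\<close> through \<open>K_ik > 0\<close>, so the right-hand side of the eigenvalue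
  equation is positive in row \<open>i\<close> and \<open>v_i\<close> cannot vanish.\<close>

lemma nonneg_eigenvector_positive:
  fixes K :: "real ^ 'm ^ ('m::finite)"
  assumes K: "interaction_on C I K" and v: "\<And>i. 0 \<le> v $ i" "\<And>i. i \<notin> I \<Longrightarrow> v $ i = 0" "v \<noteq> 0"
    and ev: "\<And>i. (\<Sum>j\<in>UNIV. K $ i $ j * v $ j) = \<mu> * v $ i"
  shows "perron_pair I K \<mu> v"
proof -
  obtain k where k: "v $ k \<noteq> 0" using v(3) by (auto simp: vec_eq_iff)
  then have kI: "k \<in> I" "0 < v $ k" using v(1,2) by (auto simp: order_less_le)
  have "0 < v $ i" if "i \<in> I" for i
  proof (cases "i = k")
    case False
    have "0 < K $ i $ k * v $ k"
      using interaction_onD(3)[OF K False that kI(1)] kI by simp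
    also have "\<dots> \<le> (\<Sum>j\<in>UNIV. K $ i $ j * v $ j)"
      by (rule member_le_sum) (use interaction_onD(2)[OF K] v(1) in auto)
    finally have "0 < \<mu> * v $ i" using ev by simp
    then show ?thesis using v(1)[of i] by (cases "v $ i = 0") auto
  qed (use kI in simp)
  then show ?thesis
    unfolding perron_pair_def using v(2) ev by blast
qed

text \<open>Since \<open>K\<close> is symmetric with respect to the weights \<open>C\<close>, a left eigenvector is \<open>C v\<close>.\<close>

lemma perron_left_eigenvector:
  fixes K :: "real ^ 'm ^ ('m::finite)"
  assumes K: "interaction_on C I K" and v: "perron_pair I K \<mu> v"
  shows "(\<Sum>i\<in>UNIV. C i * v $ i * (\<Sum>j\<in>UNIV. K $ i $ j * y j)) = \<mu> * (\<Sum>j\<in>UNIV. C j * v $ j * y j)"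
proof -
  have "(\<Sum>i\<in>UNIV. C i * v $ i * (\<Sum>j\<in>UNIV. K $ i $ j * y j)) = (\<Sum>j\<in>UNIV. \<Sum>i\<in>UNIV. (C i * K $ i $ j) * v $ i * y j)"
    by (subst sum.swap) (simp add: sum_distrib_left mult_ac)
  also have "\<dots> = (\<Sum>j\<in>UNIV. C j * y j * (\<Sum>i\<in>UNIV. K $ j $ i * v $ i))"
    unfolding interaction_onD(1)[OF K, of _ j for j]
    by (simp add: sum_distrib_left mult_ac)
  also have "\<dots> = \<mu> * (\<Sum>j\<in>UNIV. C j * v $ j * y j)"
    unfolding perron_pairD(3)[OF v] by (simp add: sum_distrib_left mult_ac)
  finally show ?thesis .
qed

text \<open>Taking moduli in the eigenvalue equation gives \<open>|l| |u| \<le> K |u|\<close>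
  entrywise. Summation against the left eigenvector \<open>C v\<close>, positive on
  \<open>I\<close>, turns \<open>K\<close> into \<mu>; the total is positive because of
  \<open>u k\<close>.\<close>

lemma perron_eigenvalue_bound:
  fixes K :: "real ^ 'm ^ ('m::finite)" and u :: "'m \<Rightarrow> complex"
  assumes K: "interaction_on C I K" and C: "\<And>i. 0 < C i" and v: "perron_pair I K \<mu> v"
    and u: "\<And>i. (\<Sum>j\<in>UNIV. of_real (K $ i $ j) * u j) = l * u i" and k: "k \<in> I" "u k \<noteq> 0"
  shows "cmod l \<le> \<mu>"
proof -
  have le: "cmod l * cmod (u i) \<le> (\<Sum>j\<in>UNIV. K $ i $ j * cmod (u j))" for i
  proof -
    have "cmod l * cmod (u i) = cmod (\<Sum>j\<in>UNIV. of_real (K $ i $ j) * u j)"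
      by (simp add: u norm_mult)
    also have "\<dots> \<le> (\<Sum>j\<in>UNIV. cmod (of_real (K $ i $ j) * u j))"
      by (rule norm_sum)
    also have "\<dots> = (\<Sum>j\<in>UNIV. K $ i $ j * cmod (u j))"
      using interaction_onD(2)[OF K] by (simp add: norm_mult)
    finally show ?thesis .
  qed
  let ?S = "\<Sum>i\<in>UNIV. C i * v $ i * cmod (u i)"
  have "cmod l * ?S = (\<Sum>i\<in>UNIV. C i * v $ i * (cmod l * cmod (u i)))"
    by (simp add: sum_distrib_left mult_ac)
  also have "\<dots> \<le> (\<Sum>i\<in>UNIV. C i * v $ i * (\<Sum>j\<in>UNIV. K $ i $ j * cmod (u j)))"
    by (intro sum_mono mult_left_mono le) (use C perron_pairD(4)[OF v] in \<open>auto simp: less_imp_le\<close>)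
  also have "\<dots> = \<mu> * ?S"
    by (rule perron_left_eigenvector[OF K v])
  finally have "cmod l * ?S \<le> \<mu> * ?S" .
  moreover have "0 < ?S"
  proof (rule sum_pos2[of _ k])
    show "0 < C k * v $ k * cmod (u k)" using C k perron_pairD(1)[OF v] by simp
    show "0 \<le> C i * v $ i * cmod (u i)" for i
      using C perron_pairD(4)[OF v] by (simp add: less_imp_le)
  qed auto
  ultimately show ?thesis by simp
qed

text \<open>Subtracting the multiple of \<open>v\<close> that agrees with \<open>u\<close> at
  \<open>k\<close> leaves \<open>y\<close> with \<open>y k = 0\<close> and
  \<open>\<mu> |y| \<le> K |y|\<close>. Pairing with the left eigenvector forces equality, in
  particular in row \<open>k\<close>, where it reads \<open>K |y| = 0\<close>; the positive entries
  of that row make \<open>y\<close> vanish. Only moduli are compared, so complex \<open>u\<close>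
  are covered.\<close>

lemma perron_eigenvector_unique:
  fixes K :: "real ^ 'm ^ ('m::finite)" and u :: "'m \<Rightarrow> complex"
  assumes K: "interaction_on C I K" and C: "\<And>i. 0 < C i" and I: "I \<noteq> {}" and v: "perron_pair I K \<mu> v"
    and u: "\<And>i. i \<in> I \<Longrightarrow> (\<Sum>j\<in>UNIV. of_real (K $ i $ j) * u j) = of_real \<mu> * u i"
    and off: "\<And>i. i \<notin> I \<Longrightarrow> u i = 0"
  shows "\<exists>c. \<forall>i. u i = c * of_real (v $ i)"
proof -
  obtain k where k: "k \<in> I" using I by blast
  define c where "c = u k / of_real (v $ k)"
  define y where "y = (\<lambda>i. u i - c * of_real (v $ i))"
  have vk: "v $ k \<noteq> 0" using perron_pairD(1)[OF v k] by simp
  have yk: "y k = 0" using vk by (simp add: y_def c_def)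
  have yoff: "y i = 0" if "i \<notin> I" for i
    using off perron_pairD(2)[OF v] that by (simp add: y_def)
  have \<mu>: "0 \<le> \<mu>"
  proof -
    have "0 \<le> (\<Sum>j\<in>UNIV. K $ k $ j * v $ j)"
      by (intro sum_nonneg mult_nonneg_nonneg interaction_onD(2)[OF K] perron_pairD(4)[OF v])
    then show ?thesis
      using perron_pairD(3)[OF v, of k] perron_pairD(1)[OF v k] by (simp add: zero_le_mult_iff)
  qed
  have ev: "(\<Sum>j\<in>UNIV. of_real (K $ i $ j) * y j) = of_real \<mu> * y i" if "i \<in> I" for i
  proof -
    have "(\<Sum>j\<in>UNIV. of_real (K $ i $ j) * (c * of_real (v $ j))) = c * of_real (\<Sum>j\<in>UNIV. K $ i $ j * v $ j)"
      by (simp add: sum_distrib_left mult_ac)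
    also have "\<dots> = of_real \<mu> * (c * of_real (v $ i))"
      unfolding perron_pairD(3)[OF v] by simp
    finally show ?thesis
      using u[OF that]
      by (simp add: y_def right_diff_distrib sum_subtractf)
  qed
  have le: "\<mu> * cmod (y i) \<le> (\<Sum>j\<in>UNIV. K $ i $ j * cmod (y j))" for i
  proof (cases "i \<in> I")
    case True
    have "\<mu> * cmod (y i) = cmod (\<Sum>j\<in>UNIV. of_real (K $ i $ j) * y j)"
      using ev[OF True] \<mu> by (simp add: norm_mult)
    also have "\<dots> \<le> (\<Sum>j\<in>UNIV. cmod (of_real (K $ i $ j) * y j))"
      by (rule norm_sum)
    also have "\<dots> = (\<Sum>j\<in>UNIV. K $ i $ j * cmod (y j))"
      using interaction_onD(2)[OF K] by (simp add: norm_mult)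
    finally show ?thesis .
  next
    case False
    then show ?thesis using yoff interaction_onD(2)[OF K] by (simp add: sum_nonneg)
  qed
  define d where "d = (\<lambda>i. C i * v $ i * ((\<Sum>j\<in>UNIV. K $ i $ j * cmod (y j)) - \<mu> * cmod (y i)))"
  have "sum d UNIV = 0"
    using perron_left_eigenvector[OF K v, of "\<lambda>j. cmod (y j)"]
    by (simp add: d_def right_diff_distrib sum_subtractf sum_distrib_left mult_ac)
  moreover have "0 \<le> d i" for i
    using le[of i] C[of i] perron_pairD(4)[OF v, of i] by (simp add: d_def)
  ultimately have "d k = 0"
    using sum_nonneg_eq_0_iff[of UNIV d] by simp
  then have "(\<Sum>j\<in>UNIV. K $ k $ j * cmod (y j)) = 0"
    using C[of k] vk yk by (simp add: d_def)
  then have zero: "K $ k $ j * cmod (y j) = 0" for j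
    using sum_nonneg_eq_0_iff[of UNIV "\<lambda>j. K $ k $ j * cmod (y j)"] interaction_onD(2)[OF K] by simp
  have "y j = 0" for j
  proof (cases "j \<in> I \<and> j \<noteq> k")
    case True
    then have "0 < K $ k $ j" using interaction_onD(3)[OF K, of k j] k by auto
    then show ?thesis using zero[of j] by simp
  qed (use yk yoff in auto)
  then show ?thesis by (auto simp: y_def)
qed

text \<open>Brouwer's fixed point theorem on the simplex of nonnegative vectors of mass 1 supported
  in \<open>I\<close>.\<close>

lemma perron_pair_exists:
  fixes K :: "real ^ 'm ^ ('m::finite)"
  assumes K: "interaction_on C I K" and I: "I \<noteq> {}"
  obtains \<mu> v where "perron_pair I K \<mu> v" "norm v = 1"
proof -
  define S :: "(real ^ 'm) set" where "S = {v. (\<forall>i. 0 \<le> v $ i) \<and> (\<forall>i. i \<notin> I \<longrightarrow> v $ i = 0) \<and> (\<Sum>i\<in>UNIV. v $ i) = 1}"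
  have S_eq: "S = (\<Inter>i. {v. 0 \<le> v $ i}) \<inter> (\<Inter>i\<in>- I. {v. v $ i = 0}) \<inter> {v. (\<Sum>i\<in>UNIV. v $ i) = 1}"
    by (auto simp: S_def)
  have "closed S"
    unfolding S_eq by (intro closed_Int closed_INT ballI closed_Collect_le closed_Collect_eq continuous_intros)
  moreover have "bounded S"
    unfolding bounded_iff
  proof (intro exI[of _ 1] ballI)
    fix v assume v: "v \<in> S"
    have "norm v \<le> (\<Sum>i\<in>UNIV. \<bar>v $ i\<bar>)" by (rule norm_le_l1_cart)
    also have "\<dots> = 1" using v by (simp add: S_def)
    finally show "norm v \<le> 1" .
  qed
  ultimately have "compact S" by (simp add: compact_eq_bounded_closed)
  moreover have "convex S"
    unfolding convex_def S_def
    by (auto simp: sum.distrib simp flip: sum_distrib_left)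
  moreover obtain k where k: "k \<in> I" using I by blast
  have "axis k 1 \<in> S" using k by (auto simp: S_def axis_def)
  then have "S \<noteq> {}" by blast
  \<comment> \<open>The added identity keeps the mass \<open>\<sigma> v\<close> at least 1, so the
    normalisation never divides by zero; for a one-element \<open>I\<close> the vector
    \<open>K v\<close> itself is 0. A fixed point belongs to the eigenvalue
    \<open>\<sigma> v - 1\<close> of \<open>K\<close>.\<close>
  moreover define F where "F = (\<lambda>v. v + K *v v)"
  define \<sigma> where "\<sigma> = (\<lambda>v. \<Sum>i\<in>UNIV. F v $ i)"
  have Fnn: "v $ i \<le> F v $ i" if "v \<in> S" for v i
    using that interaction_onD(2)[OF K] unfolding F_def S_def
    by (auto simp: matrix_vector_mult_def intro!: sum_nonneg)
  have \<sigma>1: "1 \<le> \<sigma> v" if "v \<in> S" for v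
  proof -
    have "1 = (\<Sum>i\<in>UNIV. v $ i)" using that by (simp add: S_def)
    also have "\<dots> \<le> \<sigma> v" unfolding \<sigma>_def by (intro sum_mono Fnn that)
    finally show ?thesis .
  qed
  have contF: "continuous_on S F"
    unfolding F_def by (intro continuous_intros linear_continuous_on matrix_vector_mul_bounded_linear)
  have "continuous_on S (\<lambda>v. F v /\<^sub>R \<sigma> v)"
  proof -
    have "continuous_on S \<sigma>"
      unfolding \<sigma>_def by (intro continuous_intros contF)
    then show ?thesis
      using \<sigma>1 by (intro continuous_intros contF) force+
  qed
  moreover have "(\<lambda>v. F v /\<^sub>R \<sigma> v) \<in> S \<rightarrow> S"
  proof
    fix v assume v: "v \<in> S"
    have "0 \<le> F v $ i" for i using Fnn[OF v, of i] v by (auto simp: S_def intro: order_trans)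
    moreover have "F v $ i = 0" if "i \<notin> I" for i
      using v that interaction_onD(4)[OF K] by (simp add: F_def S_def matrix_vector_mult_def)
    moreover have "(\<Sum>i\<in>UNIV. (F v /\<^sub>R \<sigma> v) $ i) = inverse (\<sigma> v) * \<sigma> v"
      unfolding \<sigma>_def sum_distrib_left by simp
    ultimately show "F v /\<^sub>R \<sigma> v \<in> S"
      using \<sigma>1[OF v] by (simp add: S_def)
  qed
  ultimately obtain v where v: "v \<in> S" "F v /\<^sub>R \<sigma> v = v"
    using brouwer[of S "\<lambda>v. F v /\<^sub>R \<sigma> v"] by blast
  have Fv: "F v $ i = \<sigma> v * v $ i" for i
  proof -
    have "v $ i = F v $ i / \<sigma> v"
      using arg_cong[OF v(2), of "\<lambda>v. v $ i"] by (simp add: divide_inverse mult.commute)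
    then show ?thesis using \<sigma>1[OF v(1)] by (simp add: field_simps)
  qed
  have v0: "v \<noteq> 0" using v(1) by (auto simp: S_def)
  define v' where "v' = v /\<^sub>R norm v"
  have ev: "(\<Sum>j\<in>UNIV. K $ i $ j * v' $ j) = (\<sigma> v - 1) * v' $ i" for i
  proof -
    have "(\<Sum>j\<in>UNIV. K $ i $ j * v $ j) = (\<sigma> v - 1) * v $ i"
      using Fv[of i] by (simp add: F_def matrix_vector_mult_def algebra_simps)
    then have "inverse (norm v) * (\<Sum>j\<in>UNIV. K $ i $ j * v $ j) = inverse (norm v) * ((\<sigma> v - 1) * v $ i)"
      by simp
    then show ?thesis by (simp add: v'_def sum_distrib_left mult_ac)
  qed
  have "perron_pair I K (\<sigma> v - 1) v'"
  proof (rule nonneg_eigenvector_positive[OF K _ _ _ ev])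
    show "0 \<le> v' $ i" "i \<notin> I \<Longrightarrow> v' $ i = 0" for i
      using v(1) by (auto simp: v'_def S_def)
    show "v' \<noteq> 0" using v0 by (simp add: v'_def)
  qed
  moreover have "norm v' = 1" using v0 by (simp add: v'_def)
  ultimately show ?thesis using that by blast
qed

text \<open>Eigenvalues are the zeros of an entire function in a disc, and this function is not
  identically zero because a point of modulus above \<open>M\<close> is no eigenvalue. Finiteness
  gives \<open>Max\<close> in \<open>perron_eigenvalue\<close> its meaning.\<close>

lemma finite_eigenvalues:
  fixes A :: "complex ^ 'k ^ ('k::finite)"
  assumes "\<And>l. l \<in> eigenvalues A \<Longrightarrow> cmod l \<le> M"
  shows "finite (eigenvalues A)"
proof -
  define f where "f = (\<lambda>l. det (A - mat l))"
  have f: "f l = 0 \<longleftrightarrow> l \<in> eigenvalues A" for l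
  proof -
    have "(mat l *v v) = l *s v" for v :: "complex ^ 'k"
    proof -
      have "(\<Sum>j\<in>UNIV. (if i = j then l else 0) * v $ j) = (\<Sum>j\<in>UNIV. if i = j then l * v $ j else 0)" for i
        by (rule sum.cong) auto
      then show ?thesis by (simp add: vec_eq_iff matrix_vector_mult_def mat_def)
    qed
    then show ?thesis
      unfolding f_def det_eq_0_iff_kernel eigenvalues_def by (simp add: matrix_vector_mult_diff_rdistrib)
  qed
  have "(\<lambda>l. (A - mat l) $ i $ j) holomorphic_on UNIV" for i j
    by (cases "i = j") (auto simp: mat_def intro!: holomorphic_intros)
  then have hol: "f holomorphic_on UNIV"
    unfolding f_def by (rule holomorphic_on_det)
  have "f (of_real (\<bar>M\<bar> + 1)) \<noteq> 0"
    using f assms[of "of_real (\<bar>M\<bar> + 1)"] by (auto simp del: of_real_add)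
  have "finite {l \<in> cball 0 M. f l = 0}"
  proof (cases "f constant_on UNIV")
    case True
    then have "f l \<noteq> 0" for l
      using \<open>f (of_real (\<bar>M\<bar> + 1)) \<noteq> 0\<close> unfolding constant_on_def by (metis UNIV_I)
    then show ?thesis by simp
  next
    case False
    then show ?thesis
      by (intro holomorphic_compact_finite_zeros[OF hol open_UNIV connected_UNIV compact_cball]) auto
  qed
  moreover have "eigenvalues A \<subseteq> {l \<in> cball 0 M. f l = 0}"
    using assms f by auto
  ultimately show ?thesis by (rule finite_subset[rotated])
qed

text \<open>An eigenvector that is nonzero somewhere on \<open>I\<close> falls under the Perron
  bound, and one supported outside \<open>I\<close> is due to the padding and has eigenvalue 0. As
  \<mu> is itself an eigenvalue, the maximum is attained there.\<close>

lemma perron_eigenvalue_eq: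
  fixes K :: "real ^ 'm ^ ('m::finite)"
  assumes K: "interaction_on C I K" and C: "\<And>i. 0 < C i" and I: "I \<noteq> {}" and v: "perron_pair I K \<mu> v"
  shows "perron_eigenvalue K = \<mu>"
proof -
  let ?A = "(\<chi> i j. of_real (K $ i $ j)) :: complex ^ 'm ^ 'm"
  obtain k where k: "k \<in> I" using I by blast
  have vk: "0 < v $ k" using perron_pairD(1)[OF v k] .
  have \<mu>: "0 \<le> \<mu>"
  proof -
    have "0 \<le> (\<Sum>j\<in>UNIV. K $ k $ j * v $ j)"
      by (intro sum_nonneg mult_nonneg_nonneg interaction_onD(2)[OF K] perron_pairD(4)[OF v])
    then show ?thesis
      using perron_pairD(3)[OF v, of k] vk by (simp add: zero_le_mult_iff)
  qed
  have le: "cmod l \<le> \<mu>" if l: "l \<in> eigenvalues ?A" for l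
  proof -
    obtain u where u: "u \<noteq> 0" "?A *v u = l *s u" using l by (auto simp: eigenvalues_def)
    have ev: "(\<Sum>j\<in>UNIV. of_real (K $ i $ j) * u $ j) = l * u $ i" for i
      using arg_cong[OF u(2), of "\<lambda>v. v $ i"] by (simp add: matrix_vector_mult_def)
    show ?thesis
    proof (cases "\<exists>k\<in>I. u $ k \<noteq> 0")
      case True
      then show ?thesis using perron_eigenvalue_bound[OF K C v ev] by blast
    next
      case False
      then have "(\<Sum>j\<in>UNIV. of_real (K $ i $ j) * u $ j) = 0" for i
        using interaction_onD(5)[OF K] by (intro sum.neutral) auto
      then have "l = 0" using ev u(1) by (auto simp: vec_eq_iff)
      then show ?thesis using \<mu> by simp
    qed
  qed
  have "of_real \<mu> \<in> eigenvalues ?A"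
  proof -
    define u :: "complex ^ 'm" where "u = (\<chi> i. of_real (v $ i))"
    have "(?A *v u) $ i = of_real (\<Sum>j\<in>UNIV. K $ i $ j * v $ j)" for i
      by (simp add: u_def matrix_vector_mult_def)
    then have "?A *v u = of_real \<mu> *s u"
      by (simp add: vec_eq_iff perron_pairD(3)[OF v] u_def)
    moreover have "u \<noteq> 0" using vk by (auto simp: u_def vec_eq_iff intro!: exI[of _ k])
    ultimately show ?thesis by (auto simp: eigenvalues_def)
  qed
  then have "\<mu> \<in> cmod ` eigenvalues ?A"
    using \<mu> by (metis abs_of_nonneg imageI norm_of_real)
  then show ?thesis
    unfolding perron_eigenvalue_def using le
    by (intro Max_eqI) (auto intro: finite_eigenvalues)
qed

text \<open>The eigenvalue equation is summed over all rows and compared with the total mass of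
  \<open>v\<close>.\<close>

lemma perron_value_bounds:
  fixes K :: "real ^ 'm ^ ('m::finite)"
  assumes K: "interaction_on C I K" and I: "I \<noteq> {}" and v: "perron_pair I K \<mu> v"
    and B: "\<And>i j. K $ i $ j \<le> B"
  shows "0 \<le> \<mu>" "\<mu> \<le> real CARD('m) * B"
proof -
  obtain k where k: "k \<in> I" using I by blast
  let ?S = "\<Sum>i\<in>UNIV. v $ i"
  have S: "0 < ?S"
    using perron_pairD(1)[OF v k] perron_pairD(4)[OF v] by (intro sum_pos2[of _ k]) auto
  have eq: "\<mu> * ?S = (\<Sum>i\<in>UNIV. \<Sum>j\<in>UNIV. K $ i $ j * v $ j)"
    by (simp add: perron_pairD(3)[OF v] sum_distrib_left)
  have "0 \<le> \<mu> * ?S" unfolding eq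
    by (intro sum_nonneg mult_nonneg_nonneg interaction_onD(2)[OF K] perron_pairD(4)[OF v])
  then show "0 \<le> \<mu>" using S by (simp add: zero_le_mult_iff)
  have "\<mu> * ?S \<le> (\<Sum>i\<in>(UNIV::'m set). \<Sum>j\<in>UNIV. B * v $ j)"
    unfolding eq by (intro sum_mono mult_right_mono B perron_pairD(4)[OF v])
  also have "\<dots> = real CARD('m) * B * ?S"
    by (simp add: sum_distrib_left mult_ac)
  finally show "\<mu> \<le> real CARD('m) * B" using S by simp
qed

subsection \<open>The bubble system\<close>

text \<open>The property may vary with \<open>n\<close>. This allows the gap argument to test the
  constant \<open>1 / (n + 1)\<close> at stage \<open>n\<close>; elsewhere the family is
  constant.\<close>

lemma not_eventually_at_right_sequence:
  assumes "\<And>n. \<not> eventually (Q n) (at_right (0::real))" "0 < b"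
  obtains e :: "nat \<Rightarrow> real" where "\<And>n. e n \<in> {0<..b}" "e \<longlonglongrightarrow> 0" "\<And>n. \<not> Q n (e n)"
proof -
  have "\<exists>x. 0 < x \<and> x < min b (inverse (real (Suc n))) \<and> \<not> Q n x" for n
    using assms(1)[of n] assms(2) unfolding eventually_at_right_field
    by (metis min_less_iff_conj of_nat_0_less_iff positive_imp_inverse_positive zero_less_Suc)
  then obtain e where e: "\<And>n. 0 < e n" "\<And>n. e n < b" "\<And>n. e n < inverse (real (Suc n))" "\<And>n. \<not> Q n (e n)"
    by (metis min_less_iff_conj)
  have "e \<longlonglongrightarrow> 0"
    by (rule tendsto_sandwich[OF _ _ tendsto_const LIMSEQ_inverse_real_of_nat])
      (use e(1,3) in \<open>auto intro!: always_eventually less_imp_le\<close>)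
  then show ?thesis using that e by (metis greaterThanAtMost_iff less_imp_le)
qed

lemma tendsto_det:
  fixes A :: "'a \<Rightarrow> complex ^ 'm ^ ('m::finite)"
  assumes "\<And>i j. ((\<lambda>n. A n $ i $ j) \<longlongrightarrow> B $ i $ j) F"
  shows "((\<lambda>n. det (A n)) \<longlongrightarrow> det B) F"
  unfolding det_def by (intro tendsto_intros assms)

text \<open>Limits of the rescaled system are available along convergent sequences of points, while
  Hurwitz' theorem asks for uniform convergence on compact sets. The hypothesis includes
  subsequences \<phi> because points violating a uniform bound may exist only along a subsequence of
  indices.\<close>

lemma uniform_limit_sequentialI:
  fixes F :: "nat \<Rightarrow> complex \<Rightarrow> complex"
  assumes X: "compact X" and g: "continuous_on X g"
    and conv: "\<And>\<phi> t l. strict_mono \<phi> \<Longrightarrow> (\<And>n. t n \<in> X) \<Longrightarrow> l \<in> X \<Longrightarrow> t \<longlonglongrightarrow> l \<Longrightarrow>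
      (\<lambda>n. F (\<phi> n) (t n)) \<longlonglongrightarrow> g l"
  shows "uniform_limit X F g sequentially"
proof (rule ccontr)
  assume "\<not> uniform_limit X F g sequentially"
  then obtain \<delta> where \<delta>: "\<delta> > 0" "\<not> (\<forall>\<^sub>F n in sequentially. \<forall>x\<in>X. dist (F n x) (g x) < \<delta>)"
    unfolding uniform_limit_iff by blast
  then have "\<forall>N. \<exists>n>N. \<exists>x\<in>X. \<delta> \<le> dist (F n x) (g x)"
    unfolding eventually_sequentially by (metis not_less less_eq_Suc_le)
  then have "infinite {n. \<exists>x\<in>X. \<delta> \<le> dist (F n x) (g x)}"
    unfolding infinite_nat_iff_unbounded by blast
  from infinite_enumerate[OF this] obtain \<phi> :: "nat \<Rightarrow> nat" where \<phi>: "strict_mono \<phi>" "\<And>n. \<exists>x\<in>X. \<delta> \<le> dist (F (\<phi> n) x) (g x)"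
    by auto
  then obtain t where t: "\<And>n. t n \<in> X" "\<And>n. \<delta> \<le> dist (F (\<phi> n) (t n)) (g (t n))"
    by metis
  obtain l \<psi> where l: "l \<in> X" "strict_mono \<psi>" "(t \<circ> \<psi>) \<longlonglongrightarrow> l"
    using X t(1) unfolding compact_def by metis
  have "(\<lambda>n. F ((\<phi> \<circ> \<psi>) n) ((t \<circ> \<psi>) n)) \<longlonglongrightarrow> g l"
    using conv[OF strict_mono_o[OF \<phi>(1) l(2)] _ l(1,3)] t(1) by simp
  moreover have "(\<lambda>n. g ((t \<circ> \<psi>) n)) \<longlonglongrightarrow> g l"
    by (rule continuous_on_tendsto_compose[OF g l(3,1)]) (use t(1) in auto)
  ultimately have "(\<lambda>n. dist (F ((\<phi> \<circ> \<psi>) n) ((t \<circ> \<psi>) n)) (g ((t \<circ> \<psi>) n))) \<longlonglongrightarrow> dist (g l) (g l)"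
    by (rule tendsto_dist)
  then have "\<delta> \<le> dist (g l) (g l)"
    by (rule LIMSEQ_le_const) (use t(2) in auto)
  then show False using \<delta>(1) by simp
qed

lemma convergent_bounded:
  fixes s :: "nat \<Rightarrow> complex"
  assumes "s \<longlonglongrightarrow> l"
  obtains R where "\<And>n. cmod (s n) \<le> R"
  using convergent_imp_Bseq[OF convergentI[OF assms]] unfolding Bseq_def by blast

text \<open>\<open>r_less\<close> keeps each disc in the upper half-plane, away from 0 and from the
  mirrored frequencies; \<open>r_sep\<close> makes the open discs disjoint and keeps foreign
  frequencies out of the closed ones.\<close>

locale bubble_clusters =
  fixes p c\<^sub>0 \<epsilon>\<^sub>1 c\<^sub>1 c\<^sub>2 D\<^sub>m\<^sub>i\<^sub>n D\<^sub>m\<^sub>a\<^sub>x r :: real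
    and cl :: "'m::finite \<Rightarrow> 'n::finite" and \<omega> C :: "'m \<Rightarrow> real" and \<omega>\<^sub>c :: "'n \<Rightarrow> real"
    and z :: "real \<Rightarrow> 'm \<Rightarrow> real ^ 3"
  assumes p: "0 < p" "p < 1" and c\<^sub>0: "0 < c\<^sub>0" and \<epsilon>\<^sub>1: "0 < \<epsilon>\<^sub>1" and c\<^sub>1: "0 < c\<^sub>1" and c\<^sub>2: "0 < c\<^sub>2"
    and D\<^sub>m\<^sub>i\<^sub>n: "0 < D\<^sub>m\<^sub>i\<^sub>n" and D\<^sub>m\<^sub>a\<^sub>x: "0 < D\<^sub>m\<^sub>a\<^sub>x" and surj_cl: "surj cl"
    and \<omega>_pos: "0 < \<omega> i" and \<omega>_cl: "\<omega> i = \<omega>\<^sub>c (cl i)" and inj_\<omega>: "inj \<omega>\<^sub>c"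
    and geometry: "dual_scale_geometry p \<epsilon>\<^sub>1 c\<^sub>1 c\<^sub>2 D\<^sub>m\<^sub>i\<^sub>n D\<^sub>m\<^sub>a\<^sub>x cl z"
    and C_pos: "0 < C i" and r_pos: "0 < r" and r_less: "r < \<omega>\<^sub>c \<alpha>"
    and r_sep: "\<alpha> \<noteq> \<beta> \<Longrightarrow> 2 * r \<le> \<bar>\<omega>\<^sub>c \<alpha> - \<omega>\<^sub>c \<beta>\<bar>"
begin

section \<open>Scaling of distances, kernel amplitudes and interaction matrices\<close>

definition d :: "real \<Rightarrow> 'm \<Rightarrow> 'm \<Rightarrow> real" where "d \<epsilon> i j = dist (z \<epsilon> i) (z \<epsilon> j)"
definition \<kappa> :: "real \<Rightarrow> 'm \<Rightarrow> 'm \<Rightarrow> real" where "\<kappa> \<epsilon> i j = \<epsilon> * C j / (4 * pi * d \<epsilon> i j)"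
definition q :: "real \<Rightarrow> 'm \<Rightarrow> 'm \<Rightarrow> complex \<Rightarrow> complex" where
  "q \<epsilon> i j s = of_real (\<kappa> \<epsilon> i j) * exp (- (s * of_real (d \<epsilon> i j / c\<^sub>0)))"
definition \<eta> :: "real \<Rightarrow> real" where "\<eta> \<epsilon> = \<epsilon> powr (1 - p)"
definition P :: "real \<Rightarrow> complex \<Rightarrow> complex ^ 'm ^ 'm" where "P \<epsilon> = P_mat c\<^sub>0 \<omega> C (z \<epsilon>) \<epsilon>"
definition K :: "'n \<Rightarrow> real \<Rightarrow> real ^ 'm ^ 'm" where "K \<alpha> \<epsilon> = interaction_mat p cl C (z \<epsilon>) \<epsilon> \<alpha>"
definition lam :: "'n \<Rightarrow> real \<Rightarrow> real" where "lam \<alpha> \<epsilon> = perron_eigenvalue (K \<alpha> \<epsilon>)"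
text \<open>The solution \<open>t\<close> of
  \<open>2 \<i> t / \<omega>\<^sub>c\<^sup>3 = \<mu>\<close>: the displacement of the zero from the
  centre in units of \<eta>.\<close>

definition shift :: "'n \<Rightarrow> real \<Rightarrow> complex" where "shift \<alpha> \<mu> = - (\<i> / 2) * of_real (\<omega>\<^sub>c \<alpha> ^ 3 * \<mu>)"

abbreviation center :: "'n \<Rightarrow> complex" where "center \<alpha> \<equiv> \<i> * of_real (\<omega>\<^sub>c \<alpha>)"
abbreviation cluster_of :: "'n \<Rightarrow> 'm set" where "cluster_of \<alpha> \<equiv> cluster cl \<alpha>"

lemma cluster_nonempty: "cluster_of \<alpha> \<noteq> {}"
  using surj_cl unfolding cluster_def surj_def by (metis (mono_tags, lifting) empty_Collect_eq)

lemma \<omega>c_pos: "0 < \<omega>\<^sub>c \<alpha>"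
  using r_pos r_less by (rule less_trans)

lemma d_sym: "d \<epsilon> i j = d \<epsilon> j i"
  by (simp add: d_def dist_commute)

lemma d_intra:
  assumes "\<epsilon> \<in> {0<..\<epsilon>\<^sub>1}" "i \<noteq> j" "cl i = cl j"
  shows "c\<^sub>1 * \<epsilon> powr p \<le> d \<epsilon> i j" "d \<epsilon> i j \<le> c\<^sub>2 * \<epsilon> powr p"
  using geometry assms unfolding dual_scale_geometry_def d_def by auto

lemma d_inter:
  assumes "\<epsilon> \<in> {0<..\<epsilon>\<^sub>1}" "cl i \<noteq> cl j"
  shows "D\<^sub>m\<^sub>i\<^sub>n \<le> d \<epsilon> i j" "d \<epsilon> i j \<le> D\<^sub>m\<^sub>a\<^sub>x"
proof -
  have "i \<noteq> j" using assms(2) by auto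
  then show "D\<^sub>m\<^sub>i\<^sub>n \<le> d \<epsilon> i j" "d \<epsilon> i j \<le> D\<^sub>m\<^sub>a\<^sub>x"
    using geometry assms unfolding dual_scale_geometry_def d_def by auto
qed

lemma d_pos:
  assumes "\<epsilon> \<in> {0<..\<epsilon>\<^sub>1}" "i \<noteq> j"
  shows "0 < d \<epsilon> i j"
proof (cases "cl i = cl j")
  case True
  have "0 < c\<^sub>1 * \<epsilon> powr p" using c\<^sub>1 assms(1) by simp
  then show ?thesis using d_intra(1)[OF assms True] by linarith
next
  case False
  then show ?thesis using d_inter(1)[OF assms(1) False] D\<^sub>m\<^sub>i\<^sub>n by linarith
qed

text \<open>A bound for all distances, uniform in \<epsilon>; divided by \<open>c\<^sub>0\<close> it
  bounds the delays.\<close>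

definition D\<^sub>a\<^sub>l\<^sub>l :: real where "D\<^sub>a\<^sub>l\<^sub>l = c\<^sub>2 * \<epsilon>\<^sub>1 powr p + D\<^sub>m\<^sub>a\<^sub>x"

lemma d_le:
  assumes "\<epsilon> \<in> {0<..\<epsilon>\<^sub>1}"
  shows "d \<epsilon> i j \<le> D\<^sub>a\<^sub>l\<^sub>l"
proof (cases "i = j \<or> cl i \<noteq> cl j")
  case True
  have "0 \<le> c\<^sub>2 * \<epsilon>\<^sub>1 powr p" using c\<^sub>2 by simp
  then show ?thesis
    using True d_inter(2)[OF assms, of i j] D\<^sub>m\<^sub>a\<^sub>x by (auto simp: D\<^sub>a\<^sub>l\<^sub>l_def d_def)
next
  case False
  have "\<epsilon> powr p \<le> \<epsilon>\<^sub>1 powr p" using assms p by (intro powr_mono2) auto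
  then have "c\<^sub>2 * \<epsilon> powr p \<le> c\<^sub>2 * \<epsilon>\<^sub>1 powr p" using c\<^sub>2 by simp
  then show ?thesis
    using False d_intra(2)[OF assms, of i j] D\<^sub>m\<^sub>a\<^sub>x by (auto simp: D\<^sub>a\<^sub>l\<^sub>l_def)
qed

lemma \<eta>_pos: "\<epsilon> \<in> {0<..\<epsilon>\<^sub>1} \<Longrightarrow> 0 < \<eta> \<epsilon>"
  by (simp add: \<eta>_def)

lemma \<epsilon>_eq_\<eta>: "\<epsilon> \<in> {0<..\<epsilon>\<^sub>1} \<Longrightarrow> \<epsilon> = \<eta> \<epsilon> * \<epsilon> powr p"
  by (simp add: \<eta>_def flip: powr_add)

text \<open>Of the factor \<epsilon> in the kernel, the part \<open>\<epsilon> powr p\<close> is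
  absorbed by the small distance and \<eta> remains. Interaction inside a cluster is thus of order
  \<eta>, between clusters only of order \<epsilon>.\<close>

lemma \<kappa>_intra:
  assumes "\<epsilon> \<in> {0<..\<epsilon>\<^sub>1}" "i \<noteq> j" "cl i = \<alpha>" "cl j = \<alpha>"
  shows "\<kappa> \<epsilon> i j = \<eta> \<epsilon> * K \<alpha> \<epsilon> $ i $ j"
proof -
  have "\<kappa> \<epsilon> i j = (\<eta> \<epsilon> * \<epsilon> powr p) * C j / (4 * pi * d \<epsilon> i j)"
    using \<epsilon>_eq_\<eta>[OF assms(1)] by (simp add: \<kappa>_def)
  then show ?thesis
    using assms by (simp add: K_def interaction_mat_def cluster_def d_def)
qed

text \<open>The rescaled distance lies between \<open>c\<^sub>1\<close> and
  \<open>c\<^sub>2\<close>. The lower bound for the entries, uniform in \<epsilon>, is what keeps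
  the limits of these matrices positive off the diagonal.\<close>

lemma K_entry_bounds:
  assumes "\<epsilon> \<in> {0<..\<epsilon>\<^sub>1}" "i \<noteq> j" "i \<in> cluster_of \<alpha>" "j \<in> cluster_of \<alpha>"
  shows "C j / (4 * pi * c\<^sub>2) \<le> K \<alpha> \<epsilon> $ i $ j" "K \<alpha> \<epsilon> $ i $ j \<le> C j / (4 * pi * c\<^sub>1)"
proof -
  have cl: "cl i = cl j" using assms by (simp add: cluster_def)
  have e: "0 < \<epsilon> powr p" using assms(1) by simp
  define \<rho> where "\<rho> = d \<epsilon> i j / \<epsilon> powr p"
  have \<rho>: "c\<^sub>1 \<le> \<rho>" "\<rho> \<le> c\<^sub>2"
    using d_intra[OF assms(1,2) cl] e by (simp_all add: \<rho>_def pos_le_divide_eq pos_divide_le_eq)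
  have eq: "K \<alpha> \<epsilon> $ i $ j = C j / (4 * pi * \<rho>)"
    using assms by (simp add: K_def interaction_mat_def \<rho>_def d_def)
  then show "C j / (4 * pi * c\<^sub>2) \<le> K \<alpha> \<epsilon> $ i $ j" "K \<alpha> \<epsilon> $ i $ j \<le> C j / (4 * pi * c\<^sub>1)"
    unfolding eq using \<rho> C_pos[of j] c\<^sub>1 c\<^sub>2
    by (auto intro!: divide_left_mono mult_pos_pos mult_left_mono)
qed

lemma K_off: "\<not> (i \<noteq> j \<and> i \<in> cluster_of \<alpha> \<and> j \<in> cluster_of \<alpha>) \<Longrightarrow> K \<alpha> \<epsilon> $ i $ j = 0"
  by (auto simp: K_def interaction_mat_def)

lemma K_sym: "C i * K \<alpha> \<epsilon> $ i $ j = C j * K \<alpha> \<epsilon> $ j $ i"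
  by (simp add: K_def interaction_mat_def dist_commute mult.commute)

lemma K_interaction:
  assumes "\<epsilon> \<in> {0<..\<epsilon>\<^sub>1}"
  shows "interaction_on C (cluster_of \<alpha>) (K \<alpha> \<epsilon>)"
  unfolding interaction_on_def
proof (intro conjI allI)
  fix i j
  have "0 < C j / (4 * pi * c\<^sub>2)" using C_pos c\<^sub>2 by simp
  then show "if i \<noteq> j \<and> i \<in> cluster_of \<alpha> \<and> j \<in> cluster_of \<alpha> then 0 < K \<alpha> \<epsilon> $ i $ j else K \<alpha> \<epsilon> $ i $ j = 0"
    using K_entry_bounds(1)[OF assms, of i j \<alpha>] K_off by (auto intro: less_le_trans)
qed (rule K_sym)

definition K\<^sub>m\<^sub>a\<^sub>x :: real where "K\<^sub>m\<^sub>a\<^sub>x = (\<Sum>j\<in>UNIV. C j / (4 * pi * c\<^sub>1))"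

lemma K_le:
  assumes "\<epsilon> \<in> {0<..\<epsilon>\<^sub>1}"
  shows "0 \<le> K \<alpha> \<epsilon> $ i $ j" "K \<alpha> \<epsilon> $ i $ j \<le> K\<^sub>m\<^sub>a\<^sub>x"
proof -
  have nn: "0 \<le> C j / (4 * pi * c\<^sub>1)" for j using C_pos[of j] c\<^sub>1 by simp
  have "C j / (4 * pi * c\<^sub>1) \<le> K\<^sub>m\<^sub>a\<^sub>x"
    unfolding K\<^sub>m\<^sub>a\<^sub>x_def by (rule member_le_sum) (use nn in auto)
  then show "K \<alpha> \<epsilon> $ i $ j \<le> K\<^sub>m\<^sub>a\<^sub>x"
    using K_entry_bounds(2)[OF assms, of i j \<alpha>] K_off[of i j \<alpha> \<epsilon>] nn[of j] by fastforce
  show "0 \<le> K \<alpha> \<epsilon> $ i $ j"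
    using interaction_onD(2)[OF K_interaction[OF assms]] .
qed

lemma lam_bounds:
  assumes "\<epsilon> \<in> {0<..\<epsilon>\<^sub>1}"
  shows "0 \<le> lam \<alpha> \<epsilon>" "lam \<alpha> \<epsilon> \<le> real CARD('m) * K\<^sub>m\<^sub>a\<^sub>x"
proof -
  obtain \<mu> v where v: "perron_pair (cluster_of \<alpha>) (K \<alpha> \<epsilon>) \<mu> v" "norm v = 1"
    by (rule perron_pair_exists[OF K_interaction[OF assms] cluster_nonempty])
  have "lam \<alpha> \<epsilon> = \<mu>"
    unfolding lam_def by (rule perron_eigenvalue_eq[OF K_interaction[OF assms] C_pos cluster_nonempty v(1)])
  then show "0 \<le> lam \<alpha> \<epsilon>" "lam \<alpha> \<epsilon> \<le> real CARD('m) * K\<^sub>m\<^sub>a\<^sub>x"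
    using perron_value_bounds[OF K_interaction[OF assms] cluster_nonempty v(1) K_le(2)[OF assms]] by auto
qed

lemma \<kappa>_sym: "C i * \<kappa> \<epsilon> i j = C j * \<kappa> \<epsilon> j i"
  by (simp add: \<kappa>_def d_sym[of \<epsilon> i j])

lemma \<kappa>_bounds:
  assumes "\<epsilon> \<in> {0<..\<epsilon>\<^sub>1}" "i \<noteq> j"
  shows "0 \<le> \<kappa> \<epsilon> i j" "\<kappa> \<epsilon> i j \<le> \<eta> \<epsilon> * K\<^sub>m\<^sub>a\<^sub>x + \<epsilon> * (C j / (4 * pi * D\<^sub>m\<^sub>i\<^sub>n))"
    "cl i \<noteq> cl j \<Longrightarrow> \<kappa> \<epsilon> i j \<le> \<epsilon> * (C j / (4 * pi * D\<^sub>m\<^sub>i\<^sub>n))"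
proof -
  show "0 \<le> \<kappa> \<epsilon> i j"
    using d_pos[OF assms] assms(1) C_pos[of j] by (simp add: \<kappa>_def)
  have nn: "0 \<le> \<epsilon> * (C j / (4 * pi * D\<^sub>m\<^sub>i\<^sub>n))" using assms(1) C_pos[of j] D\<^sub>m\<^sub>i\<^sub>n by simp
  have nn': "0 \<le> \<eta> \<epsilon> * K\<^sub>m\<^sub>a\<^sub>x"
    \<comment> \<open>Any cluster will do: one entry between 0 and
      \<open>K\<^sub>m\<^sub>a\<^sub>x\<close> shows that the latter is nonnegative.\<close>
    using \<eta>_pos[OF assms(1)] K_le[OF assms(1), of undefined i j] by simp
  show inter: "\<kappa> \<epsilon> i j \<le> \<epsilon> * (C j / (4 * pi * D\<^sub>m\<^sub>i\<^sub>n))" if "cl i \<noteq> cl j"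
  proof -
    have "\<epsilon> * C j / (4 * pi * d \<epsilon> i j) \<le> \<epsilon> * C j / (4 * pi * D\<^sub>m\<^sub>i\<^sub>n)"
      using d_inter(1)[OF assms(1) that] D\<^sub>m\<^sub>i\<^sub>n assms(1) C_pos[of j]
      by (intro divide_left_mono mult_left_mono mult_pos_pos) auto
    then show ?thesis by (simp add: \<kappa>_def)
  qed
  show "\<kappa> \<epsilon> i j \<le> \<eta> \<epsilon> * K\<^sub>m\<^sub>a\<^sub>x + \<epsilon> * (C j / (4 * pi * D\<^sub>m\<^sub>i\<^sub>n))"
  proof (cases "cl i = cl j")
    case True
    have "\<kappa> \<epsilon> i j \<le> \<eta> \<epsilon> * K\<^sub>m\<^sub>a\<^sub>x"
      unfolding \<kappa>_intra[OF assms True refl]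
      using \<eta>_pos[OF assms(1)] K_le(2)[OF assms(1)] by (intro mult_left_mono) auto
    then show ?thesis using nn by simp
  next
    case False
    then show ?thesis using inter nn' by simp
  qed
qed

lemma P_entry: "P \<epsilon> s $ i $ j = (if i = j then s\<^sup>2 / (of_real (\<omega> i))\<^sup>2 + 1 else s\<^sup>2 * q \<epsilon> i j s)"
  by (simp add: P_def P_mat_def D_mat_def mat_mult_entry Q_mat_def q_def \<kappa>_def d_def)

lemma q_has_derivative:
  "((\<lambda>s. s\<^sup>2 * q \<epsilon> i j s) has_field_derivative (2 * s - s\<^sup>2 * of_real (d \<epsilon> i j / c\<^sub>0)) * q \<epsilon> i j s) (at s within S)"
  unfolding q_def using c\<^sub>0 by (auto intro!: derivative_eq_intros simp: field_simps power2_eq_square)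

lemma P_entry_holomorphic: "(\<lambda>s. P \<epsilon> s $ i $ j) holomorphic_on UNIV"
proof (cases "i = j")
  case True
  then show ?thesis using \<omega>_pos[of i] unfolding P_entry by (auto intro!: holomorphic_intros)
next
  case False
  then show ?thesis
    unfolding P_entry q_def by (auto intro!: holomorphic_intros)
qed

lemma det_P_holomorphic: "(\<lambda>s. det (P \<epsilon> s)) holomorphic_on UNIV"
  by (intro holomorphic_on_det P_entry_holomorphic)

text \<open>All off-diagonal entries carry the factor \<open>s\<^sup>2\<close>, so \<open>P\<close>
  is the identity at 0. This point witnesses that \<open>det P\<close> does not vanish identically,
  whenever an order or the isolation of zeros is needed.\<close>

lemma det_P_0: "det (P \<epsilon> 0) \<noteq> 0"
proof -
  have "P \<epsilon> 0 = mat 1"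
    by (simp add: vec_eq_iff P_entry mat_def)
  then show ?thesis by simp
qed

lemma q_sym: "of_real (C i) * q \<epsilon> i j s = of_real (C j) * q \<epsilon> j i s"
proof -
  have "complex_of_real (C i) * of_real (\<kappa> \<epsilon> i j) = of_real (C j) * of_real (\<kappa> \<epsilon> j i)"
    using \<kappa>_sym[of i \<epsilon> j] by (metis of_real_mult)
  then show ?thesis
    unfolding q_def d_sym[of \<epsilon> j i] by (simp flip: mult.assoc)
qed

lemma P_sym: "C i * P \<epsilon> s $ i $ j = C j * P \<epsilon> s $ j $ i"
  using q_sym[of i \<epsilon> j s] by (simp add: P_entry algebra_simps)

lemma P_left_null:
  assumes "P \<epsilon> s *v x = 0"
  shows "(\<chi> i. of_real (C i) * x $ i) v* P \<epsilon> s = 0"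
proof -
  have "((\<chi> i. of_real (C i) * x $ i) v* P \<epsilon> s) $ j = of_real (C j) * (P \<epsilon> s *v x) $ j" for j
  proof -
    have "((\<chi> i. of_real (C i) * x $ i) v* P \<epsilon> s) $ j = (\<Sum>i\<in>UNIV. (of_real (C i) * P \<epsilon> s $ i $ j) * x $ i)"
      unfolding vector_matrix_mult_entry by (simp add: mult_ac)
    also have "\<dots> = of_real (C j) * (P \<epsilon> s *v x) $ j"
      unfolding P_sym[of _ \<epsilon> s j] matrix_vector_mult_def by (simp add: sum_distrib_left mult_ac)
    finally show ?thesis .
  qed
  then show ?thesis using assms by (simp add: vec_eq_iff)
qed

lemma
  assumes e: "\<And>n. e n \<in> {0<..\<epsilon>\<^sub>1}" "e \<longlonglongrightarrow> 0"
  shows \<eta>_tendsto_0: "(\<lambda>n. \<eta> (e n)) \<longlonglongrightarrow> 0" and powr_tendsto_0: "(\<lambda>n. e n powr p) \<longlonglongrightarrow> 0"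
    and \<kappa>_tendsto_0: "i \<noteq> j \<Longrightarrow> (\<lambda>n. \<kappa> (e n) i j) \<longlonglongrightarrow> 0"
proof -
  have e_nn: "0 \<le> e n" for n using e(1)[of n] by simp
  show \<eta>0: "(\<lambda>n. \<eta> (e n)) \<longlonglongrightarrow> 0"
    unfolding \<eta>_def by (rule tendsto_zero_powrI[OF e(2) tendsto_const]) (use e_nn p in auto)
  show "(\<lambda>n. e n powr p) \<longlonglongrightarrow> 0"
    by (rule tendsto_zero_powrI[OF e(2) tendsto_const]) (use e_nn p in auto)
  assume ij: "i \<noteq> j"
  have "(\<lambda>n. \<eta> (e n) * K\<^sub>m\<^sub>a\<^sub>x + e n * (C j / (4 * pi * D\<^sub>m\<^sub>i\<^sub>n))) \<longlonglongrightarrow> 0 * K\<^sub>m\<^sub>a\<^sub>x + 0 * (C j / (4 * pi * D\<^sub>m\<^sub>i\<^sub>n))"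
    by (intro tendsto_intros \<eta>0 e(2))
  then have "(\<lambda>n. \<eta> (e n) * K\<^sub>m\<^sub>a\<^sub>x + e n * (C j / (4 * pi * D\<^sub>m\<^sub>i\<^sub>n))) \<longlonglongrightarrow> 0" by simp
  then show "(\<lambda>n. \<kappa> (e n) i j) \<longlonglongrightarrow> 0"
    by (rule tendsto_sandwich[OF _ _ tendsto_const, rotated 2])
      (use \<kappa>_bounds(1,2)[OF e(1) ij] in \<open>auto intro: always_eventually\<close>)
qed

lemma d_tendsto_0:
  assumes e: "\<And>n. e n \<in> {0<..\<epsilon>\<^sub>1}" "e \<longlonglongrightarrow> 0" and "i \<noteq> j" "cl i = cl j"
  shows "(\<lambda>n. d (e n) i j) \<longlonglongrightarrow> 0"
proof (rule tendsto_sandwich[OF _ _ tendsto_const])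
  show "\<forall>\<^sub>F n in sequentially. d (e n) i j \<le> c\<^sub>2 * e n powr p"
    using d_intra(2)[OF e(1) assms(3,4)] by (simp add: always_eventually)
  show "(\<lambda>n. c\<^sub>2 * e n powr p) \<longlonglongrightarrow> 0"
    using powr_tendsto_0[OF e] tendsto_mult_right_zero by blast
qed (simp add: d_def)

lemma exp_bound:
  assumes "\<epsilon> \<in> {0<..\<epsilon>\<^sub>1}" "cmod s \<le> R"
  shows "cmod (exp (- (s * of_real (d \<epsilon> i j / c\<^sub>0)))) \<le> exp (R * (D\<^sub>a\<^sub>l\<^sub>l / c\<^sub>0))"
proof -
  have d: "0 \<le> d \<epsilon> i j / c\<^sub>0" "d \<epsilon> i j / c\<^sub>0 \<le> D\<^sub>a\<^sub>l\<^sub>l / c\<^sub>0"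
    using d_le[OF assms(1)] c\<^sub>0 by (auto simp: d_def divide_right_mono)
  have "cmod (exp (- (s * of_real (d \<epsilon> i j / c\<^sub>0)))) \<le> exp (cmod (- (s * of_real (d \<epsilon> i j / c\<^sub>0))))"
    by (rule norm_exp)
  also have "cmod (- (s * of_real (d \<epsilon> i j / c\<^sub>0))) = cmod s * (d \<epsilon> i j / c\<^sub>0)"
    using c\<^sub>0 by (simp add: norm_mult norm_divide d_def)
  also have "\<dots> \<le> R * (D\<^sub>a\<^sub>l\<^sub>l / c\<^sub>0)"
    using d assms(2) by (intro mult_mono) (auto intro: order_trans[OF norm_ge_zero])
  finally show ?thesis by simp
qed

lemma q_tendsto_0:
  assumes e: "\<And>n. e n \<in> {0<..\<epsilon>\<^sub>1}" "e \<longlonglongrightarrow> 0" and s: "\<And>n. cmod (s n) \<le> R" and ij: "i \<noteq> j"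
  shows "(\<lambda>n. q (e n) i j (s n)) \<longlonglongrightarrow> 0"
proof (rule tendsto_norm_zero_cancel, rule tendsto_sandwich[OF _ _ tendsto_const])
  show "\<forall>\<^sub>F n in sequentially. 0 \<le> norm (q (e n) i j (s n))" by simp
  show "\<forall>\<^sub>F n in sequentially. norm (q (e n) i j (s n)) \<le> \<kappa> (e n) i j * exp (R * (D\<^sub>a\<^sub>l\<^sub>l / c\<^sub>0))"
    using exp_bound[OF e(1) s] \<kappa>_bounds(1)[OF e(1) ij]
    by (auto intro!: always_eventually mult_left_mono simp: q_def norm_mult)
  show "(\<lambda>n. \<kappa> (e n) i j * exp (R * (D\<^sub>a\<^sub>l\<^sub>l / c\<^sub>0))) \<longlonglongrightarrow> 0"
    using \<kappa>_tendsto_0[OF e ij] tendsto_mult_left_zero by blast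
qed

end

subsection \<open>The limit of the rescaled system\<close>

context bubble_clusters
begin

text \<open>
  In the variable \<open>t\<close> with \<open>s = \<i> \<omega>\<^sub>\<alpha> + \<eta> t\<close>, the rows of cluster \<open>\<alpha>\<close> of \<open>P\<close> divided by \<open>\<eta>\<close> and
  the other rows of \<open>P\<close> have the limit \<open>lim_mat\<close>.
\<close>

definition scaled :: "'n \<Rightarrow> real \<Rightarrow> complex \<Rightarrow> complex ^ 'm ^ 'm" where
  "scaled \<alpha> \<epsilon> t = (\<chi> i j. (if i \<in> cluster_of \<alpha> then 1 / of_real (\<eta> \<epsilon>) else 1) *
     P \<epsilon> (center \<alpha> + of_real (\<eta> \<epsilon>) * t) $ i $ j)"

definition lim_mat :: "'n \<Rightarrow> real ^ 'm ^ 'm \<Rightarrow> complex \<Rightarrow> complex ^ 'm ^ 'm" where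
  "lim_mat \<alpha> k t = (\<chi> i j. if i \<in> cluster_of \<alpha>
     then if i = j then 2 * \<i> * t / of_real (\<omega>\<^sub>c \<alpha>) else - (of_real (\<omega>\<^sub>c \<alpha>))\<^sup>2 * of_real (k $ i $ j)
     else if i = j then 1 - (of_real (\<omega>\<^sub>c \<alpha>))\<^sup>2 / (of_real (\<omega> i))\<^sup>2 else 0)"

lemma \<omega>_cluster: "i \<in> cluster_of \<alpha> \<Longrightarrow> \<omega> i = \<omega>\<^sub>c \<alpha>"
  by (simp add: cluster_def \<omega>_cl)

lemma \<omega>_not_cluster: "i \<notin> cluster_of \<alpha> \<Longrightarrow> \<omega> i \<noteq> \<omega>\<^sub>c \<alpha>"
  using inj_\<omega> by (auto simp: cluster_def \<omega>_cl inj_eq)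

lemma scaled_null_iff:
  assumes "\<epsilon> \<in> {0<..\<epsilon>\<^sub>1}"
  shows "scaled \<alpha> \<epsilon> t *v x = 0 \<longleftrightarrow> P \<epsilon> (center \<alpha> + of_real (\<eta> \<epsilon>) * t) *v x = 0"
proof -
  have "(scaled \<alpha> \<epsilon> t *v x) $ i = (if i \<in> cluster_of \<alpha> then 1 / of_real (\<eta> \<epsilon>) else 1) *
      (P \<epsilon> (center \<alpha> + of_real (\<eta> \<epsilon>) * t) *v x) $ i" for i
    by (simp add: scaled_def matrix_vector_mult_def sum_distrib_left mult.assoc)
  then show ?thesis
    using \<eta>_pos[OF assms] by (auto simp: vec_eq_iff)
qed

text \<open>On the diagonal of the cluster, \<open>1 + s\<^sup>2 / \<omega>\<^sup>2\<close> has a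
  simple zero at the centre, so division by \<eta> leaves the finite limit
  \<open>2 \<i> t / \<omega>\<close>. Inside the cluster \<kappa> is \<eta> times an entry of
  \<open>K\<close>, and the delay factor tends to 1 because the distance tends to 0. Coupling to
  other clusters is of order \<epsilon>, so that after division by \<eta> a factor
  \<open>\<epsilon> powr p\<close> still makes it vanish.\<close>

lemma scaled_tendsto:
  assumes e: "\<And>n. e n \<in> {0<..\<epsilon>\<^sub>1}" "e \<longlonglongrightarrow> 0" and k: "(\<lambda>n. K \<alpha> (e n)) \<longlonglongrightarrow> k" and t: "t \<longlonglongrightarrow> t0"
  shows "(\<lambda>n. scaled \<alpha> (e n) (t n) $ i $ j) \<longlonglongrightarrow> lim_mat \<alpha> k t0 $ i $ j"
proof -
  define a where "a = (\<lambda>n. center \<alpha> + of_real (\<eta> (e n)) * t n)"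
  have \<eta>0: "(\<lambda>n. complex_of_real (\<eta> (e n))) \<longlonglongrightarrow> 0"
    using tendsto_of_real[OF \<eta>_tendsto_0[OF e]] by simp
  have "a \<longlonglongrightarrow> center \<alpha> + 0 * t0"
    unfolding a_def by (intro tendsto_intros \<eta>0 t)
  then have a: "a \<longlonglongrightarrow> center \<alpha>" by simp
  obtain R where R: "\<And>n. cmod (a n) \<le> R" using convergent_bounded[OF a] by blast
  have \<omega>0: "\<omega>\<^sub>c \<alpha> \<noteq> 0" "\<omega> i \<noteq> 0" using \<omega>c_pos[of \<alpha>] \<omega>_pos[of i] by auto
  have \<eta>_nz: "\<eta> (e n) \<noteq> 0" for n using \<eta>_pos[OF e(1)] by (metis less_irrefl)
  have M: "scaled \<alpha> (e n) (t n) $ i $ j = (if i \<in> cluster_of \<alpha> then 1 / of_real (\<eta> (e n)) else 1) * P (e n) (a n) $ i $ j" for n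
    by (simp add: scaled_def a_def)
  consider (1) "i = j" "i \<in> cluster_of \<alpha>" | (2) "i = j" "i \<notin> cluster_of \<alpha>" | (3) "i \<noteq> j" "i \<notin> cluster_of \<alpha>"
    | (4) "i \<noteq> j" "i \<in> cluster_of \<alpha>" "j \<in> cluster_of \<alpha>" | (5) "i \<noteq> j" "i \<in> cluster_of \<alpha>" "j \<notin> cluster_of \<alpha>"
    by blast
  then show ?thesis
  proof cases
    case 1
    have eq: "scaled \<alpha> (e n) (t n) $ i $ j = 2 * \<i> * t n / of_real (\<omega>\<^sub>c \<alpha>) + of_real (\<eta> (e n)) * (t n)\<^sup>2 / (of_real (\<omega>\<^sub>c \<alpha>))\<^sup>2" for n
      unfolding M P_entry a_def using 1 \<omega>0 \<eta>_nz[of n]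
      by (simp add: \<omega>_cluster field_simps power2_eq_square)
    have "(\<lambda>n. 2 * \<i> * t n / of_real (\<omega>\<^sub>c \<alpha>) + of_real (\<eta> (e n)) * (t n)\<^sup>2 / (of_real (\<omega>\<^sub>c \<alpha>))\<^sup>2)
      \<longlonglongrightarrow> 2 * \<i> * t0 / of_real (\<omega>\<^sub>c \<alpha>) + 0 * t0\<^sup>2 / (of_real (\<omega>\<^sub>c \<alpha>))\<^sup>2"
      using \<omega>0 by (intro tendsto_intros \<eta>0 t) auto
    then show ?thesis unfolding eq using 1 by (simp add: lim_mat_def)
  next
    case 2
    have "(\<lambda>n. (a n)\<^sup>2 / (of_real (\<omega> i))\<^sup>2 + 1) \<longlonglongrightarrow> (center \<alpha>)\<^sup>2 / (of_real (\<omega> i))\<^sup>2 + 1"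
      using \<omega>0 by (intro tendsto_intros a) auto
    then show ?thesis
      unfolding M P_entry using 2 by (simp add: lim_mat_def power_mult_distrib)
  next
    case 3
    have "(\<lambda>n. (a n)\<^sup>2 * q (e n) i j (a n)) \<longlonglongrightarrow> (center \<alpha>)\<^sup>2 * 0"
      by (intro tendsto_intros a q_tendsto_0[OF e R 3(1)])
    then show ?thesis
      unfolding M P_entry using 3 by (simp add: lim_mat_def)
  next
    case 4
    have cl: "cl i = \<alpha>" "cl j = \<alpha>" "cl i = cl j" using 4 by (auto simp: cluster_def)
    have d0: "(\<lambda>n. d (e n) i j) \<longlonglongrightarrow> 0"
      by (rule d_tendsto_0[OF e 4(1) cl(3)])
    have eq: "scaled \<alpha> (e n) (t n) $ i $ j = (a n)\<^sup>2 * of_real (K \<alpha> (e n) $ i $ j) * exp (- (a n * of_real (d (e n) i j / c\<^sub>0)))" for n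
      unfolding M P_entry q_def \<kappa>_intra[OF e(1) 4(1) cl(1,2)] using 4 \<eta>_nz[of n] by simp
    have "(\<lambda>n. (a n)\<^sup>2 * of_real (K \<alpha> (e n) $ i $ j) * exp (- (a n * of_real (d (e n) i j / c\<^sub>0))))
      \<longlonglongrightarrow> (center \<alpha>)\<^sup>2 * of_real (k $ i $ j) * exp (- (center \<alpha> * of_real (0 / c\<^sub>0)))"
      using c\<^sub>0 by (intro tendsto_intros a d0 k) auto
    then show ?thesis
      unfolding eq using 4 by (simp add: lim_mat_def power_mult_distrib)
  next
    case 5
    have cl: "cl i \<noteq> cl j" using 5 by (auto simp: cluster_def)
    have "(\<lambda>n. K \<alpha> (e n) $ i $ j) \<longlonglongrightarrow> k $ i $ j" by (intro tendsto_intros k)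
    then have k0: "k $ i $ j = 0"
      using K_off[of i j \<alpha>] 5 by (simp add: LIMSEQ_const_iff)
    define B where "B = C j / (4 * pi * D\<^sub>m\<^sub>i\<^sub>n) * exp (R * (D\<^sub>a\<^sub>l\<^sub>l / c\<^sub>0))"
    have "(\<lambda>n. q (e n) i j (a n) / of_real (\<eta> (e n))) \<longlonglongrightarrow> 0"
    proof (rule tendsto_norm_zero_cancel, rule tendsto_sandwich[OF _ _ tendsto_const])
      show "\<forall>\<^sub>F n in sequentially. norm (q (e n) i j (a n) / of_real (\<eta> (e n))) \<le> e n powr p * B"
      proof (intro always_eventually allI)
        fix n
        have nn: "0 \<le> e n * (C j / (4 * pi * D\<^sub>m\<^sub>i\<^sub>n))"
          using order_trans[OF \<kappa>_bounds(1)[OF e(1) 5(1), of n] \<kappa>_bounds(3)[OF e(1) 5(1) cl, of n]] .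
        have "cmod (q (e n) i j (a n)) \<le> e n * (C j / (4 * pi * D\<^sub>m\<^sub>i\<^sub>n)) * exp (R * (D\<^sub>a\<^sub>l\<^sub>l / c\<^sub>0))"
          unfolding q_def norm_mult using \<kappa>_bounds(1,3)[OF e(1) 5(1)] cl exp_bound[OF e(1) R]
          by (intro mult_mono nn) auto
        also have "\<dots> = \<eta> (e n) * (e n powr p * B)"
          by (subst \<epsilon>_eq_\<eta>[OF e(1)]) (simp add: B_def)
        finally show "norm (q (e n) i j (a n) / of_real (\<eta> (e n))) \<le> e n powr p * B"
          using \<eta>_pos[OF e(1), of n] by (simp add: norm_divide field_simps)
      qed
      show "(\<lambda>n. e n powr p * B) \<longlonglongrightarrow> 0"
        using powr_tendsto_0[OF e] tendsto_mult_left_zero by blast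
    qed simp
    then have "(\<lambda>n. (a n)\<^sup>2 * (q (e n) i j (a n) / of_real (\<eta> (e n)))) \<longlonglongrightarrow> (center \<alpha>)\<^sup>2 * 0"
      by (intro tendsto_intros a)
    then show ?thesis
      unfolding M P_entry using 5 k0 by (simp add: lim_mat_def)
  qed
qed

text \<open>Rows outside the cluster are diagonal with a nonzero entry, because the frequencies of
  different clusters differ and are positive; rows inside are the eigenvalue equation of
  \<open>k\<close> multiplied by a constant.\<close>

lemma lim_mat_null:
  assumes x: "lim_mat \<alpha> k t *v x = 0" and k: "interaction_on C (cluster_of \<alpha>) k"
  shows "i \<notin> cluster_of \<alpha> \<Longrightarrow> x $ i = 0"
    "i \<in> cluster_of \<alpha> \<Longrightarrow> (\<Sum>j\<in>UNIV. of_real (k $ i $ j) * x $ j) = 2 * \<i> * t / of_real (\<omega>\<^sub>c \<alpha>) ^ 3 * x $ i"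
proof -
  have row: "(\<Sum>j\<in>UNIV. lim_mat \<alpha> k t $ i $ j * x $ j) = 0"
    using arg_cong[OF x, of "\<lambda>v. v $ i"] by (simp add: matrix_vector_mult_def)
  show "x $ i = 0" if "i \<notin> cluster_of \<alpha>"
  proof -
    have "(\<Sum>j\<in>UNIV. lim_mat \<alpha> k t $ i $ j * x $ j) =
        (\<Sum>j\<in>UNIV. if j = i then (1 - (of_real (\<omega>\<^sub>c \<alpha>))\<^sup>2 / (of_real (\<omega> i))\<^sup>2) * x $ i else 0)"
      using that by (intro sum.cong) (auto simp: lim_mat_def)
    then have "(1 - (complex_of_real (\<omega>\<^sub>c \<alpha>))\<^sup>2 / (of_real (\<omega> i))\<^sup>2) * x $ i = 0"
      using row by simp
    moreover have "(complex_of_real (\<omega>\<^sub>c \<alpha>))\<^sup>2 / (of_real (\<omega> i))\<^sup>2 \<noteq> 1"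
    proof
      assume "(complex_of_real (\<omega>\<^sub>c \<alpha>))\<^sup>2 / (of_real (\<omega> i))\<^sup>2 = 1"
      then have "complex_of_real ((\<omega>\<^sub>c \<alpha>)\<^sup>2) = complex_of_real ((\<omega> i)\<^sup>2)"
        using \<omega>_pos[of i] by (simp add: field_simps)
      then have "(\<omega>\<^sub>c \<alpha>)\<^sup>2 = (\<omega> i)\<^sup>2" by (simp only: of_real_eq_iff)
      then have "\<omega>\<^sub>c \<alpha> = \<omega> i" using \<omega>_pos[of i] \<omega>c_pos[of \<alpha>] by (simp add: power2_eq_iff)
      then show False using \<omega>_not_cluster[OF that] by simp
    qed
    ultimately show ?thesis by (metis eq_iff_diff_eq_0 mult_eq_0_iff)
  qed
  assume i: "i \<in> cluster_of \<alpha>"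
  have kii: "k $ i $ i = 0" using k unfolding interaction_on_def by metis
  have "(\<Sum>j\<in>UNIV. lim_mat \<alpha> k t $ i $ j * x $ j) = (\<Sum>j\<in>UNIV. (if j = i then 2 * \<i> * t / of_real (\<omega>\<^sub>c \<alpha>) * x $ i else 0)
      - (of_real (\<omega>\<^sub>c \<alpha>))\<^sup>2 * (of_real (k $ i $ j) * x $ j))"
    using i kii by (intro sum.cong) (auto simp: lim_mat_def)
  also have "\<dots> = 2 * \<i> * t / of_real (\<omega>\<^sub>c \<alpha>) * x $ i - (of_real (\<omega>\<^sub>c \<alpha>))\<^sup>2 * (\<Sum>j\<in>UNIV. of_real (k $ i $ j) * x $ j)"
    by (simp add: sum_subtractf sum_distrib_left)
  finally have "(of_real (\<omega>\<^sub>c \<alpha>))\<^sup>2 * (\<Sum>j\<in>UNIV. of_real (k $ i $ j) * x $ j) = 2 * \<i> * t / of_real (\<omega>\<^sub>c \<alpha>) * x $ i"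
    using row by simp
  then show "(\<Sum>j\<in>UNIV. of_real (k $ i $ j) * x $ j) = 2 * \<i> * t / of_real (\<omega>\<^sub>c \<alpha>) ^ 3 * x $ i"
    using \<omega>c_pos[of \<alpha>] by (simp add: field_simps power2_eq_square power3_eq_cube)
qed

text \<open>At \<open>t = shift \<alpha> \<mu>\<close> the eigenvalue in question is \<mu> itself,
  where uniqueness of the Perron vector applies.\<close>

lemma lim_mat_shift_null:
  assumes "lim_mat \<alpha> k (shift \<alpha> \<mu>) *v x = 0" and k: "interaction_on C (cluster_of \<alpha>) k"
    and v: "perron_pair (cluster_of \<alpha>) k \<mu> v"
  shows "\<exists>c. \<forall>i. x $ i = c * of_real (v $ i)"
proof (rule perron_eigenvector_unique[OF k C_pos cluster_nonempty v])
  have "2 * \<i> * shift \<alpha> \<mu> / of_real (\<omega>\<^sub>c \<alpha>) ^ 3 = of_real \<mu>"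
    using \<omega>c_pos[of \<alpha>] by (simp add: shift_def field_simps)
  then show "(\<Sum>j\<in>UNIV. of_real (k $ i $ j) * x $ j) = of_real \<mu> * x $ i" if "i \<in> cluster_of \<alpha>" for i
    using lim_mat_null(2)[OF assms(1,2) that] by simp
qed (use lim_mat_null(1)[OF assms(1,2)] in auto)

text \<open>A null vector would give \<open>k\<close> an eigenvalue of modulus
  \<open>2 |t| / \<omega>\<^sub>c\<^sup>3\<close>, beyond the Perron bound. The purpose is to
  exclude that the limit determinant is constant, as Hurwitz' theorem demands.\<close>

lemma lim_mat_det_nonzero:
  assumes k: "interaction_on C (cluster_of \<alpha>) k" and v: "perron_pair (cluster_of \<alpha>) k \<mu> v"
    and t: "cmod (shift \<alpha> \<mu>) < cmod t"
  shows "det (lim_mat \<alpha> k t) \<noteq> 0"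
proof
  assume "det (lim_mat \<alpha> k t) = 0"
  then obtain x where x: "x \<noteq> 0" "lim_mat \<alpha> k t *v x = 0" unfolding det_eq_0_iff_kernel by blast
  then obtain i where i: "x $ i \<noteq> 0" by (auto simp: vec_eq_iff)
  have iI: "i \<in> cluster_of \<alpha>" using lim_mat_null(1)[OF x(2) k] i by blast
  have "(\<Sum>j\<in>UNIV. of_real (k $ i $ j) * x $ j) = 2 * \<i> * t / of_real (\<omega>\<^sub>c \<alpha>) ^ 3 * x $ i" for i
  proof (cases "i \<in> cluster_of \<alpha>")
    case False
    then show ?thesis
      using lim_mat_null(1)[OF x(2) k] interaction_onD(4)[OF k] by simp
  qed (rule lim_mat_null(2)[OF x(2) k])
  from perron_eigenvalue_bound[OF k C_pos v this iI i]
  have "2 * cmod t / \<omega>\<^sub>c \<alpha> ^ 3 \<le> \<mu>"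
    using \<omega>c_pos[of \<alpha>] by (simp add: norm_divide norm_mult norm_power)
  then have "2 * cmod t \<le> \<omega>\<^sub>c \<alpha> ^ 3 * \<mu>"
    using \<omega>c_pos[of \<alpha>] by (simp add: field_simps)
  also have "\<dots> \<le> \<bar>\<omega>\<^sub>c \<alpha> ^ 3 * \<mu>\<bar>" by (rule abs_ge_self)
  also have "\<dots> = 2 * cmod (shift \<alpha> \<mu>)"
    unfolding shift_def norm_mult norm_of_real by (simp add: norm_divide)
  finally show False using t by simp
qed

text \<open>Matrix, Perron value and unit Perron vector are extracted together by compactness, which
  replaces a continuity argument for the Perron value. Strict positivity does not pass to limits by
  itself: for \<open>k\<close> it comes from the uniform lower bound of the entries, for the vector
  from \<open>nonneg_eigenvector_positive\<close>.\<close>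

lemma perron_subsequence:
  assumes e: "\<And>n. e n \<in> {0<..\<epsilon>\<^sub>1}"
  obtains \<phi> :: "nat \<Rightarrow> nat" and k \<mu> v where "strict_mono \<phi>" "(\<lambda>n. K \<alpha> (e (\<phi> n))) \<longlonglongrightarrow> k"
    "(\<lambda>n. lam \<alpha> (e (\<phi> n))) \<longlonglongrightarrow> \<mu>" "interaction_on C (cluster_of \<alpha>) k" "perron_pair (cluster_of \<alpha>) k \<mu> v"
proof -
  let ?I = "cluster_of \<alpha>"
  have "\<exists>v. perron_pair ?I (K \<alpha> (e n)) (lam \<alpha> (e n)) v \<and> norm v = 1" for n
  proof -
    obtain \<mu> v where v: "perron_pair ?I (K \<alpha> (e n)) \<mu> v" "norm v = 1"
      by (rule perron_pair_exists[OF K_interaction[OF e] cluster_nonempty])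
    have "lam \<alpha> (e n) = \<mu>"
      unfolding lam_def by (rule perron_eigenvalue_eq[OF K_interaction[OF e] C_pos cluster_nonempty v(1)])
    then show ?thesis using v by blast
  qed
  then obtain v where v: "\<And>n. perron_pair ?I (K \<alpha> (e n)) (lam \<alpha> (e n)) (v n)" "\<And>n. norm (v n) = 1"
    by metis
  define f where "f = (\<lambda>n. (K \<alpha> (e n), lam \<alpha> (e n), v n))"
  have "bounded (range (\<lambda>n. K \<alpha> (e n)))"
  proof -
    have "norm (K \<alpha> (e n)) \<le> (\<Sum>i\<in>(UNIV::'m set). \<Sum>j\<in>(UNIV::'m set). K\<^sub>m\<^sub>a\<^sub>x)" for n
    proof -
      have "norm (K \<alpha> (e n)) \<le> (\<Sum>i\<in>UNIV. norm (K \<alpha> (e n) $ i))"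
        unfolding norm_vec_def by (rule L2_set_le_sum) simp
      also have "\<dots> \<le> (\<Sum>i\<in>(UNIV::'m set). \<Sum>j\<in>(UNIV::'m set). K\<^sub>m\<^sub>a\<^sub>x)"
      proof (rule sum_mono)
        fix i
        have "norm (K \<alpha> (e n) $ i) \<le> (\<Sum>j\<in>UNIV. \<bar>K \<alpha> (e n) $ i $ j\<bar>)"
          by (rule norm_le_l1_cart)
        also have "\<dots> \<le> (\<Sum>j\<in>(UNIV::'m set). K\<^sub>m\<^sub>a\<^sub>x)"
          using K_le[OF e] by (intro sum_mono) simp
        finally show "norm (K \<alpha> (e n) $ i) \<le> (\<Sum>j\<in>(UNIV::'m set). K\<^sub>m\<^sub>a\<^sub>x)" .
      qed
      finally show ?thesis .
    qed
    then show ?thesis unfolding bounded_iff by blast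
  qed
  moreover have "bounded (range (\<lambda>n. lam \<alpha> (e n)))"
    unfolding bounded_iff using lam_bounds[OF e] by (intro exI[of _ "real CARD('m) * K\<^sub>m\<^sub>a\<^sub>x"]) auto
  moreover have "bounded (range v)"
    unfolding bounded_iff using v(2) by (intro exI[of _ 1]) auto
  ultimately have "bounded (range (\<lambda>n. K \<alpha> (e n)) \<times> range (\<lambda>n. lam \<alpha> (e n)) \<times> range v)"
    by (intro bounded_Times)
  then have "bounded (range f)"
    by (rule bounded_subset) (auto simp: f_def)
  then obtain l \<phi> where \<phi>: "strict_mono \<phi>" "(f \<circ> \<phi>) \<longlonglongrightarrow> l"
    using bounded_imp_convergent_subsequence by metis
  define k \<mu> w where "k = fst l" "\<mu> = fst (snd l)" "w = snd (snd l)"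
  have k: "(\<lambda>n. K \<alpha> (e (\<phi> n))) \<longlonglongrightarrow> k" and \<mu>: "(\<lambda>n. lam \<alpha> (e (\<phi> n))) \<longlonglongrightarrow> \<mu>" and w: "(\<lambda>n. v (\<phi> n)) \<longlonglongrightarrow> w"
    using tendsto_fst[OF \<phi>(2)] tendsto_fst[OF tendsto_snd[OF \<phi>(2)]] tendsto_snd[OF tendsto_snd[OF \<phi>(2)]]
    by (simp_all add: f_def k_\<mu>_w_def o_def)
  have kij: "(\<lambda>n. K \<alpha> (e (\<phi> n)) $ i $ j) \<longlonglongrightarrow> k $ i $ j" for i j
    by (intro tendsto_intros k)
  have wi: "(\<lambda>n. v (\<phi> n) $ i) \<longlonglongrightarrow> w $ i" for i
    by (intro tendsto_intros w)
  have int: "interaction_on C ?I k"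
    unfolding interaction_on_def
  proof (intro conjI allI)
    fix i j
    have "(\<lambda>n. C i * K \<alpha> (e (\<phi> n)) $ i $ j) \<longlonglongrightarrow> C i * k $ i $ j"
      by (intro tendsto_intros kij)
    moreover have "(\<lambda>n. C i * K \<alpha> (e (\<phi> n)) $ i $ j) \<longlonglongrightarrow> C j * k $ j $ i"
      unfolding K_sym[of i _ _ j] by (intro tendsto_intros kij)
    ultimately show "C i * k $ i $ j = C j * k $ j $ i"
      by (rule LIMSEQ_unique)
    show "if i \<noteq> j \<and> i \<in> ?I \<and> j \<in> ?I then 0 < k $ i $ j else k $ i $ j = 0"
    proof (cases "i \<noteq> j \<and> i \<in> ?I \<and> j \<in> ?I")
      case True
      have "C j / (4 * pi * c\<^sub>2) \<le> k $ i $ j"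
        by (rule LIMSEQ_le_const[OF kij]) (use K_entry_bounds(1)[OF e, of i j \<alpha>] True in auto)
      moreover have "0 < C j / (4 * pi * c\<^sub>2)" using C_pos c\<^sub>2 by simp
      ultimately show ?thesis using True by simp
    next
      case False
      then show ?thesis
        using kij[of i j] K_off[OF False] by (simp add: LIMSEQ_const_iff)
    qed
  qed
  have "perron_pair ?I k \<mu> w"
  proof (rule nonneg_eigenvector_positive[OF int])
    show "0 \<le> w $ i" for i
      by (rule LIMSEQ_le_const[OF wi]) (use perron_pairD(4)[OF v(1)] in auto)
    show "w $ i = 0" if "i \<notin> ?I" for i
      using wi[of i] perron_pairD(2)[OF v(1) that] by (simp add: LIMSEQ_const_iff)
    have "(\<lambda>n. norm (v (\<phi> n))) \<longlonglongrightarrow> norm w"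
      by (intro tendsto_intros w)
    then show "w \<noteq> 0" by (auto simp: v(2) LIMSEQ_const_iff)
    show "(\<Sum>j\<in>UNIV. k $ i $ j * w $ j) = \<mu> * w $ i" for i
    proof (rule LIMSEQ_unique)
      show "(\<lambda>n. \<Sum>j\<in>UNIV. K \<alpha> (e (\<phi> n)) $ i $ j * v (\<phi> n) $ j) \<longlonglongrightarrow> (\<Sum>j\<in>UNIV. k $ i $ j * w $ j)"
        by (intro tendsto_intros kij wi)
      show "(\<lambda>n. \<Sum>j\<in>UNIV. K \<alpha> (e (\<phi> n)) $ i $ j * v (\<phi> n) $ j) \<longlonglongrightarrow> \<mu> * w $ i"
        unfolding perron_pairD(3)[OF v(1)] by (intro tendsto_intros \<mu> wi)
    qed
  qed
  then show ?thesis using that \<phi>(1) k \<mu> int by blast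
qed

text \<open>A unit null vector may carry any phase, which accounts for \<open>c\<close>; it is
  nonzero because the norms are 1. The sequence \<open>a\<close> is an arbitrary one with the
  leading asymptotics, so that the gap argument can apply the lemma to a second family of
  zeros.\<close>

lemma principal_null_vector_limit:
  assumes e: "\<And>n. e n \<in> {0<..\<epsilon>\<^sub>1}" "e \<longlonglongrightarrow> 0"
    and a: "(\<lambda>n. (a n - center \<alpha>) / of_real (\<eta> (e n)) - shift \<alpha> (lam \<alpha> (e n))) \<longlonglongrightarrow> 0"
    and x: "\<And>n. P (e n) (a n) *v x n = 0" "\<And>n. norm (x n) = 1"
  obtains \<phi> :: "nat \<Rightarrow> nat" and c :: complex and v where "strict_mono \<phi>" "c \<noteq> 0"
    "\<And>i. i \<in> cluster_of \<alpha> \<Longrightarrow> 0 < v i" "\<And>i. i \<notin> cluster_of \<alpha> \<Longrightarrow> v i = (0::real)"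
    "\<And>i. (\<lambda>n. x (\<phi> n) $ i) \<longlonglongrightarrow> c * of_real (v i)"
proof -
  obtain \<phi> :: "nat \<Rightarrow> nat" and k \<mu> v where \<phi>: "strict_mono \<phi>" "(\<lambda>n. K \<alpha> (e (\<phi> n))) \<longlonglongrightarrow> k"
    "(\<lambda>n. lam \<alpha> (e (\<phi> n))) \<longlonglongrightarrow> \<mu>" "interaction_on C (cluster_of \<alpha>) k" "perron_pair (cluster_of \<alpha>) k \<mu> v"
    by (rule perron_subsequence[OF e(1)])
  have "bounded (range (x \<circ> \<phi>))"
    unfolding bounded_iff using x(2) by (intro exI[of _ 1]) auto
  then obtain l \<psi> where \<psi>: "strict_mono \<psi>" "((x \<circ> \<phi>) \<circ> \<psi>) \<longlonglongrightarrow> l"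
    using bounded_imp_convergent_subsequence by metis
  define \<theta> where "\<theta> = \<phi> \<circ> \<psi>"
  have \<theta>: "strict_mono \<theta>" unfolding \<theta>_def using \<phi>(1) \<psi>(1) by (rule strict_mono_o)
  have xl: "(\<lambda>n. x (\<theta> n)) \<longlonglongrightarrow> l" using \<psi>(2) by (simp add: \<theta>_def o_def)
  have e\<theta>: "\<And>n. e (\<theta> n) \<in> {0<..\<epsilon>\<^sub>1}" "(\<lambda>n. e (\<theta> n)) \<longlonglongrightarrow> 0"
    using e(1) LIMSEQ_subseq_LIMSEQ[OF e(2) \<theta>] by (simp_all add: o_def)
  have k: "(\<lambda>n. K \<alpha> (e (\<theta> n))) \<longlonglongrightarrow> k" and \<mu>: "(\<lambda>n. lam \<alpha> (e (\<theta> n))) \<longlonglongrightarrow> \<mu>"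
    using LIMSEQ_subseq_LIMSEQ[OF \<phi>(2) \<psi>(1)] LIMSEQ_subseq_LIMSEQ[OF \<phi>(3) \<psi>(1)] by (simp_all add: \<theta>_def o_def)
  define t where "t = (\<lambda>n. (a (\<theta> n) - center \<alpha>) / of_real (\<eta> (e (\<theta> n))))"
  have "(\<lambda>n. t n - shift \<alpha> (lam \<alpha> (e (\<theta> n)))) \<longlonglongrightarrow> 0"
    using LIMSEQ_subseq_LIMSEQ[OF a \<theta>] by (simp add: t_def o_def)
  moreover have "(\<lambda>n. shift \<alpha> (lam \<alpha> (e (\<theta> n)))) \<longlonglongrightarrow> shift \<alpha> \<mu>"
    unfolding shift_def by (intro tendsto_intros \<mu>)
  ultimately have "(\<lambda>n. (t n - shift \<alpha> (lam \<alpha> (e (\<theta> n)))) + shift \<alpha> (lam \<alpha> (e (\<theta> n)))) \<longlonglongrightarrow> 0 + shift \<alpha> \<mu>"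
    by (rule tendsto_add)
  then have t: "t \<longlonglongrightarrow> shift \<alpha> \<mu>" by simp
  have null: "scaled \<alpha> (e (\<theta> n)) (t n) *v x (\<theta> n) = 0" for n
  proof -
    have "center \<alpha> + of_real (\<eta> (e (\<theta> n))) * t n = a (\<theta> n)"
      using \<eta>_pos[OF e\<theta>(1), of n] by (simp add: t_def)
    then show ?thesis
      unfolding scaled_null_iff[OF e\<theta>(1)] using x(1) by simp
  qed
  have "(lim_mat \<alpha> k (shift \<alpha> \<mu>) *v l) $ i = 0" for i
  proof (rule LIMSEQ_unique)
    show "(\<lambda>n. (scaled \<alpha> (e (\<theta> n)) (t n) *v x (\<theta> n)) $ i) \<longlonglongrightarrow> (lim_mat \<alpha> k (shift \<alpha> \<mu>) *v l) $ i"
      unfolding matrix_vector_mult_def vec_lambda_beta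
      by (intro tendsto_intros scaled_tendsto[OF e\<theta> k t] xl)
    show "(\<lambda>n. (scaled \<alpha> (e (\<theta> n)) (t n) *v x (\<theta> n)) $ i) \<longlonglongrightarrow> 0"
      by (simp add: null)
  qed
  then have "lim_mat \<alpha> k (shift \<alpha> \<mu>) *v l = 0" by (simp add: vec_eq_iff)
  from lim_mat_shift_null[OF this \<phi>(4,5)]
  obtain c where c: "\<And>i. l $ i = c * of_real (v $ i)" by blast
  have "(\<lambda>n. norm (x (\<theta> n))) \<longlonglongrightarrow> norm l" by (intro tendsto_intros xl)
  then have "l \<noteq> 0" by (auto simp: x(2) LIMSEQ_const_iff)
  then have "c \<noteq> 0" using c by (auto simp: vec_eq_iff)
  moreover have "(\<lambda>n. x (\<theta> n) $ i) \<longlonglongrightarrow> c * of_real (v $ i)" for i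
    unfolding c[symmetric] by (intro tendsto_intros xl)
  ultimately show ?thesis
    using that[OF \<theta>, of c "\<lambda>i. v $ i"] perron_pairD(1,2)[OF \<phi>(5)] by blast
qed

end

subsection \<open>Simplicity and gap of the principal zero\<close>

lemma unit_null_vector:
  fixes A :: "complex ^ 'm ^ ('m::finite)"
  assumes "A *v y = 0" "y \<noteq> 0"
  obtains x c where "A *v x = 0" "norm x = 1" "x = c *\<^sub>R y"
proof -
  have "A *v (inverse (norm y) *\<^sub>R y) = inverse (norm y) *\<^sub>R (A *v y)"
    by (simp add: vec_eq_iff matrix_vector_mult_def scaleR_sum_right)
  then have "A *v (inverse (norm y) *\<^sub>R y) = 0" using assms(1) by simp
  moreover have "norm (inverse (norm y) *\<^sub>R y) = 1" using assms(2) by simp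
  ultimately show ?thesis using that by blast
qed

lemma det_zero_unit_null_vector:
  fixes A :: "complex ^ 'm ^ ('m::finite)"
  assumes "det A = 0"
  shows "\<exists>x. A *v x = 0 \<and> norm x = 1"
  using assms unit_null_vector unfolding det_eq_0_iff_kernel by metis

context bubble_clusters
begin

text \<open>The little-o condition on the principal resonance, divided by \<eta> so that it becomes
  a limit in the rescaled variable \<open>t\<close>.\<close>

definition leading_order :: "'n \<Rightarrow> (real \<Rightarrow> complex) \<Rightarrow> bool" where
  "leading_order \<alpha> a \<longleftrightarrow>
     ((\<lambda>\<epsilon>. (a \<epsilon> - center \<alpha>) / of_real (\<eta> \<epsilon>) - shift \<alpha> (lam \<alpha> \<epsilon>)) \<longlongrightarrow> 0) (at_right 0)"

lemma leading_order_sequence: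
  assumes "leading_order \<alpha> a" and e: "\<And>n. e n \<in> {0<..\<epsilon>\<^sub>1}" "e \<longlonglongrightarrow> 0"
  shows "(\<lambda>n. (a (e n) - center \<alpha>) / of_real (\<eta> (e n)) - shift \<alpha> (lam \<alpha> (e n))) \<longlonglongrightarrow> 0"
proof -
  have "filterlim e (at_right 0) sequentially"
    using e by (intro tendsto_imp_filterlim_at_right) auto
  then show ?thesis
    using assms(1) unfolding leading_order_def by (rule filterlim_compose[rotated])
qed

lemma shift_bound:
  assumes "\<epsilon> \<in> {0<..\<epsilon>\<^sub>1}"
  shows "cmod (shift \<alpha> (lam \<alpha> \<epsilon>)) \<le> \<omega>\<^sub>c \<alpha> ^ 3 * (real CARD('m) * K\<^sub>m\<^sub>a\<^sub>x)"
proof -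
  have "cmod (shift \<alpha> (lam \<alpha> \<epsilon>)) = \<omega>\<^sub>c \<alpha> ^ 3 * lam \<alpha> \<epsilon> / 2"
    using lam_bounds(1)[OF assms, of \<alpha>] \<omega>c_pos[of \<alpha>]
    unfolding shift_def norm_mult norm_of_real by (simp add: norm_divide abs_mult)
  also have "\<dots> \<le> \<omega>\<^sub>c \<alpha> ^ 3 * lam \<alpha> \<epsilon>"
    using lam_bounds(1)[OF assms, of \<alpha>] \<omega>c_pos[of \<alpha>] by simp
  also have "\<dots> \<le> \<omega>\<^sub>c \<alpha> ^ 3 * (real CARD('m) * K\<^sub>m\<^sub>a\<^sub>x)"
    using lam_bounds(2)[OF assms, of \<alpha>] \<omega>c_pos[of \<alpha>] by (intro mult_left_mono) auto
  finally show ?thesis .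
qed

text \<open>The shifts along the sequence need not converge; their boundedness suffices, since they
  are multiplied by \<eta>.\<close>

lemma leading_order_tendsto:
  assumes e: "\<And>n. e n \<in> {0<..\<epsilon>\<^sub>1}" "e \<longlonglongrightarrow> 0"
    and a: "(\<lambda>n. (a n - center \<alpha>) / of_real (\<eta> (e n)) - shift \<alpha> (lam \<alpha> (e n))) \<longlonglongrightarrow> 0"
  shows "a \<longlonglongrightarrow> center \<alpha>"
proof -
  define t where "t = (\<lambda>n. (a n - center \<alpha>) / of_real (\<eta> (e n)) - shift \<alpha> (lam \<alpha> (e n)))"
  define B where "B = \<omega>\<^sub>c \<alpha> ^ 3 * (real CARD('m) * K\<^sub>m\<^sub>a\<^sub>x)"
  have \<eta>0: "(\<lambda>n. complex_of_real (\<eta> (e n))) \<longlonglongrightarrow> 0"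
    using tendsto_of_real[OF \<eta>_tendsto_0[OF e]] by simp
  have eq: "a n = center \<alpha> + (of_real (\<eta> (e n)) * t n + of_real (\<eta> (e n)) * shift \<alpha> (lam \<alpha> (e n)))" for n
    using \<eta>_pos[OF e(1), of n] by (simp add: t_def field_simps)
  have "(\<lambda>n. of_real (\<eta> (e n)) * shift \<alpha> (lam \<alpha> (e n))) \<longlonglongrightarrow> 0"
  proof (rule tendsto_norm_zero_cancel, rule tendsto_sandwich[OF _ _ tendsto_const])
    show "\<forall>\<^sub>F n in sequentially. norm (of_real (\<eta> (e n)) * shift \<alpha> (lam \<alpha> (e n))) \<le> \<eta> (e n) * B"
      using shift_bound[OF e(1)] \<eta>_pos[OF e(1)]
      by (auto intro!: always_eventually mult_left_mono simp: norm_mult B_def abs_of_pos)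
    show "(\<lambda>n. \<eta> (e n) * B) \<longlonglongrightarrow> 0"
      using \<eta>_tendsto_0[OF e] tendsto_mult_left_zero by blast
  qed simp
  moreover have "(\<lambda>n. of_real (\<eta> (e n)) * t n) \<longlonglongrightarrow> 0 * 0"
    using a by (intro tendsto_mult \<eta>0) (simp add: t_def)
  ultimately have "(\<lambda>n. center \<alpha> + (of_real (\<eta> (e n)) * t n + of_real (\<eta> (e n)) * shift \<alpha> (lam \<alpha> (e n))))
      \<longlonglongrightarrow> center \<alpha> + (0 * 0 + 0)"
    by (intro tendsto_add tendsto_const)
  then have "(\<lambda>n. a n) \<longlonglongrightarrow> center \<alpha>"
    unfolding eq[symmetric] by simp
  then show ?thesis .
qed

section \<open>Derivatives and difference quotients of \<open>P\<close> in the limit\<close>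

lemma P_entry_derivative:
  "((\<lambda>s. P \<epsilon> s $ i $ j) has_field_derivative
     (if i = j then 2 * s / (of_real (\<omega> i))\<^sup>2 else (2 * s - s\<^sup>2 * of_real (d \<epsilon> i j / c\<^sub>0)) * q \<epsilon> i j s)) (at s within S)"
proof (cases "i = j")
  case True
  then show ?thesis
    unfolding P_entry using \<omega>_pos[of i]
    by (auto intro!: derivative_eq_intros simp: field_simps power2_eq_square power4_eq_xxxx)
next
  case False
  then show ?thesis
    unfolding P_entry using q_has_derivative by simp
qed

text \<open>Bound for the derivative of the off-diagonal entry \<open>s\<^sup>2 q\<close> on the
  disc of radius \<open>R\<close>, hence a Lipschitz constant there. It is proportional to \<kappa>
  and therefore tends to 0.\<close>

definition lip :: "real \<Rightarrow> real \<Rightarrow> 'm \<Rightarrow> 'm \<Rightarrow> real" where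
  "lip R \<epsilon> i j = (2 * R + R\<^sup>2 * (D\<^sub>a\<^sub>l\<^sub>l / c\<^sub>0)) * (\<kappa> \<epsilon> i j * exp (R * (D\<^sub>a\<^sub>l\<^sub>l / c\<^sub>0)))"

lemma lip_bound:
  assumes "\<epsilon> \<in> {0<..\<epsilon>\<^sub>1}" "cmod s \<le> R" "i \<noteq> j"
  shows "cmod ((2 * s - s\<^sup>2 * of_real (d \<epsilon> i j / c\<^sub>0)) * q \<epsilon> i j s) \<le> lip R \<epsilon> i j"
proof -
  have R: "0 \<le> R" using assms(2) norm_ge_zero order_trans by blast
  have d: "0 \<le> d \<epsilon> i j / c\<^sub>0" "d \<epsilon> i j / c\<^sub>0 \<le> D\<^sub>a\<^sub>l\<^sub>l / c\<^sub>0"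
    using d_le[OF assms(1)] c\<^sub>0 by (auto simp: d_def divide_right_mono)
  have "cmod (2 * s - s\<^sup>2 * of_real (d \<epsilon> i j / c\<^sub>0)) \<le> cmod (2 * s) + cmod (s\<^sup>2 * of_real (d \<epsilon> i j / c\<^sub>0))"
    by (rule norm_triangle_ineq4)
  also have "\<dots> = 2 * cmod s + (cmod s)\<^sup>2 * (d \<epsilon> i j / c\<^sub>0)"
    unfolding norm_mult norm_power norm_of_real abs_of_nonneg[OF d(1)] by simp
  also have "\<dots> \<le> 2 * R + R\<^sup>2 * (D\<^sub>a\<^sub>l\<^sub>l / c\<^sub>0)"
    using assms(2) d by (intro add_mono mult_mono power_mono) auto
  finally have 1: "cmod (2 * s - s\<^sup>2 * of_real (d \<epsilon> i j / c\<^sub>0)) \<le> 2 * R + R\<^sup>2 * (D\<^sub>a\<^sub>l\<^sub>l / c\<^sub>0)" .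
  have 2: "cmod (q \<epsilon> i j s) \<le> \<kappa> \<epsilon> i j * exp (R * (D\<^sub>a\<^sub>l\<^sub>l / c\<^sub>0))"
    using exp_bound[OF assms(1,2)] \<kappa>_bounds(1)[OF assms(1,3)]
    by (auto intro!: mult_left_mono simp: q_def norm_mult)
  show ?thesis
    unfolding norm_mult lip_def by (intro mult_mono 1 2) (use order_trans[OF norm_ge_zero 1] in auto)
qed

lemma lip_tendsto_0:
  assumes e: "\<And>n. e n \<in> {0<..\<epsilon>\<^sub>1}" "e \<longlonglongrightarrow> 0" and "i \<noteq> j"
  shows "(\<lambda>n. lip R (e n) i j) \<longlonglongrightarrow> 0"
proof -
  have "(\<lambda>n. lip R (e n) i j) \<longlonglongrightarrow> (2 * R + R\<^sup>2 * (D\<^sub>a\<^sub>l\<^sub>l / c\<^sub>0)) * (0 * exp (R * (D\<^sub>a\<^sub>l\<^sub>l / c\<^sub>0)))"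
    unfolding lip_def by (intro tendsto_intros \<kappa>_tendsto_0[OF assms])
  then show ?thesis by simp
qed

lemma P_deriv_tendsto:
  assumes e: "\<And>n. e n \<in> {0<..\<epsilon>\<^sub>1}" "e \<longlonglongrightarrow> 0" and a: "a \<longlonglongrightarrow> l"
  shows "(\<lambda>n. deriv (\<lambda>s. P (e n) s $ i $ j) (a n)) \<longlonglongrightarrow> (if i = j then 2 * l / (of_real (\<omega> i))\<^sup>2 else 0)"
proof (cases "i = j")
  case True
  then show ?thesis
    using \<omega>_pos[of i] unfolding DERIV_imp_deriv[OF P_entry_derivative] by (auto intro!: tendsto_eq_intros a)
next
  case False
  obtain R where R: "\<And>n. cmod (a n) \<le> R" using convergent_bounded[OF a] by blast
  have "(\<lambda>n. (2 * a n - (a n)\<^sup>2 * of_real (d (e n) i j / c\<^sub>0)) * q (e n) i j (a n)) \<longlonglongrightarrow> 0"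
    by (rule tendsto_norm_zero_cancel, rule tendsto_sandwich[OF _ _ tendsto_const lip_tendsto_0[OF e False, of R]])
      (use lip_bound[OF e(1) R False] in \<open>auto intro!: always_eventually\<close>)
  then show ?thesis
    unfolding DERIV_imp_deriv[OF P_entry_derivative] using False by simp
qed

text \<open>The diagonal quotient is exactly \<open>(a + b) / \<omega>\<^sup>2\<close>; off the
  diagonal the mean value inequality on a disc containing both points gives the bound
  \<open>lip\<close>.\<close>

lemma P_difference_quotient_tendsto:
  assumes e: "\<And>n. e n \<in> {0<..\<epsilon>\<^sub>1}" "e \<longlonglongrightarrow> 0" and a: "a \<longlonglongrightarrow> l" and b: "b \<longlonglongrightarrow> l"
    and ab: "\<And>n. a n \<noteq> b n"
  shows "(\<lambda>n. (P (e n) (a n) $ i $ j - P (e n) (b n) $ i $ j) / (a n - b n))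
    \<longlonglongrightarrow> (if i = j then 2 * l / (of_real (\<omega> i))\<^sup>2 else 0)"
proof (cases "i = j")
  case True
  have eq: "(P (e n) (a n) $ i $ j - P (e n) (b n) $ i $ j) / (a n - b n) = (a n + b n) / (of_real (\<omega> i))\<^sup>2" for n
  proof -
    have "P (e n) (a n) $ i $ j - P (e n) (b n) $ i $ j = (a n - b n) * ((a n + b n) / (of_real (\<omega> i))\<^sup>2)"
      using True by (simp add: P_entry power2_eq_square algebra_simps diff_divide_distrib add_divide_distrib)
    then show ?thesis using ab[of n] by simp
  qed
  have "(\<lambda>n. (a n + b n) / (of_real (\<omega> i))\<^sup>2) \<longlonglongrightarrow> (l + l) / (of_real (\<omega> i))\<^sup>2"
    using \<omega>_pos[of i] by (intro tendsto_intros a b) auto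
  then show ?thesis unfolding eq by (simp only: if_P[OF True] mult_2)
next
  case False
  obtain R1 where R1: "\<And>n. cmod (a n) \<le> R1" using convergent_bounded[OF a] by blast
  obtain R2 where R2: "\<And>n. cmod (b n) \<le> R2" using convergent_bounded[OF b] by blast
  define R where "R = max R1 R2"
  have R: "cmod (a n) \<le> R" "cmod (b n) \<le> R" for n
    using R1[of n] R2[of n] by (auto simp: R_def)
  have le: "cmod ((P (e n) (a n) $ i $ j - P (e n) (b n) $ i $ j) / (a n - b n)) \<le> lip R (e n) i j" for n
  proof -
    have "cmod (P (e n) (a n) $ i $ j - P (e n) (b n) $ i $ j) \<le> lip R (e n) i j * cmod (a n - b n)"
    proof (rule field_differentiable_bound[OF convex_cball[of 0 R]])
      show "((\<lambda>s. P (e n) s $ i $ j) has_field_derivative (2 * s - s\<^sup>2 * of_real (d (e n) i j / c\<^sub>0)) * q (e n) i j s) (at s within cball 0 R)" for s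
        using P_entry_derivative[of "e n" i j s] False by simp
      show "cmod ((2 * s - s\<^sup>2 * of_real (d (e n) i j / c\<^sub>0)) * q (e n) i j s) \<le> lip R (e n) i j" if "s \<in> cball 0 R" for s
        using lip_bound[OF e(1) _ False] that by simp
    qed (use R in auto)
    then show ?thesis using ab[of n] by (simp add: norm_divide divide_le_eq)
  qed
  have "(\<lambda>n. (P (e n) (a n) $ i $ j - P (e n) (b n) $ i $ j) / (a n - b n)) \<longlonglongrightarrow> 0"
    by (rule tendsto_norm_zero_cancel, rule tendsto_sandwich[OF _ _ tendsto_const lip_tendsto_0[OF e False, of R]])
      (use le in \<open>auto intro!: always_eventually\<close>)
  then show ?thesis using False by simp
qed

text \<open>The limit of the form is \<open>2 \<i> \<omega>\<^sub>c c c'\<close> times the sum of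
  \<open>C v v' / \<omega>\<^sup>2\<close>, which is positive. Although the form is not conjugated,
  the complex factors \<open>c\<close> and \<open>c'\<close> come out in front and cannot cause
  cancellation.\<close>

lemma weighted_form_limit_nonzero:
  fixes x y :: "nat \<Rightarrow> complex ^ 'm" and A :: "nat \<Rightarrow> complex ^ 'm ^ 'm"
  assumes x: "\<And>i. (\<lambda>n. x n $ i) \<longlonglongrightarrow> c * of_real (v i)" and y: "\<And>i. (\<lambda>n. y n $ i) \<longlonglongrightarrow> c' * of_real (v' i)"
    and c: "c \<noteq> 0" "c' \<noteq> 0"
    and v: "\<And>i. i \<in> cluster_of \<alpha> \<Longrightarrow> 0 < v i" "\<And>i. i \<notin> cluster_of \<alpha> \<Longrightarrow> v i = (0::real)"
    and v': "\<And>i. i \<in> cluster_of \<alpha> \<Longrightarrow> 0 < v' i" "\<And>i. i \<notin> cluster_of \<alpha> \<Longrightarrow> v' i = (0::real)"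
    and A: "\<And>i j. (\<lambda>n. A n $ i $ j) \<longlonglongrightarrow> (if i = j then 2 * (center \<alpha>) / (of_real (\<omega> i))\<^sup>2 else 0)"
    and zero: "\<And>n. (\<Sum>i\<in>UNIV. \<Sum>j\<in>UNIV. of_real (C i) * x n $ i * A n $ i $ j * y n $ j) = 0"
  shows False
proof -
  obtain k where k: "k \<in> cluster_of \<alpha>" using cluster_nonempty by blast
  let ?l = "\<lambda>i j. of_real (C i) * (c * of_real (v i)) * (if i = j then 2 * (center \<alpha>) / (of_real (\<omega> i))\<^sup>2 else 0) * (c' * of_real (v' j))"
  have "(\<lambda>n. \<Sum>i\<in>UNIV. \<Sum>j\<in>UNIV. of_real (C i) * x n $ i * A n $ i $ j * y n $ j) \<longlonglongrightarrow> (\<Sum>i\<in>UNIV. \<Sum>j\<in>UNIV. ?l i j)"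
    by (intro tendsto_intros x y A)
  then have "0 = (\<Sum>i\<in>UNIV. \<Sum>j\<in>UNIV. ?l i j)"
    by (simp add: zero LIMSEQ_const_iff)
  also have "\<dots> = (\<Sum>i\<in>UNIV. \<Sum>j\<in>UNIV. if j = i then 2 * (center \<alpha>) * c * c' * of_real (C i * v i * v' i / (\<omega> i)\<^sup>2) else 0)"
    by (intro sum.cong refl) simp
  also have "\<dots> = 2 * (center \<alpha>) * c * c' * of_real (\<Sum>i\<in>UNIV. C i * v i * v' i / (\<omega> i)\<^sup>2)"
    by (simp add: sum_distrib_left)
  finally have "(\<Sum>i\<in>UNIV. C i * v i * v' i / (\<omega> i)\<^sup>2) = 0"
    using c \<omega>c_pos[of \<alpha>] by (simp del: of_real_sum)
  moreover have "0 < (\<Sum>i\<in>UNIV. C i * v i * v' i / (\<omega> i)\<^sup>2)"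
  proof (rule sum_pos2[of _ k])
    show "0 < C k * v k * v' k / (\<omega> k)\<^sup>2"
      using C_pos[of k] \<omega>_pos[of k] v(1)[OF k] v'(1)[OF k] by simp
    show "0 \<le> C i * v i * v' i / (\<omega> i)\<^sup>2" for i
      using C_pos[of i] v[of i] v'[of i] by (cases "i \<in> cluster_of \<alpha>") (auto simp: less_imp_le)
  qed auto
  ultimately show False by simp
qed

text \<open>A unit null vector with vanishing coordinate \<open>k\<close> would converge along a
  subsequence to \<open>c v\<close>, whose coordinate \<open>k\<close> is nonzero. So coordinate
  \<open>k\<close> determines null vectors, as \<open>det_simple_zero\<close> demands.\<close>

lemma eventually_null_coordinate:
  assumes a: "leading_order \<alpha> a" and k: "k \<in> cluster_of \<alpha>"
  shows "\<forall>\<^sub>F \<epsilon> in at_right 0. \<forall>y. P \<epsilon> (a \<epsilon>) *v y = 0 \<and> y $ k = 0 \<longrightarrow> y = 0"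
proof (rule ccontr)
  assume "\<not> ?thesis"
  then obtain e where e: "\<And>n. e n \<in> {0<..\<epsilon>\<^sub>1}" "e \<longlonglongrightarrow> 0"
    "\<And>n. \<not> (\<forall>y. P (e n) (a (e n)) *v y = 0 \<and> y $ k = 0 \<longrightarrow> y = 0)"
    using not_eventually_at_right_sequence[OF _ \<epsilon>\<^sub>1, of "\<lambda>n. _"] by blast
  have "\<exists>x. P (e n) (a (e n)) *v x = 0 \<and> norm x = 1 \<and> x $ k = 0" for n
  proof -
    obtain y where y: "P (e n) (a (e n)) *v y = 0" "y $ k = 0" "y \<noteq> 0" using e(3) by blast
    obtain x c where "P (e n) (a (e n)) *v x = 0" "norm x = 1" "x = c *\<^sub>R y"
      by (rule unit_null_vector[OF y(1,3)])
    then show ?thesis using y(2) by (intro exI[of _ x]) simp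
  qed
  then obtain x where x: "\<And>n. P (e n) (a (e n)) *v x n = 0" "\<And>n. norm (x n) = 1" "\<And>n. x n $ k = 0"
    by metis
  obtain \<phi> :: "nat \<Rightarrow> nat" and c :: complex and v where \<phi>: "strict_mono \<phi>" "c \<noteq> 0"
    "\<And>i. i \<in> cluster_of \<alpha> \<Longrightarrow> 0 < v i" "\<And>i. i \<notin> cluster_of \<alpha> \<Longrightarrow> v i = (0::real)"
    "\<And>i. (\<lambda>n. x (\<phi> n) $ i) \<longlonglongrightarrow> c * of_real (v i)"
    by (rule principal_null_vector_limit[OF e(1,2) leading_order_sequence[OF a e(1,2)] x(1,2)]) blast
  have "c * of_real (v k) = 0"
    using \<phi>(5)[of k] by (simp add: x(3) LIMSEQ_const_iff)
  then show False using \<phi>(2) \<phi>(3)[OF k] by simp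
qed

text \<open>The vector \<open>x\<close> is paired with itself without conjugation, because
  \<open>C x\<close> is the left null vector belonging to \<open>x\<close>. This is the
  transversality condition of \<open>det_simple_zero\<close>.\<close>

lemma eventually_transversal:
  assumes a: "leading_order \<alpha> a"
  shows "\<forall>\<^sub>F \<epsilon> in at_right 0. \<forall>x. P \<epsilon> (a \<epsilon>) *v x = 0 \<and> norm x = 1 \<longrightarrow>
    (\<Sum>i\<in>UNIV. \<Sum>j\<in>UNIV. of_real (C i) * x $ i * deriv (\<lambda>s. P \<epsilon> s $ i $ j) (a \<epsilon>) * x $ j) \<noteq> 0"
proof (rule ccontr)
  assume "\<not> ?thesis"
  then obtain e where e: "\<And>n. e n \<in> {0<..\<epsilon>\<^sub>1}" "e \<longlonglongrightarrow> 0"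
    "\<And>n. \<not> (\<forall>x. P (e n) (a (e n)) *v x = 0 \<and> norm x = 1 \<longrightarrow>
       (\<Sum>i\<in>UNIV. \<Sum>j\<in>UNIV. of_real (C i) * x $ i * deriv (\<lambda>s. P (e n) s $ i $ j) (a (e n)) * x $ j) \<noteq> 0)"
    using not_eventually_at_right_sequence[OF _ \<epsilon>\<^sub>1, of "\<lambda>n. _"] by blast
  define Q where "Q = (\<lambda>n x. P (e n) (a (e n)) *v x = 0 \<and> norm x = 1 \<and>
      (\<Sum>i\<in>UNIV. \<Sum>j\<in>UNIV. of_real (C i) * x $ i * deriv (\<lambda>s. P (e n) s $ i $ j) (a (e n)) * x $ j) = 0)"
  have "\<exists>x. Q n x" for n
    unfolding Q_def using e(3)[of n] by blast
  then obtain x where "\<And>n. Q n (x n)" by metis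
  then have x: "\<And>n. P (e n) (a (e n)) *v x n = 0" "\<And>n. norm (x n) = 1"
    "\<And>n. (\<Sum>i\<in>UNIV. \<Sum>j\<in>UNIV. of_real (C i) * x n $ i * deriv (\<lambda>s. P (e n) s $ i $ j) (a (e n)) * x n $ j) = 0"
    unfolding Q_def by blast+
  note as = leading_order_sequence[OF a e(1,2)]
  obtain \<phi> :: "nat \<Rightarrow> nat" and c :: complex and v where \<phi>: "strict_mono \<phi>" "c \<noteq> 0"
    "\<And>i. i \<in> cluster_of \<alpha> \<Longrightarrow> 0 < v i" "\<And>i. i \<notin> cluster_of \<alpha> \<Longrightarrow> v i = (0::real)"
    "\<And>i. (\<lambda>n. x (\<phi> n) $ i) \<longlonglongrightarrow> c * of_real (v i)"
    by (rule principal_null_vector_limit[OF e(1,2) as x(1,2)]) blast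
  define A :: "nat \<Rightarrow> complex ^ 'm ^ 'm" where "A = (\<lambda>n. \<chi> i j. deriv (\<lambda>s. P (e n) s $ i $ j) (a (e n)))"
  have "(\<lambda>n. A n $ i $ j) \<longlonglongrightarrow> (if i = j then 2 * (center \<alpha>) / (of_real (\<omega> i))\<^sup>2 else 0)" for i j
    using P_deriv_tendsto[OF e(1,2) leading_order_tendsto[OF e(1,2) as], of i j] by (simp add: A_def)
  from LIMSEQ_subseq_LIMSEQ[OF this \<phi>(1)]
  have A: "(\<lambda>n. A (\<phi> n) $ i $ j) \<longlonglongrightarrow> (if i = j then 2 * (center \<alpha>) / (of_real (\<omega> i))\<^sup>2 else 0)" for i j
    by (simp add: o_def)
  show False
    by (rule weighted_form_limit_nonzero[OF \<phi>(5) \<phi>(5) \<phi>(2) \<phi>(2) \<phi>(3) \<phi>(4) \<phi>(3) \<phi>(4) A])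
      (use x(3) in \<open>simp_all add: A_def\<close>)
qed

lemma eventually_simple_zero:
  assumes a: "leading_order \<alpha> a"
  shows "\<forall>\<^sub>F \<epsilon> in at_right 0. det (P \<epsilon> (a \<epsilon>)) = 0 \<longrightarrow> zorder (\<lambda>u. det (P \<epsilon> u)) (a \<epsilon>) = 1"
proof -
  obtain k where k: "k \<in> cluster_of \<alpha>" using cluster_nonempty by blast
  show ?thesis
    using eventually_null_coordinate[OF a k] eventually_transversal[OF a]
  proof eventually_elim
    case (elim \<epsilon>)
    show ?case
    proof
      assume "det (P \<epsilon> (a \<epsilon>)) = 0"
      then obtain x where x: "P \<epsilon> (a \<epsilon>) *v x = 0" "norm x = 1"
        using det_zero_unit_null_vector by blast
      show "zorder (\<lambda>u. det (P \<epsilon> u)) (a \<epsilon>) = 1"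
        by (rule det_simple_zero[OF P_entry_holomorphic x(1) P_left_null[OF x(1)], of k])
          (use elim x in auto)
    qed
  qed
qed

text \<open>If every constant failed, there would be zeros closer than
  \<open>\<eta> / (n + 1)\<close> to the principal one. They share its leading asymptotics, so their
  null vectors approach Perron vectors as well. All zeros of \<open>det P\<close> in the plane are
  compared, not only those of the same disc.\<close>

lemma eventually_gap:
  assumes a: "leading_order \<alpha> a"
  shows "\<exists>g>0. \<forall>\<^sub>F \<epsilon> in at_right 0. det (P \<epsilon> (a \<epsilon>)) = 0 \<longrightarrow>
    (\<forall>b. det (P \<epsilon> b) = 0 \<and> b \<noteq> a \<epsilon> \<longrightarrow> g * \<eta> \<epsilon> \<le> dist (a \<epsilon>) b)"
proof (rule ccontr)
  assume neg: "\<not> ?thesis"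
  define Q where "Q = (\<lambda>g \<epsilon>. det (P \<epsilon> (a \<epsilon>)) = 0 \<longrightarrow> (\<forall>b. det (P \<epsilon> b) = 0 \<and> b \<noteq> a \<epsilon> \<longrightarrow> g * \<eta> \<epsilon> \<le> dist (a \<epsilon>) b))"
  have "\<not> eventually (Q (inverse (real (Suc n)))) (at_right 0)" for n
  proof -
    have "\<not> eventually (Q g) (at_right 0)" if "0 < g" for g
      using neg that unfolding Q_def by blast
    then show ?thesis by simp
  qed
  then obtain e where e: "\<And>n. e n \<in> {0<..\<epsilon>\<^sub>1}" and e0: "e \<longlonglongrightarrow> 0" and Q: "\<And>n. \<not> Q (inverse (real (Suc n))) (e n)"
    by (rule not_eventually_at_right_sequence[of "\<lambda>n. Q (inverse (real (Suc n)))", OF _ \<epsilon>\<^sub>1]) blast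
  obtain b where b: "\<And>n. det (P (e n) (a (e n))) = 0" "\<And>n. det (P (e n) (b n)) = 0" "\<And>n. b n \<noteq> a (e n)"
    "\<And>n. dist (a (e n)) (b n) < inverse (real (Suc n)) * \<eta> (e n)"
    using Q unfolding Q_def not_le not_all not_imp by metis
  note as = leading_order_sequence[OF a e e0]
  have bs: "(\<lambda>n. (b n - center \<alpha>) / of_real (\<eta> (e n)) - shift \<alpha> (lam \<alpha> (e n))) \<longlonglongrightarrow> 0"
  proof -
    have "(\<lambda>n. (b n - a (e n)) / of_real (\<eta> (e n))) \<longlonglongrightarrow> 0"
    proof (rule tendsto_norm_zero_cancel, rule tendsto_sandwich[OF _ _ tendsto_const LIMSEQ_inverse_real_of_nat])
      show "\<forall>\<^sub>F n in sequentially. norm ((b n - a (e n)) / of_real (\<eta> (e n))) \<le> inverse (real (Suc n))"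
      proof (intro always_eventually allI)
        fix n
        have "norm (b n - a (e n)) \<le> inverse (real (Suc n)) * \<eta> (e n)"
          using b(4)[of n] by (simp add: dist_norm norm_minus_commute)
        then show "norm ((b n - a (e n)) / of_real (\<eta> (e n))) \<le> inverse (real (Suc n))"
          using \<eta>_pos[OF e, of n] by (simp add: norm_divide divide_le_eq)
      qed
    qed simp
    from tendsto_add[OF as this] show ?thesis
      by (simp add: diff_divide_distrib algebra_simps)
  qed
  have "\<exists>x. P (e n) (a (e n)) *v x = 0 \<and> norm x = 1" for n
    by (rule det_zero_unit_null_vector[OF b(1)])
  then obtain x where x: "\<And>n. P (e n) (a (e n)) *v x n = 0" "\<And>n. norm (x n) = 1" by metis
  have "\<exists>x. P (e n) (b n) *v x = 0 \<and> norm x = 1" for n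
    by (rule det_zero_unit_null_vector[OF b(2)])
  then obtain y where y: "\<And>n. P (e n) (b n) *v y n = 0" "\<And>n. norm (y n) = 1" by metis
  obtain \<phi> :: "nat \<Rightarrow> nat" and c :: complex and v where \<phi>: "strict_mono \<phi>" "c \<noteq> 0"
    "\<And>i. i \<in> cluster_of \<alpha> \<Longrightarrow> 0 < v i" "\<And>i. i \<notin> cluster_of \<alpha> \<Longrightarrow> v i = (0::real)"
    "\<And>i. (\<lambda>n. x (\<phi> n) $ i) \<longlonglongrightarrow> c * of_real (v i)"
    by (rule principal_null_vector_limit[OF e e0 as x]) blast
  \<comment> \<open>The second extraction runs inside the first subsequence, so that both families
    of null vectors converge along \<theta>.\<close>
  obtain \<psi> :: "nat \<Rightarrow> nat" and c' :: complex and v' where \<psi>: "strict_mono \<psi>" "c' \<noteq> 0"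
    "\<And>i. i \<in> cluster_of \<alpha> \<Longrightarrow> 0 < v' i" "\<And>i. i \<notin> cluster_of \<alpha> \<Longrightarrow> v' i = (0::real)"
    "\<And>i. (\<lambda>n. y (\<phi> (\<psi> n)) $ i) \<longlonglongrightarrow> c' * of_real (v' i)"
  proof (rule principal_null_vector_limit[of "\<lambda>n. e (\<phi> n)" "\<lambda>n. b (\<phi> n)" \<alpha> "\<lambda>n. y (\<phi> n)"])
    show "(\<lambda>n. e (\<phi> n)) \<longlonglongrightarrow> 0"
      using LIMSEQ_subseq_LIMSEQ[OF e0 \<phi>(1)] by (simp add: o_def)
    show "(\<lambda>n. (b (\<phi> n) - center \<alpha>) / of_real (\<eta> (e (\<phi> n))) - shift \<alpha> (lam \<alpha> (e (\<phi> n)))) \<longlonglongrightarrow> 0"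
      using LIMSEQ_subseq_LIMSEQ[OF bs \<phi>(1)] by (simp add: o_def)
  qed (use e y in blast)+
  define \<theta> where "\<theta> = \<phi> \<circ> \<psi>"
  have \<theta>: "strict_mono \<theta>" unfolding \<theta>_def using \<phi>(1) \<psi>(1) by (rule strict_mono_o)
  have x\<theta>: "(\<lambda>n. x (\<theta> n) $ i) \<longlonglongrightarrow> c * of_real (v i)" for i
    using LIMSEQ_subseq_LIMSEQ[OF \<phi>(5) \<psi>(1)] by (simp add: \<theta>_def o_def)
  have y\<theta>: "(\<lambda>n. y (\<theta> n) $ i) \<longlonglongrightarrow> c' * of_real (v' i)" for i
    using \<psi>(5) by (simp add: \<theta>_def)
  define A :: "nat \<Rightarrow> complex ^ 'm ^ 'm" where
    "A = (\<lambda>n. \<chi> i j. (P (e n) (a (e n)) $ i $ j - P (e n) (b n) $ i $ j) / (a (e n) - b n))"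
  have "(\<lambda>n. A n $ i $ j) \<longlonglongrightarrow> (if i = j then 2 * (center \<alpha>) / (of_real (\<omega> i))\<^sup>2 else 0)" for i j
    unfolding A_def vec_lambda_beta
    by (rule P_difference_quotient_tendsto[OF e e0 leading_order_tendsto[OF e e0 as] leading_order_tendsto[OF e e0 bs]])
      (use b(3) in metis)
  from LIMSEQ_subseq_LIMSEQ[OF this \<theta>]
  have A: "(\<lambda>n. A (\<theta> n) $ i $ j) \<longlonglongrightarrow> (if i = j then 2 * (center \<alpha>) / (of_real (\<omega> i))\<^sup>2 else 0)" for i j
    by (simp add: o_def)
  \<comment> \<open>\<open>C x\<close> is a left null vector at \<open>a\<close> and
    \<open>y\<close> a right null vector at \<open>b\<close>, so the two terms of the difference
    vanish separately.\<close>
  have zero: "(\<Sum>i\<in>UNIV. \<Sum>j\<in>UNIV. of_real (C i) * x n $ i * A n $ i $ j * y n $ j) = 0" for n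
  proof -
    let ?w = "(\<chi> i. of_real (C i) * x n $ i) :: complex ^ 'm"
    have 1: "(\<Sum>i\<in>UNIV. \<Sum>j\<in>UNIV. of_real (C i) * x n $ i * P (e n) (b n) $ i $ j * y n $ j) = 0"
    proof -
      have "(\<Sum>j\<in>UNIV. P (e n) (b n) $ i $ j * y n $ j) = 0" for i
        using arg_cong[OF y(1)[of n], of "\<lambda>v. v $ i"] by (simp add: matrix_vector_mult_def)
      then show ?thesis by (simp add: mult.assoc flip: sum_distrib_left)
    qed
    have 2: "(\<Sum>i\<in>UNIV. \<Sum>j\<in>UNIV. of_real (C i) * x n $ i * P (e n) (a (e n)) $ i $ j * y n $ j) = 0"
    proof -
      have "(\<Sum>i\<in>UNIV. of_real (C i) * x n $ i * P (e n) (a (e n)) $ i $ j) = 0" for j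
        using arg_cong[OF P_left_null[OF x(1)[of n]], of "\<lambda>v. v $ j"] by (simp add: vector_matrix_mult_entry)
      then show ?thesis by (subst sum.swap) (simp flip: sum_distrib_right)
    qed
    have "(\<Sum>i\<in>UNIV. \<Sum>j\<in>UNIV. of_real (C i) * x n $ i * A n $ i $ j * y n $ j) =
       ((\<Sum>i\<in>UNIV. \<Sum>j\<in>UNIV. of_real (C i) * x n $ i * P (e n) (a (e n)) $ i $ j * y n $ j) -
        (\<Sum>i\<in>UNIV. \<Sum>j\<in>UNIV. of_real (C i) * x n $ i * P (e n) (b n) $ i $ j * y n $ j)) / (a (e n) - b n)"
      by (simp add: A_def diff_divide_distrib right_diff_distrib left_diff_distrib sum_subtractf sum_divide_distrib)
    then show ?thesis using 1 2 by simp
  qed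
  show False
    by (rule weighted_form_limit_nonzero[OF x\<theta> y\<theta> \<phi>(2) \<psi>(2) \<phi>(3) \<phi>(4) \<psi>(3) \<psi>(4) A zero])
qed

end

subsection \<open>Damping and existence of the principal zero\<close>

lemma tendsto_sin_divide_self:
  fixes u :: "nat \<Rightarrow> real"
  assumes "u \<longlonglongrightarrow> 0" "\<forall>\<^sub>F n in sequentially. u n \<noteq> 0"
  shows "(\<lambda>n. sin (u n) / u n) \<longlonglongrightarrow> 1"
proof -
  have "((\<lambda>x::real. sin x / x) \<longlongrightarrow> 1) (at 0)"
    using DERIV_sin[of "0::real"] by (simp add: DERIV_def)
  moreover have "filterlim u (at 0) sequentially"
    using assms by (simp add: filterlim_at)
  ultimately show ?thesis by (rule filterlim_compose)
qed

context bubble_clusters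
begin

text \<open>
  The imaginary part of \<open>x\<^sup>* C P x / s\<^sup>2 = 0\<close>. It involves only the imaginary part of the
  symmetric kernel \<open>C Q\<close>, so that the real, undamped part of the interaction drops out.
\<close>

lemma null_vector_imaginary_part:
  assumes x: "P \<epsilon> s *v x = 0" and s: "s \<noteq> 0"
  shows "Im (1 / s\<^sup>2) * (\<Sum>i\<in>UNIV. C i * (cmod (x $ i))\<^sup>2) =
    (\<Sum>i\<in>UNIV. \<Sum>j\<in>UNIV. if i = j then 0 else
       C i * \<kappa> \<epsilon> i j * (exp (- (Re s * (d \<epsilon> i j / c\<^sub>0))) * sin (Im s * (d \<epsilon> i j / c\<^sub>0))) * Re (cnj (x $ i) * x $ j))"
proof -
  define g where "g = (\<lambda>i j. if i = j then 0 else of_real (C i) * q \<epsilon> i j s)"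
  have g_sym: "g i j = g j i" for i j
    using q_sym[of i \<epsilon> j s] by (simp add: g_def)
  have Im_g: "Im (g i j) = (if i = j then 0 else - (C i * \<kappa> \<epsilon> i j * (exp (- (Re s * (d \<epsilon> i j / c\<^sub>0))) * sin (Im s * (d \<epsilon> i j / c\<^sub>0)))))" for i j
    by (simp add: g_def q_def Im_exp mult.assoc)
  \<comment> \<open>\<open>N\<close> is the diagonal part divided by \<open>s\<^sup>2\<close>; its
    first sum is real, so only \<open>1 / s\<^sup>2\<close> contributes to the imaginary
    part.\<close>
  define N where "N = (\<Sum>i\<in>UNIV. of_real (C i / (\<omega> i)\<^sup>2 * (cmod (x $ i))\<^sup>2)) + of_real (\<Sum>i\<in>UNIV. C i * (cmod (x $ i))\<^sup>2) * (1 / s\<^sup>2)"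
  define G where "G = (\<Sum>i\<in>UNIV. \<Sum>j\<in>UNIV. g i j * (cnj (x $ i) * x $ j))"
  have "N + G = 0"
  proof -
    have row: "(\<Sum>j\<in>UNIV. P \<epsilon> s $ i $ j * x $ j) = 0" for i
      using arg_cong[OF x, of "\<lambda>v. v $ i"] by (simp add: matrix_vector_mult_def)
    have Pij: "P \<epsilon> s $ i $ j * x $ j = (if j = i then (s\<^sup>2 / (of_real (\<omega> i))\<^sup>2 + 1) * x $ i else 0)
        + s\<^sup>2 * (if i = j then 0 else q \<epsilon> i j s) * x $ j" for i j
      by (simp add: P_entry)
    have "(s\<^sup>2 / (of_real (\<omega> i))\<^sup>2 + 1) * x $ i + s\<^sup>2 * (\<Sum>j\<in>UNIV. (if i = j then 0 else q \<epsilon> i j s) * x $ j) = 0" for i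
      using row[of i] unfolding Pij by (simp add: sum.distrib sum_distrib_left mult.assoc)
    then have eq: "(1 / (of_real (\<omega> i))\<^sup>2 + 1 / s\<^sup>2) * x $ i + (\<Sum>j\<in>UNIV. (if i = j then 0 else q \<epsilon> i j s) * x $ j) = 0" for i
    proof -
      have "s\<^sup>2 * ((1 / (of_real (\<omega> i))\<^sup>2 + 1 / s\<^sup>2) * x $ i + (\<Sum>j\<in>UNIV. (if i = j then 0 else q \<epsilon> i j s) * x $ j)) =
          (s\<^sup>2 / (of_real (\<omega> i))\<^sup>2 + 1) * x $ i + s\<^sup>2 * (\<Sum>j\<in>UNIV. (if i = j then 0 else q \<epsilon> i j s) * x $ j)"
        using s by (simp add: distrib_left distrib_right)
      also have "\<dots> = 0" by fact
      finally show ?thesis using s by simp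
    qed
    have "0 = (\<Sum>i\<in>UNIV. of_real (C i) * cnj (x $ i) * ((1 / (of_real (\<omega> i))\<^sup>2 + 1 / s\<^sup>2) * x $ i + (\<Sum>j\<in>UNIV. (if i = j then 0 else q \<epsilon> i j s) * x $ j)))"
      unfolding eq by simp
    also have "\<dots> = (\<Sum>i\<in>UNIV. of_real (C i / (\<omega> i)\<^sup>2 * (cmod (x $ i))\<^sup>2) + of_real (C i * (cmod (x $ i))\<^sup>2) * (1 / s\<^sup>2)
        + (\<Sum>j\<in>UNIV. g i j * (cnj (x $ i) * x $ j)))"
    proof (rule sum.cong[OF refl])
      fix i
      have sq: "complex_of_real ((cmod (x $ i))\<^sup>2) = cnj (x $ i) * x $ i"
        by (simp only: complex_norm_square mult.commute)
      have "of_real (C i) * cnj (x $ i) * (\<Sum>j\<in>UNIV. (if i = j then 0 else q \<epsilon> i j s) * x $ j) = (\<Sum>j\<in>UNIV. g i j * (cnj (x $ i) * x $ j))"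
        unfolding sum_distrib_left by (rule sum.cong) (auto simp: g_def)
      then show "of_real (C i) * cnj (x $ i) * ((1 / (of_real (\<omega> i))\<^sup>2 + 1 / s\<^sup>2) * x $ i + (\<Sum>j\<in>UNIV. (if i = j then 0 else q \<epsilon> i j s) * x $ j)) =
          of_real (C i / (\<omega> i)\<^sup>2 * (cmod (x $ i))\<^sup>2) + of_real (C i * (cmod (x $ i))\<^sup>2) * (1 / s\<^sup>2)
          + (\<Sum>j\<in>UNIV. g i j * (cnj (x $ i) * x $ j))"
        by (simp only: distrib_left of_real_mult of_real_divide of_real_power[of "\<omega> i"] sq)
          (simp add: distrib_left distrib_right mult_ac)
    qed
    also have "\<dots> = N + G"
      unfolding N_def G_def by (simp only: sum.distrib of_real_sum sum_distrib_right)
    finally show ?thesis by simp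
  qed
  then have "Im N + Im G = 0" by (metis plus_complex.simps(2) zero_complex.simps(2))
  moreover have "Im N = Im (1 / s\<^sup>2) * (\<Sum>i\<in>UNIV. C i * (cmod (x $ i))\<^sup>2)"
    unfolding N_def by (simp only: plus_complex.simps Im_sum Im_complex_of_real sum.neutral_const add_0 times_complex.simps
        Re_complex_of_real mult_zero_left add_0_right) (rule mult.commute)
  moreover have "Im G = (\<Sum>i\<in>UNIV. \<Sum>j\<in>UNIV. Im (g i j) * Re (cnj (x $ i) * x $ j))"
  proof -
    \<comment> \<open>\<open>Re (g i j)\<close> is symmetric and \<open>Im (cnj x_i x_j)\<close>
      antisymmetric in the indices, so this sum equals its own negative.\<close>
    define Z where "Z = (\<Sum>i\<in>UNIV. \<Sum>j\<in>UNIV. Re (g i j) * Im (cnj (x $ i) * x $ j))"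
    have "Z = (\<Sum>j\<in>UNIV. \<Sum>i\<in>UNIV. Re (g i j) * Im (cnj (x $ i) * x $ j))"
      unfolding Z_def by (rule sum.swap)
    also have "\<dots> = (\<Sum>j\<in>UNIV. \<Sum>i\<in>UNIV. - (Re (g j i) * Im (cnj (x $ j) * x $ i)))"
      by (intro sum.cong refl) (simp add: g_sym algebra_simps)
    also have "\<dots> = - Z"
      unfolding Z_def by (simp only: sum_negf)
    finally have "Z = 0" by simp
    moreover have "Im G = Z + (\<Sum>i\<in>UNIV. \<Sum>j\<in>UNIV. Im (g i j) * Re (cnj (x $ i) * x $ j))"
      unfolding G_def Z_def Im_sum times_complex.simps(2)[of "g _ _"] sum.distrib by simp
    ultimately show ?thesis by simp
  qed
  ultimately have "Im (1 / s\<^sup>2) * (\<Sum>i\<in>UNIV. C i * (cmod (x $ i))\<^sup>2) = - (\<Sum>i\<in>UNIV. \<Sum>j\<in>UNIV. Im (g i j) * Re (cnj (x $ i) * x $ j))"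
    by simp
  also have "\<dots> = (\<Sum>i\<in>UNIV. \<Sum>j\<in>UNIV. if i = j then 0 else
       C i * \<kappa> \<epsilon> i j * (exp (- (Re s * (d \<epsilon> i j / c\<^sub>0))) * sin (Im s * (d \<epsilon> i j / c\<^sub>0))) * Re (cnj (x $ i) * x $ j))"
    unfolding sum_negf[symmetric] Im_g by (intro sum.cong refl) simp
  finally show ?thesis .
qed

text \<open>If \<open>Re (a \<epsilon>)\<close> were nonnegative, the left side in
  \<open>null_vector_imaginary_part\<close> would be nonpositive, because
  \<open>Im (1 / s\<^sup>2)\<close> has the sign of \<open>- Re s Im s\<close>. The right side
  divided by \<epsilon> tends to a sum of nonnegative terms, positive for each pair of distinct
  bubbles of the cluster.\<close>

lemma eventually_damped:
  assumes a: "leading_order \<alpha> a" and card: "2 \<le> card (cluster_of \<alpha>)"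
  shows "\<forall>\<^sub>F \<epsilon> in at_right 0. det (P \<epsilon> (a \<epsilon>)) = 0 \<longrightarrow> Re (a \<epsilon>) < 0"
proof (rule ccontr)
  assume "\<not> ?thesis"
  then obtain e0 where e0: "\<And>n. e0 n \<in> {0<..\<epsilon>\<^sub>1}" "e0 \<longlonglongrightarrow> 0"
    "\<And>n. \<not> (det (P (e0 n) (a (e0 n))) = 0 \<longrightarrow> Re (a (e0 n)) < 0)"
    using not_eventually_at_right_sequence[OF _ \<epsilon>\<^sub>1, of "\<lambda>n. _"] by blast
  have "\<exists>x. P (e0 n) (a (e0 n)) *v x = 0 \<and> norm x = 1" for n
    using e0(3)[of n] by (intro det_zero_unit_null_vector) blast
  then obtain x0 where x0: "\<And>n. P (e0 n) (a (e0 n)) *v x0 n = 0" "\<And>n. norm (x0 n) = 1" by metis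
  note as = leading_order_sequence[OF a e0(1,2)]
  obtain \<phi> :: "nat \<Rightarrow> nat" and c :: complex and v where \<phi>: "strict_mono \<phi>" "c \<noteq> 0"
    "\<And>i. i \<in> cluster_of \<alpha> \<Longrightarrow> 0 < v i" "\<And>i. i \<notin> cluster_of \<alpha> \<Longrightarrow> v i = (0::real)"
    "\<And>i. (\<lambda>n. x0 (\<phi> n) $ i) \<longlonglongrightarrow> c * of_real (v i)"
    by (rule principal_null_vector_limit[OF e0(1,2) as x0]) blast
  define e where "e = e0 \<circ> \<phi>"
  define x where "x = x0 \<circ> \<phi>"
  define b where "b = (\<lambda>n. a (e n))"
  have e: "\<And>n. e n \<in> {0<..\<epsilon>\<^sub>1}" "e \<longlonglongrightarrow> 0"
    using e0(1) LIMSEQ_subseq_LIMSEQ[OF e0(2) \<phi>(1)] by (simp_all add: e_def)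
  have xlim: "(\<lambda>n. x n $ i) \<longlonglongrightarrow> c * of_real (v i)" for i
    using \<phi>(5) by (simp add: x_def)
  have null: "P (e n) (b n) *v x n = 0" for n
    using x0(1) by (simp add: e_def b_def x_def)
  have Re_b: "0 \<le> Re (b n)" for n
    using e0(3)[of "\<phi> n"] by (auto simp: b_def e_def)
  have blim: "b \<longlonglongrightarrow> center \<alpha>"
    using LIMSEQ_subseq_LIMSEQ[OF leading_order_tendsto[OF e0(1,2) as] \<phi>(1)] by (simp add: b_def e_def o_def)
  have Re_lim: "(\<lambda>n. Re (b n)) \<longlonglongrightarrow> 0" and Im_lim: "(\<lambda>n. Im (b n)) \<longlonglongrightarrow> \<omega>\<^sub>c \<alpha>"
    using tendsto_Re[OF blim] tendsto_Im[OF blim] by simp_all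
  have Im_pos: "\<forall>\<^sub>F n in sequentially. 0 < Im (b n)"
    using order_tendstoD(1)[OF Im_lim \<omega>c_pos] .
  \<comment> \<open>The distance in the denominator of \<kappa> meets the sine of a multiple of the
    same distance, so \<open>F\<close> stays bounded; inside the cluster its limit is
    \<open>\<omega>\<^sub>c / c\<^sub>0\<close>.\<close>
  define F where "F = (\<lambda>n i j. exp (- (Re (b n) * (d (e n) i j / c\<^sub>0))) * sin (Im (b n) * (d (e n) i j / c\<^sub>0)) / d (e n) i j)"
  define T where "T = (\<lambda>n i j. if i = j then 0 else C i * C j / (4 * pi) * F n i j * Re (cnj (x n $ i) * x n $ j))"
  have Relim: "(\<lambda>n. Re (cnj (x n $ i) * x n $ j)) \<longlonglongrightarrow> (cmod c)\<^sup>2 * (v i * v j)" for i j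
  proof -
    have "(\<lambda>n. Re (cnj (x n $ i) * x n $ j)) \<longlonglongrightarrow> Re (cnj (c * of_real (v i)) * (c * of_real (v j)))"
      by (intro tendsto_intros xlim)
    moreover have "Re (cnj (c * of_real (v i)) * (c * of_real (v j))) = (cmod c)\<^sup>2 * (v i * v j)"
      unfolding cmod_power2 by (simp add: power2_eq_square algebra_simps)
    ultimately show ?thesis by simp
  qed
  have Tlim: "(\<lambda>n. T n i j) \<longlonglongrightarrow> (if i = j then 0 else C i * C j / (4 * pi) * (\<omega>\<^sub>c \<alpha> / c\<^sub>0) * ((cmod c)\<^sup>2 * (v i * v j)))" for i j
  proof (cases "i \<noteq> j")
    case ij: True
    have dpos: "0 < d (e n) i j" for n using d_pos[OF e(1) ij] .
    show ?thesis
    proof (cases "i \<in> cluster_of \<alpha> \<and> j \<in> cluster_of \<alpha>")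
      case True
      then have cl: "cl i = cl j" by (simp add: cluster_def)
      have d0: "(\<lambda>n. d (e n) i j) \<longlonglongrightarrow> 0"
        by (rule d_tendsto_0[OF e ij cl])
      define u where "u = (\<lambda>n. Im (b n) * (d (e n) i j / c\<^sub>0))"
      have "u \<longlonglongrightarrow> \<omega>\<^sub>c \<alpha> * (0 / c\<^sub>0)"
        unfolding u_def using c\<^sub>0 by (intro tendsto_intros Im_lim d0) auto
      then have u0: "u \<longlonglongrightarrow> 0" by simp
      have unz: "\<forall>\<^sub>F n in sequentially. u n \<noteq> 0"
        using Im_pos by eventually_elim (use dpos c\<^sub>0 in \<open>auto simp: u_def order_less_le\<close>)
      have lim: "(\<lambda>n. exp (- (Re (b n) * (d (e n) i j / c\<^sub>0))) * (Im (b n) / c\<^sub>0) * (sin (u n) / u n)) \<longlonglongrightarrow> exp (- (0 * (0 / c\<^sub>0))) * (\<omega>\<^sub>c \<alpha> / c\<^sub>0) * 1"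
        using c\<^sub>0 by (intro tendsto_intros Re_lim Im_lim d0 tendsto_sin_divide_self[OF u0 unz]) auto
      have "\<forall>\<^sub>F n in sequentially. exp (- (Re (b n) * (d (e n) i j / c\<^sub>0))) * (Im (b n) / c\<^sub>0) * (sin (u n) / u n) = F n i j"
        using Im_pos
      proof eventually_elim
        case (elim n)
        then show ?case
          using dpos[of n] c\<^sub>0 unfolding F_def u_def by (simp add: field_simps)
      qed
      from Lim_transform_eventually[OF lim this] have "(\<lambda>n. F n i j) \<longlonglongrightarrow> \<omega>\<^sub>c \<alpha> / c\<^sub>0"
        by simp
      then have "(\<lambda>n. C i * C j / (4 * pi) * F n i j * Re (cnj (x n $ i) * x n $ j)) \<longlonglongrightarrow> C i * C j / (4 * pi) * (\<omega>\<^sub>c \<alpha> / c\<^sub>0) * ((cmod c)\<^sup>2 * (v i * v j))"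
        by (intro tendsto_mult tendsto_const Relim)
      then show ?thesis using ij by (simp only: T_def if_not_P if_False simp_thms)
    next
      case False
      then have v0: "v i * v j = 0" using \<phi>(4) by auto
      \<comment> \<open>For the remaining pairs the distance, and with it \<open>F\<close>, need not
        converge; a bound suffices because \<open>v i * v j = 0\<close>.\<close>
      obtain B where B: "\<And>n. \<bar>Im (b n)\<bar> \<le> B"
        using convergent_imp_Bseq[OF convergentI[OF Im_lim]] unfolding Bseq_def by auto
      have F_le: "\<bar>F n i j\<bar> \<le> B / c\<^sub>0" for n
      proof -
        \<comment> \<open>The assumption of nonnegative real parts enters here as well, to bound the
          exponential by 1.\<close>
        have "0 \<le> Re (b n) * (d (e n) i j / c\<^sub>0)" using Re_b[of n] dpos[of n] c\<^sub>0 by simp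
        then have 1: "\<bar>exp (- (Re (b n) * (d (e n) i j / c\<^sub>0)))\<bar> \<le> 1" by simp
        have "\<bar>sin (Im (b n) * (d (e n) i j / c\<^sub>0))\<bar> \<le> \<bar>Im (b n) * (d (e n) i j / c\<^sub>0)\<bar>"
          by (rule abs_sin_x_le_abs_x)
        also have "\<dots> \<le> B * (d (e n) i j / c\<^sub>0)"
          using B[of n] dpos[of n] c\<^sub>0 by (simp add: abs_mult mult_right_mono divide_right_mono)
        finally have 2: "\<bar>sin (Im (b n) * (d (e n) i j / c\<^sub>0))\<bar> \<le> B * (d (e n) i j / c\<^sub>0)" .
        have "\<bar>F n i j\<bar> \<le> 1 * (B * (d (e n) i j / c\<^sub>0)) / d (e n) i j"
          unfolding F_def abs_mult abs_divide abs_of_pos[OF dpos] using dpos[of n]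
          by (intro divide_right_mono mult_mono 1 2) auto
        then show ?thesis using dpos[of n] by simp
      qed
      define M where "M = C i * C j / (4 * pi) * (B / c\<^sub>0)"
      have "(\<lambda>n. M * \<bar>Re (cnj (x n $ i) * x n $ j)\<bar>) \<longlonglongrightarrow> M * \<bar>(cmod c)\<^sup>2 * (v i * v j)\<bar>"
        by (intro tendsto_intros Relim)
      then have M0: "(\<lambda>n. M * \<bar>Re (cnj (x n $ i) * x n $ j)\<bar>) \<longlonglongrightarrow> 0" by (simp add: v0)
      have "(\<lambda>n. T n i j) \<longlonglongrightarrow> 0"
      proof (rule tendsto_rabs_zero_cancel, rule tendsto_sandwich[OF _ _ tendsto_const M0])
        show "\<forall>\<^sub>F n in sequentially. \<bar>T n i j\<bar> \<le> M * \<bar>Re (cnj (x n $ i) * x n $ j)\<bar>"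
        proof (intro always_eventually allI)
          fix n
          have "\<bar>T n i j\<bar> = C i * C j / (4 * pi) * \<bar>F n i j\<bar> * \<bar>Re (cnj (x n $ i) * x n $ j)\<bar>"
            using ij C_pos[of i] C_pos[of j] by (simp add: T_def abs_mult del: times_complex.simps)
          also have "\<dots> \<le> M * \<bar>Re (cnj (x n $ i) * x n $ j)\<bar>"
            unfolding M_def using F_le[of n] C_pos[of i] C_pos[of j]
            by (intro mult_right_mono mult_left_mono) auto
          finally show "\<bar>T n i j\<bar> \<le> M * \<bar>Re (cnj (x n $ i) * x n $ j)\<bar>" .
        qed
      qed simp
      then show ?thesis using ij unfolding v0 by simp
    qed
  qed (simp add: T_def)
  have le: "\<forall>\<^sub>F n in sequentially. (\<Sum>i\<in>UNIV. \<Sum>j\<in>UNIV. T n i j) \<le> 0"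
    using Im_pos
  proof eventually_elim
    case (elim n)
    have bnz: "b n \<noteq> 0" using elim by auto
    have "Im (1 / (b n)\<^sup>2) = - (2 * Re (b n) * Im (b n)) / (cmod ((b n)\<^sup>2))\<^sup>2"
      by (simp only: Im_divide' one_complex.simps complex_norm_square) (simp add: power2_eq_square cmod_def)
    also have "\<dots> \<le> 0"
      using Re_b[of n] elim by (intro divide_nonpos_nonneg) auto
    finally have "Im (1 / (b n)\<^sup>2) * (\<Sum>i\<in>UNIV. C i * (cmod (x n $ i))\<^sup>2) \<le> 0"
      using C_pos by (intro mult_nonpos_nonneg sum_nonneg mult_nonneg_nonneg) (auto simp: less_imp_le)
    moreover have "(\<Sum>i\<in>UNIV. \<Sum>j\<in>UNIV. if i = j then 0 else
       C i * \<kappa> (e n) i j * (exp (- (Re (b n) * (d (e n) i j / c\<^sub>0))) * sin (Im (b n) * (d (e n) i j / c\<^sub>0))) * Re (cnj (x n $ i) * x n $ j))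
       = e n * (\<Sum>i\<in>UNIV. \<Sum>j\<in>UNIV. T n i j)"
      unfolding sum_distrib_left by (intro sum.cong refl) (simp add: T_def F_def \<kappa>_def)
    ultimately have "e n * (\<Sum>i\<in>UNIV. \<Sum>j\<in>UNIV. T n i j) \<le> 0"
      using null_vector_imaginary_part[OF null bnz] by simp
    then show ?case using e(1)[of n] by (simp add: mult_le_0_iff)
  qed
  let ?l = "\<lambda>i j. if i = j then 0 else C i * C j / (4 * pi) * (\<omega>\<^sub>c \<alpha> / c\<^sub>0) * ((cmod c)\<^sup>2 * (v i * v j))"
  have "(\<lambda>n. \<Sum>i\<in>UNIV. \<Sum>j\<in>UNIV. T n i j) \<longlonglongrightarrow> (\<Sum>i\<in>UNIV. \<Sum>j\<in>UNIV. ?l i j)"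
    by (intro tendsto_sum Tlim)
  then have "(\<Sum>i\<in>UNIV. \<Sum>j\<in>UNIV. ?l i j) \<le> 0"
    by (rule tendsto_upperbound[OF _ le trivial_limit_sequentially])
  moreover have "0 < (\<Sum>i\<in>UNIV. \<Sum>j\<in>UNIV. ?l i j)"
  proof -
    have "\<not> (\<exists>k. cluster_of \<alpha> = {k}) \<and> cluster_of \<alpha> \<noteq> {}"
      using card by auto
    then obtain k l where kl: "k \<in> cluster_of \<alpha>" "l \<in> cluster_of \<alpha>" "k \<noteq> l" by blast
    have vnn: "0 \<le> v i" for i using \<phi>(3,4)[of i] by (cases "i \<in> cluster_of \<alpha>") (auto simp: less_imp_le)
    have nn: "0 \<le> ?l i j" for i j
      using C_pos[of i] C_pos[of j] \<omega>c_pos[of \<alpha>] c\<^sub>0 vnn[of i] vnn[of j] by simp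
    have pos: "0 < ?l k l"
      using C_pos[of k] C_pos[of l] \<omega>c_pos[of \<alpha>] c\<^sub>0 \<phi>(2) \<phi>(3)[OF kl(1)] \<phi>(3)[OF kl(2)] kl(3) by simp
    show ?thesis
    proof (rule sum_pos2[of _ k])
      show "0 < (\<Sum>j\<in>UNIV. ?l k j)"
        by (rule sum_pos2[of _ l]) (use pos nn[of k] in auto)
      show "0 \<le> (\<Sum>j\<in>UNIV. ?l i j)" for i
        by (rule sum_nonneg) (rule nn)
    qed auto
  qed
  ultimately show False by simp
qed

text \<open>The prediction moves with \<epsilon> while Hurwitz' theorem needs a fixed limit, so a
  subsequence is chosen along which the shift converges to \<open>t0\<close>. Without zeros near the
  prediction the rescaled determinants would have none in \<open>S\<close>, and neither would their
  nonconstant limit \<open>g\<close>; but the Perron vector is a null vector of the limit matrix at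
  \<open>t0\<close>.\<close>

lemma eventually_principal_zero:
  assumes \<delta>: "0 < \<delta>"
  shows "\<forall>\<^sub>F \<epsilon> in at_right 0. \<exists>w. det (P \<epsilon> w) = 0 \<and>
    cmod (w - (center \<alpha> + of_real (\<eta> \<epsilon>) * shift \<alpha> (lam \<alpha> \<epsilon>))) < \<delta> * \<eta> \<epsilon>"
proof (rule ccontr)
  assume "\<not> ?thesis"
  then obtain e where e: "\<And>n. e n \<in> {0<..\<epsilon>\<^sub>1}" "e \<longlonglongrightarrow> 0"
    "\<And>n. \<not> (\<exists>w. det (P (e n) w) = 0 \<and>
       cmod (w - (center \<alpha> + of_real (\<eta> (e n)) * shift \<alpha> (lam \<alpha> (e n)))) < \<delta> * \<eta> (e n))"
    using not_eventually_at_right_sequence[OF _ \<epsilon>\<^sub>1, of "\<lambda>n. _"] by blast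
  obtain \<phi> :: "nat \<Rightarrow> nat" and k \<mu> v where \<phi>: "strict_mono \<phi>" "(\<lambda>n. K \<alpha> (e (\<phi> n))) \<longlonglongrightarrow> k"
    "(\<lambda>n. lam \<alpha> (e (\<phi> n))) \<longlonglongrightarrow> \<mu>" "interaction_on C (cluster_of \<alpha>) k" "perron_pair (cluster_of \<alpha>) k \<mu> v"
    by (rule perron_subsequence[OF e(1)])
  define t0 where "t0 = shift \<alpha> \<mu>"
  have "(\<lambda>n. shift \<alpha> (lam \<alpha> (e (\<phi> n)))) \<longlonglongrightarrow> t0"
    unfolding t0_def shift_def by (intro tendsto_intros \<phi>(3))
  then have "\<forall>\<^sub>F n in sequentially. dist (shift \<alpha> (lam \<alpha> (e (\<phi> n)))) t0 < \<delta> / 2"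
    using \<delta> by (intro tendstoD) auto
  then obtain N where N: "\<And>n. N \<le> n \<Longrightarrow> dist (shift \<alpha> (lam \<alpha> (e (\<phi> n)))) t0 < \<delta> / 2"
    unfolding eventually_sequentially by blast
  \<comment> \<open>After the first \<open>N\<close> terms are dropped, every point of the ball of
    radius \<open>\<delta> / 2\<close> around \<open>t0\<close> lies within \<delta> of the shift
    for all indices, so every function of the sequence is free of zeros there.\<close>
  define e' where "e' = (\<lambda>n. e (\<phi> (n + N)))"
  have sm: "strict_mono (\<lambda>n. \<phi> (n + N))" using \<phi>(1) by (simp add: strict_mono_def)
  have e': "\<And>n. e' n \<in> {0<..\<epsilon>\<^sub>1}" "e' \<longlonglongrightarrow> 0"
    using e(1) LIMSEQ_subseq_LIMSEQ[OF e(2) sm] by (simp_all add: e'_def o_def)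
  have k': "(\<lambda>n. K \<alpha> (e' n)) \<longlonglongrightarrow> k"
    unfolding e'_def by (rule LIMSEQ_ignore_initial_segment[OF \<phi>(2)])
  define S where "S = ball t0 (\<delta> / 2)"
  define f where "f = (\<lambda>n t. det (scaled \<alpha> (e' n) t))"
  define g where "g = (\<lambda>t. det (lim_mat \<alpha> k t))"
  have nz: "f n t \<noteq> 0" if "t \<in> S" for n t
  proof
    assume "f n t = 0"
    then obtain x where x: "x \<noteq> 0" "scaled \<alpha> (e' n) t *v x = 0" unfolding f_def det_eq_0_iff_kernel by blast
    let ?w = "center \<alpha> + of_real (\<eta> (e' n)) * t"
    have "det (P (e' n) ?w) = 0"
      unfolding det_eq_0_iff_kernel using x scaled_null_iff[OF e'(1)] by blast
    moreover have "cmod (?w - (center \<alpha> + of_real (\<eta> (e' n)) * shift \<alpha> (lam \<alpha> (e' n)))) < \<delta> * \<eta> (e' n)"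
    proof -
      have "dist t (shift \<alpha> (lam \<alpha> (e' n))) < \<delta>"
        using dist_triangle_half_r[of t0 t \<delta> "shift \<alpha> (lam \<alpha> (e' n))"] that N[of "n + N"]
        by (simp add: S_def e'_def dist_commute)
      then have "\<eta> (e' n) * cmod (t - shift \<alpha> (lam \<alpha> (e' n))) < \<eta> (e' n) * \<delta>"
        using \<eta>_pos[OF e'(1)] by (simp add: dist_norm)
      moreover have "?w - (center \<alpha> + of_real (\<eta> (e' n)) * shift \<alpha> (lam \<alpha> (e' n)))
          = of_real (\<eta> (e' n)) * (t - shift \<alpha> (lam \<alpha> (e' n)))"
        by (simp add: algebra_simps)
      ultimately show ?thesis
        using \<eta>_pos[OF e'(1), of n] by (simp only: norm_mult norm_of_real abs_of_pos mult.commute)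
    qed
    ultimately show False using e(3)[of "\<phi> (n + N)"] unfolding e'_def by blast
  qed
  have holf: "f n holomorphic_on S" for n
  proof -
    have "(\<lambda>t. scaled \<alpha> (e' n) t $ i $ j) holomorphic_on S" for i j
    proof -
      have "((\<lambda>s. P (e' n) s $ i $ j) \<circ> (\<lambda>t. center \<alpha> + of_real (\<eta> (e' n)) * t)) holomorphic_on S"
        by (rule holomorphic_on_compose) (auto intro!: holomorphic_intros holomorphic_on_subset[OF P_entry_holomorphic])
      then show ?thesis
        unfolding scaled_def vec_lambda_beta o_def by (intro holomorphic_on_mult holomorphic_on_const)
    qed
    then show ?thesis unfolding f_def by (rule holomorphic_on_det)
  qed
  have holg: "g holomorphic_on X" for X
  proof -
    have "(\<lambda>t. lim_mat \<alpha> k t $ i $ j) holomorphic_on X" for i j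
      using \<omega>c_pos[of \<alpha>] unfolding lim_mat_def
      by (cases "i \<in> cluster_of \<alpha>"; cases "i = j") (auto intro!: holomorphic_intros)
    then show ?thesis unfolding g_def by (rule holomorphic_on_det)
  qed
  have g0: "g t0 = 0"
  proof -
    obtain m where m: "m \<in> cluster_of \<alpha>" using cluster_nonempty by blast
    define x :: "complex ^ 'm" where "x = (\<chi> i. of_real (v $ i))"
    have "(lim_mat \<alpha> k t0 *v x) $ i = 0" for i
    proof (cases "i \<in> cluster_of \<alpha>")
      case True
      have kii: "k $ i $ i = 0" using \<phi>(4) unfolding interaction_on_def by metis
      have "(lim_mat \<alpha> k t0 *v x) $ i = (\<Sum>j\<in>UNIV. (if j = i then 2 * \<i> * t0 / of_real (\<omega>\<^sub>c \<alpha>) * of_real (v $ i) else 0)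
          - (of_real (\<omega>\<^sub>c \<alpha>))\<^sup>2 * of_real (k $ i $ j * v $ j))"
        unfolding matrix_vector_mult_def vec_lambda_beta using True kii
        by (intro sum.cong) (auto simp: lim_mat_def x_def)
      also have "\<dots> = 2 * \<i> * t0 / of_real (\<omega>\<^sub>c \<alpha>) * of_real (v $ i) - (of_real (\<omega>\<^sub>c \<alpha>))\<^sup>2 * of_real (\<Sum>j\<in>UNIV. k $ i $ j * v $ j)"
        by (simp add: sum_subtractf sum_distrib_left)
      also have "\<dots> = 0"
        unfolding perron_pairD(3)[OF \<phi>(5)] t0_def shift_def using \<omega>c_pos[of \<alpha>]
        by (simp add: field_simps power2_eq_square power3_eq_cube)
      finally show ?thesis .
    next
      case False
      have "(lim_mat \<alpha> k t0 *v x) $ i = (\<Sum>j\<in>(UNIV::'m set). 0)"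
        unfolding matrix_vector_mult_def vec_lambda_beta using False perron_pairD(2)[OF \<phi>(5) False]
        by (intro sum.cong) (auto simp: lim_mat_def x_def)
      then show ?thesis by simp
    qed
    then have "lim_mat \<alpha> k t0 *v x = 0" by (simp add: vec_eq_iff)
    moreover have "x \<noteq> 0"
      using perron_pairD(1)[OF \<phi>(5) m] by (auto simp: x_def vec_eq_iff intro!: exI[of _ m])
    ultimately show ?thesis unfolding g_def det_eq_0_iff_kernel by blast
  qed
  have "\<not> g constant_on S"
  proof
    assume const: "g constant_on S"
    \<comment> \<open>\<open>t1\<close> is pushed from \<open>t0\<close> radially outwards inside
      \<open>S\<close>; its larger modulus makes \<open>g t1\<close> nonzero. If
      \<open>t0 = 0\<close>, as for a single bubble, there is no direction to follow, hence the
      default 1.\<close>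
    define dir where "dir = (if t0 = 0 then 1 else sgn t0)"
    define t1 where "t1 = t0 + of_real (\<delta> / 4) * dir"
    have dir: "cmod dir = 1" "t0 = of_real (cmod t0) * dir"
      by (auto simp: dir_def norm_sgn) (simp add: sgn_eq)
    have "t1 = of_real (cmod t0 + \<delta> / 4) * dir"
      unfolding t1_def by (subst (1) dir(2)) (simp add: distrib_right)
    then have "cmod t1 = \<bar>cmod t0 + \<delta> / 4\<bar>"
      by (simp only: norm_mult norm_of_real dir(1) mult_1_right)
    then have "cmod t0 < cmod t1" using \<delta> by simp
    then have "g t1 \<noteq> 0"
      unfolding g_def t0_def by (rule lim_mat_det_nonzero[OF \<phi>(4,5)])
    moreover have "t1 \<in> S" "t0 \<in> S"
      using \<delta> dir(1) by (auto simp: S_def t1_def dist_norm norm_mult)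
    ultimately show False using const g0 unfolding constant_on_def by metis
  qed
  moreover have "uniform_limit X f g sequentially" if X: "compact X" for X
  proof (rule uniform_limit_sequentialI[OF X])
    show "continuous_on X g" by (rule holomorphic_on_imp_continuous_on[OF holg])
    fix \<psi> :: "nat \<Rightarrow> nat" and t :: "nat \<Rightarrow> complex" and l
    assume \<psi>: "strict_mono \<psi>" and t: "t \<longlonglongrightarrow> l"
    have "(\<lambda>n. e' (\<psi> n)) \<longlonglongrightarrow> 0" "(\<lambda>n. K \<alpha> (e' (\<psi> n))) \<longlonglongrightarrow> k"
      using LIMSEQ_subseq_LIMSEQ[OF e'(2) \<psi>] LIMSEQ_subseq_LIMSEQ[OF k' \<psi>] by (simp_all add: o_def)
    then show "(\<lambda>n. f (\<psi> n) (t n)) \<longlonglongrightarrow> g l"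
      unfolding f_def g_def by (intro tendsto_det scaled_tendsto[OF _ _ _ t] e'(1))
  qed
  ultimately have "g t0 \<noteq> 0"
    using Hurwitz_no_zeros[of S f g t0] holf holg nz \<delta> unfolding S_def by (auto simp: S_def)
  then show False using g0 by simp
qed

end

subsection \<open>Counting the zeros\<close>

text \<open>The points form a multiset in which each is repeated according to its order; putting
  \<open>w\<close> at the head of a list of this multiset makes it number 1.\<close>

lemma enumerate_with_multiplicity:
  fixes f :: "'a \<Rightarrow> int"
  assumes Z: "finite Z" and f: "\<And>x. x \<in> Z \<Longrightarrow> 0 < f x" and N: "(\<Sum>x\<in>Z. f x) = int N" and w: "w \<in> Z"
  shows "\<exists>s :: nat \<Rightarrow> 'a. s 1 = w \<and> (\<forall>m\<in>{1..N}. s m \<in> Z) \<and>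
    (\<forall>x\<in>Z. int (card {m \<in> {1..N}. s m = x}) = f x) \<and> (\<forall>x. x \<notin> Z \<longrightarrow> card {m \<in> {1..N}. s m = x} = 0)"
proof -
  define X where "X = (\<Sum>x\<in>Z. replicate_mset (nat (f x)) x)"
  have count: "count X x = (if x \<in> Z then nat (f x) else 0)" for x
  proof -
    have "count X x = (\<Sum>y\<in>Z. if y = x then nat (f y) else 0)"
      unfolding X_def count_sum by (intro sum.cong) auto
    then show ?thesis using Z by simp
  qed
  have "size X = (\<Sum>x\<in>Z. nat (f x))"
    unfolding X_def using Z by (induction rule: finite_induct) auto
  then have "int (size X) = (\<Sum>x\<in>Z. int (nat (f x)))"
    by simp
  also have "\<dots> = int N"
    unfolding N[symmetric] using f by (intro sum.cong) (auto simp: less_imp_le)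
  finally have size: "size X = N" by simp
  have "w \<in># X"
    using count[of w] w f[OF w] by (simp flip: count_greater_zero_iff)
  then obtain Y where Y: "X = add_mset w Y" by (metis insert_DiffM)
  obtain ys where ys: "mset ys = Y" using ex_mset by blast
  define xs where "xs = w # ys"
  have xs: "mset xs = X" "length xs = N"
    using ys Y size by (auto simp: xs_def simp flip: size_mset)
  \<comment> \<open>The enumeration starts at 1, list positions start at 0.\<close>
  define s where "s = (\<lambda>m. xs ! (m - 1))"
  have card_s: "card {m \<in> {1..N}. s m = x} = count X x" for x
  proof -
    have "{m \<in> {1..N}. s m = x} = Suc ` {i. i < length xs \<and> xs ! i = x}"
    proof (intro equalityI subsetI)
      fix m assume "m \<in> {m \<in> {1..N}. s m = x}"
      then have "m = Suc (m - 1)" "m - 1 < length xs" "xs ! (m - 1) = x" using xs(2) by (auto simp: s_def)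
      then show "m \<in> Suc ` {i. i < length xs \<and> xs ! i = x}" by blast
    qed (use xs(2) in \<open>auto simp: s_def\<close>)
    then have "card {m \<in> {1..N}. s m = x} = card {i. i < length xs \<and> xs ! i = x}"
      by (simp add: card_image)
    also have "\<dots> = length (filter (\<lambda>y. y = x) xs)"
      by (simp add: length_filter_conv_card)
    also have "\<dots> = count (mset xs) x"
      by (induction xs) auto
    finally show ?thesis by (simp add: xs(1))
  qed
  have "s m \<in> Z" if "m \<in> {1..N}" for m
  proof -
    have "xs ! (m - 1) \<in> set xs" using that xs(2) by (intro nth_mem) auto
    then have "xs ! (m - 1) \<in># X" using xs(1) by (metis set_mset_mset)
    then show ?thesis using count by (metis count_greater_zero_iff less_irrefl s_def)
  qed
  moreover have "s 1 = w" by (simp add: s_def xs_def)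
  moreover have "int (card {m \<in> {1..N}. s m = x}) = f x" if "x \<in> Z" for x
    unfolding card_s using count[of x] that f[OF that] by simp
  moreover have "card {m \<in> {1..N}. s m = x} = 0" if "x \<notin> Z" for x
    using count[of x] that by (simp only: card_s if_False)
  ultimately show ?thesis by (intro exI[of _ s]) blast
qed

lemma finite_zeros_entire:
  assumes f: "f holomorphic_on UNIV" "f b \<noteq> (0::complex)"
  shows "finite {s \<in> cball x R. f s = 0}"
proof (cases "f constant_on UNIV")
  case True
  then have "f s \<noteq> 0" for s using f(2) unfolding constant_on_def by (metis UNIV_I)
  then show ?thesis by simp
next
  case False
  then show ?thesis
    by (intro holomorphic_compact_finite_zeros[OF f(1) open_UNIV connected_UNIV compact_cball]) auto
qed

context bubble_clusters
begin

section \<open>Rouche's theorem for \<open>det P\<close> against the decoupled determinant\<close>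

definition detD :: "complex \<Rightarrow> complex" where "detD s = det (D_mat \<omega> s)"

lemma detD_eq: "detD s = (\<Prod>i\<in>UNIV. s\<^sup>2 / (of_real (\<omega> i))\<^sup>2 + 1)"
  unfolding detD_def D_mat_def by (subst det_diagonal) auto

lemma detD_factor_eq: "s\<^sup>2 / (of_real (\<omega> i))\<^sup>2 + 1 = (s - \<i> * of_real (\<omega> i)) * ((s + \<i> * of_real (\<omega> i)) / (of_real (\<omega> i))\<^sup>2)"
  using \<omega>_pos[of i] by (simp add: field_simps power2_eq_square)

lemma detD_holomorphic: "detD holomorphic_on X"
  unfolding detD_eq[abs_def] using \<omega>_pos by (intro holomorphic_intros) (auto simp: less_imp_neq[symmetric])

lemma dist_center: "dist (center \<alpha>) (\<i> * of_real y) = \<bar>\<omega>\<^sub>c \<alpha> - y\<bar>"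
proof -
  have "center \<alpha> - \<i> * of_real y = \<i> * of_real (\<omega>\<^sub>c \<alpha> - y)" by (simp add: right_diff_distrib)
  then show ?thesis by (simp only: dist_norm norm_mult norm_ii norm_of_real mult_1_left)
qed

text \<open>\<open>r_less\<close> rules out the mirrored frequencies, \<open>r_sep\<close> those of
  other clusters.\<close>

lemma other_frequency_far:
  assumes "s \<in> cball (center \<alpha>) r" and "s = \<i> * of_real (\<omega> i) \<or> s = - (\<i> * of_real (\<omega> i))"
  shows "s = center \<alpha> \<and> cl i = \<alpha>"
proof -
  from assms(2) have "s = \<i> * of_real (\<omega> i)"
  proof
    assume "s = - (\<i> * of_real (\<omega> i))"
    then have "s = \<i> * of_real (- \<omega> i)" by simp
    then have "\<bar>\<omega>\<^sub>c \<alpha> - - \<omega> i\<bar> \<le> r"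
      using assms(1) dist_center[of \<alpha> "- \<omega> i"] by (simp only: mem_cball)
    then show ?thesis using \<omega>_pos[of i] r_less[of \<alpha>] by simp
  qed
  moreover have "cl i = \<alpha>"
  proof (rule ccontr)
    assume "cl i \<noteq> \<alpha>"
    then have "2 * r \<le> \<bar>\<omega>\<^sub>c \<alpha> - \<omega> i\<bar>" using r_sep[of \<alpha> "cl i"] by (simp add: \<omega>_cl)
    then show False using assms(1) dist_center[of \<alpha> "\<omega> i"] r_pos calculation by (simp only: mem_cball)
  qed
  ultimately show ?thesis by (simp add: \<omega>_cl)
qed

lemma detD_zero:
  assumes "s \<in> cball (center \<alpha>) r" "detD s = 0"
  shows "s = center \<alpha>"
proof -
  obtain i where "s\<^sup>2 / (of_real (\<omega> i))\<^sup>2 + 1 = 0"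
    using assms(2) unfolding detD_eq by auto
  then have "s = \<i> * of_real (\<omega> i) \<or> s = - (\<i> * of_real (\<omega> i))"
    unfolding detD_factor_eq using \<omega>_pos[of i] by (auto simp: eq_neg_iff_add_eq_0)
  then show ?thesis using other_frequency_far[OF assms(1)] by blast
qed

text \<open>Each bubble of the cluster contributes one simple factor vanishing at the centre;
  \<open>g\<close> collects the mirrored factors and those of the other clusters, none of which
  vanishes there.\<close>

lemma zorder_detD: "zorder detD (center \<alpha>) = int (card (cluster_of \<alpha>))"
proof -
  define g where "g = (\<lambda>s. (\<Prod>i\<in>cluster_of \<alpha>. (s + \<i> * of_real (\<omega> i)) / (of_real (\<omega> i))\<^sup>2) * (\<Prod>i\<in>- cluster_of \<alpha>. s\<^sup>2 / (of_real (\<omega> i))\<^sup>2 + 1))"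
  have eq: "detD s = g s * (s - center \<alpha>) ^ card (cluster_of \<alpha>)" for s
  proof -
    have "detD s = (\<Prod>i\<in>cluster_of \<alpha>. s\<^sup>2 / (of_real (\<omega> i))\<^sup>2 + 1) * (\<Prod>i\<in>- cluster_of \<alpha>. s\<^sup>2 / (of_real (\<omega> i))\<^sup>2 + 1)"
      unfolding detD_eq by (subst prod.union_disjoint[symmetric]) auto
    also have "(\<Prod>i\<in>cluster_of \<alpha>. s\<^sup>2 / (of_real (\<omega> i))\<^sup>2 + 1) =
        (\<Prod>i\<in>cluster_of \<alpha>. (s - center \<alpha>) * ((s + \<i> * of_real (\<omega> i)) / (of_real (\<omega> i))\<^sup>2))"
      unfolding detD_factor_eq by (intro prod.cong) (auto simp: \<omega>_cluster)
    also have "\<dots> = (s - center \<alpha>) ^ card (cluster_of \<alpha>) * (\<Prod>i\<in>cluster_of \<alpha>. (s + \<i> * of_real (\<omega> i)) / (of_real (\<omega> i))\<^sup>2)"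
      by (simp only: prod.distrib prod_constant)
    finally show ?thesis by (simp only: g_def mult_ac)
  qed
  have \<omega>nz: "complex_of_real (\<omega> i) \<noteq> 0" for i using \<omega>_pos[of i] by simp
  have holg: "g holomorphic_on UNIV"
    unfolding g_def using \<omega>nz by (intro holomorphic_intros) auto
  have g0: "g (center \<alpha>) \<noteq> 0"
  proof -
    have "(center \<alpha> + \<i> * of_real (\<omega> i)) / (of_real (\<omega> i))\<^sup>2 \<noteq> 0" if "i \<in> cluster_of \<alpha>" for i
      using \<omega>_cluster[OF that] \<omega>nz[of i] by (simp flip: distrib_left)
    moreover have "(center \<alpha>)\<^sup>2 / (of_real (\<omega> i))\<^sup>2 + 1 \<noteq> 0" if "i \<in> - cluster_of \<alpha>" for i
    proof
      assume "(center \<alpha>)\<^sup>2 / (of_real (\<omega> i))\<^sup>2 + 1 = 0"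
      then have "center \<alpha> = \<i> * of_real (\<omega> i) \<or> center \<alpha> = - (\<i> * of_real (\<omega> i))"
        unfolding detD_factor_eq using \<omega>_pos[of i] by (auto simp: eq_neg_iff_add_eq_0)
      then show False
        using other_frequency_far[of "center \<alpha>" \<alpha> i] r_pos that by (auto simp: cluster_def)
    qed
    ultimately show ?thesis by (simp add: g_def)
  qed
  show ?thesis
    by (rule zorder_eqI[OF open_UNIV UNIV_I holg g0]) (simp add: eq)
qed

text \<open>Points of the circle that violate the inequality for \<epsilon> tending to 0 would
  accumulate at a zero of \<open>detD\<close> on the circle, since \<open>det P\<close> converges to
  \<open>detD\<close> along them; but the centre is the only zero in the closed disc.\<close>

lemma eventually_det_close:
  "\<forall>\<^sub>F \<epsilon> in at_right 0. \<forall>s\<in>sphere (center \<alpha>) r. cmod (det (P \<epsilon> s) - detD s) < cmod (detD s)"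
proof (rule ccontr)
  assume "\<not> ?thesis"
  then obtain e where e: "\<And>n. e n \<in> {0<..\<epsilon>\<^sub>1}" "e \<longlonglongrightarrow> 0"
    "\<And>n. \<not> (\<forall>s\<in>sphere (center \<alpha>) r. cmod (det (P (e n) s) - detD s) < cmod (detD s))"
    using not_eventually_at_right_sequence[OF _ \<epsilon>\<^sub>1, of "\<lambda>n. _"] by blast
  then obtain s where s: "\<And>n. s n \<in> sphere (center \<alpha>) r" "\<And>n. cmod (detD (s n)) \<le> cmod (det (P (e n) (s n)) - detD (s n))"
    unfolding not_less[symmetric] by metis
  obtain l \<phi> where l: "l \<in> sphere (center \<alpha>) r" "strict_mono \<phi>" "(s \<circ> \<phi>) \<longlonglongrightarrow> l"
    using compact_sphere[of "center \<alpha>" r] s(1) unfolding compact_def by metis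
  have sl: "(\<lambda>n. s (\<phi> n)) \<longlonglongrightarrow> l" using l(3) by (simp add: o_def)
  have e\<phi>: "\<And>n. e (\<phi> n) \<in> {0<..\<epsilon>\<^sub>1}" "(\<lambda>n. e (\<phi> n)) \<longlonglongrightarrow> 0"
    using e(1) LIMSEQ_subseq_LIMSEQ[OF e(2) l(2)] by (simp_all add: o_def)
  obtain R where R: "\<And>n. cmod (s (\<phi> n)) \<le> R" using convergent_bounded[OF sl] by blast
  have "(\<lambda>n. det (P (e (\<phi> n)) (s (\<phi> n)))) \<longlonglongrightarrow> det (D_mat \<omega> l)"
  proof (rule tendsto_det)
    fix i j
    show "(\<lambda>n. P (e (\<phi> n)) (s (\<phi> n)) $ i $ j) \<longlonglongrightarrow> D_mat \<omega> l $ i $ j"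
    proof (cases "i = j")
      case True
      then show ?thesis
        unfolding P_entry D_mat_def using \<omega>_pos[of i] by (auto intro!: tendsto_intros sl)
    next
      case False
      have "(\<lambda>n. (s (\<phi> n))\<^sup>2 * q (e (\<phi> n)) i j (s (\<phi> n))) \<longlonglongrightarrow> l\<^sup>2 * 0"
        by (intro tendsto_intros sl q_tendsto_0[OF e\<phi> R False])
      then show ?thesis unfolding P_entry D_mat_def using False by simp
    qed
  qed
  then have 1: "(\<lambda>n. det (P (e (\<phi> n)) (s (\<phi> n)))) \<longlonglongrightarrow> detD l" by (simp add: detD_def)
  have 2: "(\<lambda>n. detD (s (\<phi> n))) \<longlonglongrightarrow> detD l"
  proof -
    have "isCont detD l"
      using holomorphic_on_imp_continuous_on[OF detD_holomorphic] continuous_on_eq_continuous_at open_UNIV by blast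
    then show ?thesis using sl isCont_tendsto_compose by blast
  qed
  have "cmod (detD l) \<le> cmod (detD l - detD l)"
    by (rule LIMSEQ_le[OF tendsto_norm[OF 2] tendsto_norm[OF tendsto_diff[OF 1 2]]]) (use s(2) in blast)
  then have "detD l = 0" by simp
  moreover have "l \<in> cball (center \<alpha>) r" using l(1) by auto
  ultimately have "l = center \<alpha>" using detD_zero by blast
  then show False using l(1) r_pos by simp
qed

definition zeros :: "real \<Rightarrow> 'n \<Rightarrow> complex set" where
  "zeros \<epsilon> \<alpha> = {s \<in> ball (center \<alpha>) r. det (P \<epsilon> s) = 0}"

lemma finite_zeros: "finite (zeros \<epsilon> \<alpha>)"
  unfolding zeros_def
  by (rule finite_subset[OF _ finite_zeros_entire[OF det_P_holomorphic det_P_0, of "center \<alpha>" r]]) auto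

lemma zorder_det_P_pos: "det (P \<epsilon> s) = 0 \<longleftrightarrow> 0 < zorder (\<lambda>u. det (P \<epsilon> u)) s"
  and zorder_det_P_nonneg: "0 \<le> zorder (\<lambda>u. det (P \<epsilon> u)) s"
proof -
  show "det (P \<epsilon> s) = 0 \<longleftrightarrow> 0 < zorder (\<lambda>u. det (P \<epsilon> u)) s"
    by (rule zorder_entire[OF det_P_holomorphic det_P_0, of \<epsilon> s])
  show "0 \<le> zorder (\<lambda>u. det (P \<epsilon> u)) s"
    by (rule zorder_entire[OF det_P_holomorphic det_P_0, of \<epsilon> s])
qed

lemma eventually_zero_count:
  "\<forall>\<^sub>F \<epsilon> in at_right 0. (\<Sum>s\<in>zeros \<epsilon> \<alpha>. zorder (\<lambda>u. det (P \<epsilon> u)) s) = int (card (cluster_of \<alpha>))"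
  using eventually_det_close[of \<alpha>]
proof eventually_elim
  case (elim \<epsilon>)
  \<comment> \<open>The doubled disc serves as an open set around the circle. Zeros of either
    function in it but outside the circle have winding number 0.\<close>
  define S where "S = ball (center \<alpha>) (2 * r)"
  define g where "g = (\<lambda>s. det (P \<epsilon> s) - detD s)"
  let ?\<gamma> = "circlepath (center \<alpha>) r"
  let ?Zf = "{s \<in> S. detD s = 0}"
  let ?Zfg = "{s \<in> S. detD s + g s = 0}"
  have fg: "(\<lambda>s. detD s + g s) = (\<lambda>s. det (P \<epsilon> s))" by (simp add: g_def fun_eq_iff)
  have detD0: "detD 0 \<noteq> 0" by (simp add: detD_eq)
  have finf: "finite ?Zf"
    by (rule finite_subset[OF _ finite_zeros_entire[OF detD_holomorphic detD0, of "center \<alpha>" "2 * r"]]) (auto simp: S_def)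
  have finfg: "finite ?Zfg"
    by (rule finite_subset[OF _ finite_zeros_entire[OF det_P_holomorphic[of \<epsilon>] det_P_0, of "center \<alpha>" "2 * r"]])
      (auto simp: S_def g_def)
  have outside: "winding_number ?\<gamma> w = 0" if "w \<notin> cball (center \<alpha>) r" for w
    using that r_pos by (intro winding_number_zero_outside[of _ "cball (center \<alpha>) r"]) (auto simp: path_image_circlepath)
  have inside: "winding_number ?\<gamma> w = 1" if "w \<in> ball (center \<alpha>) r" for w
    using that by (intro winding_number_circlepath) (simp add: dist_norm norm_minus_commute)
  have "(\<Sum>w\<in>?Zfg. winding_number ?\<gamma> w * zorder (\<lambda>s. detD s + g s) w) = (\<Sum>w\<in>?Zf. winding_number ?\<gamma> w * zorder detD w)"
  proof (rule Rouche_theorem)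
    show "g holomorphic_on S"
      unfolding g_def by (intro holomorphic_on_diff detD_holomorphic holomorphic_on_subset[OF det_P_holomorphic]) auto
    show "path_image ?\<gamma> \<subseteq> S" using r_pos by (auto simp: path_image_circlepath S_def)
    show "\<forall>z\<in>path_image ?\<gamma>. cmod (g z) < cmod (detD z)"
      using elim r_pos by (simp add: path_image_circlepath g_def)
    show "\<forall>z. z \<notin> S \<longrightarrow> winding_number ?\<gamma> z = 0"
      using outside r_pos by (auto simp: S_def)
  qed (use finf finfg in \<open>auto simp: S_def detD_holomorphic\<close>)
  moreover have "(\<Sum>w\<in>?Zfg. winding_number ?\<gamma> w * zorder (\<lambda>s. detD s + g s) w) = (\<Sum>w\<in>zeros \<epsilon> \<alpha>. of_int (zorder (\<lambda>u. det (P \<epsilon> u)) w))"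
    unfolding fg
  proof (rule sum.mono_neutral_cong_right)
    show "finite {s \<in> S. detD s + g s = 0}" by (rule finfg)
    show sub: "zeros \<epsilon> \<alpha> \<subseteq> {s \<in> S. detD s + g s = 0}"
      using r_pos by (auto simp: zeros_def S_def g_def)
    show "\<forall>w\<in>{s \<in> S. detD s + g s = 0} - zeros \<epsilon> \<alpha>. winding_number ?\<gamma> w * of_int (zorder (\<lambda>s. det (P \<epsilon> s)) w) = 0"
    proof
      fix w assume w: "w \<in> {s \<in> S. detD s + g s = 0} - zeros \<epsilon> \<alpha>"
      then have "det (P \<epsilon> w) = 0" "w \<notin> ball (center \<alpha>) r" by (auto simp: zeros_def g_def)
      \<comment> \<open>Strictness of the inequality excludes zeros on the circle itself.\<close>
      moreover have "w \<notin> sphere (center \<alpha>) r"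
      proof
        assume "w \<in> sphere (center \<alpha>) r"
        then have "cmod (det (P \<epsilon> w) - detD w) < cmod (detD w)" using elim by blast
        then show False using \<open>det (P \<epsilon> w) = 0\<close> by simp
      qed
      ultimately have "w \<notin> cball (center \<alpha>) r" by auto
      then show "winding_number ?\<gamma> w * of_int (zorder (\<lambda>s. det (P \<epsilon> s)) w) = 0" using outside by simp
    qed
    show "winding_number ?\<gamma> w * of_int (zorder (\<lambda>s. det (P \<epsilon> s)) w) = of_int (zorder (\<lambda>u. det (P \<epsilon> u)) w)" if "w \<in> zeros \<epsilon> \<alpha>" for w
      using that inside by (simp add: zeros_def)
  qed
  moreover have "(\<Sum>w\<in>?Zf. winding_number ?\<gamma> w * zorder detD w) = of_nat (card (cluster_of \<alpha>))"
  proof -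
    have "(\<Sum>w\<in>?Zf. winding_number ?\<gamma> w * zorder detD w) = (\<Sum>w\<in>{center \<alpha>}. of_nat (card (cluster_of \<alpha>)))"
    proof (rule sum.mono_neutral_cong_right[OF finf])
      have "detD (center \<alpha>) = 0"
      proof -
        obtain k where k: "k \<in> cluster_of \<alpha>" using cluster_nonempty by blast
        then have "(center \<alpha>)\<^sup>2 / (of_real (\<omega> k))\<^sup>2 + 1 = 0"
          unfolding detD_factor_eq by (simp add: \<omega>_cluster)
        then show ?thesis unfolding detD_eq by auto
      qed
      then show "{center \<alpha>} \<subseteq> {s \<in> S. detD s = 0}" using r_pos by (auto simp: S_def)
      show "\<forall>w\<in>{s \<in> S. detD s = 0} - {center \<alpha>}. winding_number ?\<gamma> w * of_int (zorder detD w) = 0"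
        using outside detD_zero by fastforce
      show "winding_number ?\<gamma> w * of_int (zorder detD w) = of_nat (card (cluster_of \<alpha>))" if "w \<in> {center \<alpha>}" for w
        using that inside[of "center \<alpha>"] r_pos zorder_detD[of \<alpha>] by simp
    qed
    then show ?thesis by simp
  qed
  ultimately have "(\<Sum>w\<in>zeros \<epsilon> \<alpha>. complex_of_int (zorder (\<lambda>u. det (P \<epsilon> u)) w)) = of_nat (card (cluster_of \<alpha>))"
    by simp
  \<comment> \<open>The winding numbers make the counting identity complex-valued; it is read back
    as an identity between integers.\<close>
  then have "complex_of_int (\<Sum>w\<in>zeros \<epsilon> \<alpha>. zorder (\<lambda>u. det (P \<epsilon> u)) w) = complex_of_int (int (card (cluster_of \<alpha>)))"
    by simp
  then show ?case by (simp only: of_int_eq_iff)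
qed

section \<open>Enumeration of the zeros with the principal one first\<close>

abbreviation predicted :: "'n \<Rightarrow> real \<Rightarrow> complex" where
  "predicted \<alpha> \<epsilon> \<equiv> center \<alpha> + of_real (\<eta> \<epsilon>) * shift \<alpha> (lam \<alpha> \<epsilon>)"

lemma eventually_in_range: "\<forall>\<^sub>F \<epsilon> in at_right 0. \<epsilon> \<in> {0<..\<epsilon>\<^sub>1}"
  using eventually_at_right_less[of 0] eventually_at_right_real[OF \<epsilon>\<^sub>1]
  by (auto elim: eventually_mono)

lemma \<eta>_tendsto: "(\<eta> \<longlongrightarrow> 0) (at_right 0)"
proof -
  have "((\<lambda>\<epsilon>::real. \<epsilon> powr (1 - p)) \<longlongrightarrow> 0) (at_right 0)"
    by (rule tendsto_zero_powrI[OF tendsto_ident_at tendsto_const])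
      (use p eventually_at_right_less[of "0::real"] in \<open>auto elim: eventually_mono\<close>)
  then show ?thesis by (simp add: \<eta>_def[abs_def])
qed

lemma predicted_tendsto: "(predicted \<alpha> \<longlongrightarrow> center \<alpha>) (at_right 0)"
proof -
  define B where "B = \<omega>\<^sub>c \<alpha> ^ 3 * (real CARD('m) * K\<^sub>m\<^sub>a\<^sub>x)"
  have "((\<lambda>\<epsilon>. of_real (\<eta> \<epsilon>) * shift \<alpha> (lam \<alpha> \<epsilon>)) \<longlongrightarrow> 0) (at_right 0)"
  proof (rule tendsto_norm_zero_cancel, rule tendsto_sandwich[OF _ _ tendsto_const])
    show "\<forall>\<^sub>F \<epsilon> in at_right 0. norm (of_real (\<eta> \<epsilon>) * shift \<alpha> (lam \<alpha> \<epsilon>)) \<le> \<eta> \<epsilon> * B"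
      using eventually_in_range
    proof eventually_elim
      case (elim \<epsilon>)
      then show ?case
        using shift_bound[OF elim, of \<alpha>] \<eta>_pos[OF elim]
        by (auto intro!: mult_left_mono simp: norm_mult B_def abs_of_pos)
    qed
    show "((\<lambda>\<epsilon>. \<eta> \<epsilon> * B) \<longlongrightarrow> 0) (at_right 0)"
      using \<eta>_tendsto tendsto_mult_left_zero by blast
  qed simp
  from tendsto_add[OF tendsto_const this, of "center \<alpha>"] show ?thesis by simp
qed

definition is_enumeration :: "'n \<Rightarrow> real \<Rightarrow> (nat \<Rightarrow> complex) \<Rightarrow> bool" where
  "is_enumeration \<alpha> \<epsilon> f \<longleftrightarrow> (\<forall>m\<in>{1..card (cluster_of \<alpha>)}. f m \<in> ball (center \<alpha>) r) \<and>
     (\<forall>w\<in>ball (center \<alpha>) r. int (card {m \<in> {1..card (cluster_of \<alpha>)}. f m = w}) = zorder (\<lambda>u. det (P \<epsilon> u)) w)"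

text \<open>A zero nearest to the prediction receives the number 1. A minimiser exists because the
  zeros are finitely many and, by the count, there is at least one.\<close>

lemma enumeration_exists:
  assumes "(\<Sum>s\<in>zeros \<epsilon> \<alpha>. zorder (\<lambda>u. det (P \<epsilon> u)) s) = int (card (cluster_of \<alpha>))"
  shows "\<exists>f. is_enumeration \<alpha> \<epsilon> f \<and> (\<forall>w\<in>zeros \<epsilon> \<alpha>. cmod (f 1 - predicted \<alpha> \<epsilon>) \<le> cmod (w - predicted \<alpha> \<epsilon>))"
proof -
  have "card (cluster_of \<alpha>) \<noteq> 0"
    using cluster_nonempty by simp
  then have ne: "zeros \<epsilon> \<alpha> \<noteq> {}" using assms by auto
  obtain w where w: "w \<in> zeros \<epsilon> \<alpha>" "\<And>w'. w' \<in> zeros \<epsilon> \<alpha> \<Longrightarrow> cmod (w - predicted \<alpha> \<epsilon>) \<le> cmod (w' - predicted \<alpha> \<epsilon>)"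
    using ex_is_arg_min_if_finite[OF finite_zeros ne, of "\<lambda>w. cmod (w - predicted \<alpha> \<epsilon>)"]
    unfolding is_arg_min_linorder by blast
  have pos: "0 < zorder (\<lambda>u. det (P \<epsilon> u)) s" if "s \<in> zeros \<epsilon> \<alpha>" for s
    using that zorder_det_P_pos by (simp add: zeros_def)
  from enumerate_with_multiplicity[OF finite_zeros pos assms w(1)]
  obtain f :: "nat \<Rightarrow> complex" where f: "f 1 = w \<and> (\<forall>m\<in>{1..card (cluster_of \<alpha>)}. f m \<in> zeros \<epsilon> \<alpha>) \<and>
    (\<forall>x\<in>zeros \<epsilon> \<alpha>. int (card {m \<in> {1..card (cluster_of \<alpha>)}. f m = x}) = zorder (\<lambda>u. det (P \<epsilon> u)) x) \<and>
    (\<forall>x. x \<notin> zeros \<epsilon> \<alpha> \<longrightarrow> card {m \<in> {1..card (cluster_of \<alpha>)}. f m = x} = 0)" ..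
  have "int (card {m \<in> {1..card (cluster_of \<alpha>)}. f m = x}) = zorder (\<lambda>u. det (P \<epsilon> u)) x"
    if "x \<in> ball (center \<alpha>) r" for x
  proof (cases "x \<in> zeros \<epsilon> \<alpha>")
    case False
    then have "det (P \<epsilon> x) \<noteq> 0" using that by (simp add: zeros_def)
    then have "zorder (\<lambda>u. det (P \<epsilon> u)) x = 0"
      using zorder_det_P_pos[of \<epsilon> x] zorder_det_P_nonneg[of \<epsilon> x] by linarith
    then show ?thesis using f False by simp
  qed (use f in blast)
  then have "is_enumeration \<alpha> \<epsilon> f"
    unfolding is_enumeration_def using f by (auto simp: zeros_def)
  then show ?thesis using f w(2) by (intro exI[of _ f]) simp
qed

text \<open>The choice of a nearest zero does not refer to \<delta>, so one family \<open>s\<close>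
  satisfies the bound for every \<delta>: whenever some zero is within
  \<open>\<delta> * \<eta> \<epsilon>\<close> of the prediction, the chosen one is too.\<close>

lemma principal_enumeration_exists:
  "\<exists>s. (\<forall>\<^sub>F \<epsilon> in at_right 0. \<forall>\<alpha>. is_enumeration \<alpha> \<epsilon> (s \<epsilon> \<alpha>)) \<and>
     (\<forall>\<alpha> \<delta>. 0 < \<delta> \<longrightarrow> (\<forall>\<^sub>F \<epsilon> in at_right 0. cmod (s \<epsilon> \<alpha> 1 - predicted \<alpha> \<epsilon>) \<le> \<delta> * \<eta> \<epsilon>))"
proof -
  define good where "good = (\<lambda>\<epsilon> \<alpha>. (\<Sum>s\<in>zeros \<epsilon> \<alpha>. zorder (\<lambda>u. det (P \<epsilon> u)) s) = int (card (cluster_of \<alpha>)))"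
  define Q where "Q = (\<lambda>\<epsilon> \<alpha> f. is_enumeration \<alpha> \<epsilon> f \<and> (\<forall>w\<in>zeros \<epsilon> \<alpha>. cmod (f 1 - predicted \<alpha> \<epsilon>) \<le> cmod (w - predicted \<alpha> \<epsilon>)))"
  have "\<exists>f. good \<epsilon> \<alpha> \<longrightarrow> Q \<epsilon> \<alpha> f" for \<epsilon> \<alpha>
    using enumeration_exists unfolding good_def Q_def by blast
  then obtain s where s: "\<And>\<epsilon> \<alpha>. good \<epsilon> \<alpha> \<Longrightarrow> Q \<epsilon> \<alpha> (s \<epsilon> \<alpha>)" by metis
  have good: "\<forall>\<^sub>F \<epsilon> in at_right 0. good \<epsilon> \<alpha>" for \<alpha>
    unfolding good_def by (rule eventually_zero_count)
  have "\<forall>\<^sub>F \<epsilon> in at_right 0. \<forall>\<alpha>. is_enumeration \<alpha> \<epsilon> (s \<epsilon> \<alpha>)"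
  proof (rule eventually_all_finite)
    show "\<forall>\<^sub>F \<epsilon> in at_right 0. is_enumeration \<alpha> \<epsilon> (s \<epsilon> \<alpha>)" for \<alpha>
      using good[of \<alpha>] by eventually_elim (use s in \<open>auto simp: Q_def\<close>)
  qed
  moreover have "\<forall>\<^sub>F \<epsilon> in at_right 0. cmod (s \<epsilon> \<alpha> 1 - predicted \<alpha> \<epsilon>) \<le> \<delta> * \<eta> \<epsilon>" if \<delta>: "0 < \<delta>" for \<alpha> \<delta>
  proof -
    have "\<forall>\<^sub>F \<epsilon> in at_right 0. dist (predicted \<alpha> \<epsilon>) (center \<alpha>) < r / 2"
      using tendstoD[OF predicted_tendsto[of \<alpha>], of "r / 2"] r_pos by simp
    moreover have "\<forall>\<^sub>F \<epsilon> in at_right 0. \<delta> * \<eta> \<epsilon> < r / 2"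
      using order_tendstoD(2)[OF tendsto_mult_right_zero[OF \<eta>_tendsto, of \<delta>], of "r / 2"] r_pos by simp
    ultimately show ?thesis
      using eventually_principal_zero[OF \<delta>, of \<alpha>] good[of \<alpha>]
    proof eventually_elim
      case (elim \<epsilon>)
      obtain w where w: "det (P \<epsilon> w) = 0" "cmod (w - predicted \<alpha> \<epsilon>) < \<delta> * \<eta> \<epsilon>" using elim(3) by blast
      \<comment> \<open>Two distances below \<open>r / 2\<close> place the zero in the disc, hence
        among those enumerated.\<close>
      have "dist w (predicted \<alpha> \<epsilon>) < r / 2" using w(2) elim(2) by (simp add: dist_norm)
      then have "dist w (center \<alpha>) < r"
        using elim(1) dist_triangle_half_r[of "predicted \<alpha> \<epsilon>" w r "center \<alpha>"] by (simp add: dist_commute)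
      then have "w \<in> zeros \<epsilon> \<alpha>" using w(1) by (simp add: zeros_def dist_commute)
      then show ?case using s[OF elim(4)] w(2) unfolding Q_def by fastforce
    qed
  qed
  ultimately show ?thesis by blast
qed

end

subsection \<open>The transfer matrix\<close>

context bubble_clusters
begin

lemma leading_order_smallo:
  "(\<lambda>\<epsilon>. a \<epsilon> - (\<i> * of_real (\<omega>\<^sub>c \<alpha>) - \<i> / 2 * of_real ((\<omega>\<^sub>c \<alpha>) ^ 3
      * perron_eigenvalue (interaction_mat p cl C (z \<epsilon>) \<epsilon> \<alpha>) * \<epsilon> powr (1 - p))))
    \<in> o[at_right 0](\<lambda>\<epsilon>. of_real (\<epsilon> powr (1 - p))) \<longleftrightarrow> leading_order \<alpha> a"
proof -
  define f where "f = (\<lambda>\<epsilon>. a \<epsilon> - predicted \<alpha> \<epsilon>)"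
  have f_eq: "(\<lambda>\<epsilon>. a \<epsilon> - (\<i> * of_real (\<omega>\<^sub>c \<alpha>) - \<i> / 2 * of_real ((\<omega>\<^sub>c \<alpha>) ^ 3
      * perron_eigenvalue (interaction_mat p cl C (z \<epsilon>) \<epsilon> \<alpha>) * \<epsilon> powr (1 - p)))) = f"
    by (simp add: f_def fun_eq_iff shift_def lam_def K_def \<eta>_def)
  have nz: "\<forall>\<^sub>F \<epsilon> in at_right 0. complex_of_real (\<eta> \<epsilon>) \<noteq> 0"
    using eventually_in_range by eventually_elim (simp add: \<eta>_def)
  have "f \<in> o[at_right 0](\<lambda>\<epsilon>. of_real (\<eta> \<epsilon>)) \<longleftrightarrow> ((\<lambda>\<epsilon>. f \<epsilon> / of_real (\<eta> \<epsilon>)) \<longlongrightarrow> 0) (at_right 0)"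
    using smalloI_tendsto[OF _ nz, of f] smalloD_tendsto[of f "at_right 0" "\<lambda>\<epsilon>. complex_of_real (\<eta> \<epsilon>)"] by blast
  also have "\<dots> \<longleftrightarrow> leading_order \<alpha> a"
    unfolding leading_order_def
  proof (rule tendsto_cong)
    show "\<forall>\<^sub>F \<epsilon> in at_right 0. f \<epsilon> / of_real (\<eta> \<epsilon>) = (a \<epsilon> - \<i> * of_real (\<omega>\<^sub>c \<alpha>)) / of_real (\<eta> \<epsilon>) - shift \<alpha> (lam \<alpha> \<epsilon>)"
      using nz by eventually_elim (simp add: f_def field_simps)
  qed
  finally show ?thesis unfolding f_eq by (simp only: \<eta>_def)
qed

lemma cluster_resonances_iff:
  "cluster_resonances p c\<^sub>0 cl \<omega> \<omega>\<^sub>c C z r s \<longleftrightarrow>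
     (\<forall>\<^sub>F \<epsilon> in at_right 0. \<forall>\<alpha>. is_enumeration \<alpha> \<epsilon> (s \<epsilon> \<alpha>)) \<and> (\<forall>\<alpha>. leading_order \<alpha> (\<lambda>\<epsilon>. s \<epsilon> \<alpha> 1))"
  unfolding cluster_resonances_def leading_order_smallo is_enumeration_def P_def ..

text \<open>Existence ensures that the assertions about all families \<open>s\<close> are not
  vacuous.\<close>

lemma cluster_resonances_exist: "\<exists>s. cluster_resonances p c\<^sub>0 cl \<omega> \<omega>\<^sub>c C z r s"
proof -
  obtain s where s: "\<forall>\<^sub>F \<epsilon> in at_right 0. \<forall>\<alpha>. is_enumeration \<alpha> \<epsilon> (s \<epsilon> \<alpha>)"
    "\<And>\<alpha> \<delta>. 0 < \<delta> \<Longrightarrow> \<forall>\<^sub>F \<epsilon> in at_right 0. cmod (s \<epsilon> \<alpha> 1 - predicted \<alpha> \<epsilon>) \<le> \<delta> * \<eta> \<epsilon>"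
    using principal_enumeration_exists by blast
  have "leading_order \<alpha> (\<lambda>\<epsilon>. s \<epsilon> \<alpha> 1)" for \<alpha>
    unfolding leading_order_def
  proof (rule tendstoI)
    fix \<delta> :: real assume \<delta>: "0 < \<delta>"
    have "\<forall>\<^sub>F \<epsilon> in at_right 0. cmod (s \<epsilon> \<alpha> 1 - predicted \<alpha> \<epsilon>) \<le> \<delta> / 2 * \<eta> \<epsilon>"
      using \<delta> by (intro s(2)) simp
    with eventually_in_range
    show "\<forall>\<^sub>F \<epsilon> in at_right 0. dist ((s \<epsilon> \<alpha> 1 - center \<alpha>) / of_real (\<eta> \<epsilon>) - shift \<alpha> (lam \<alpha> \<epsilon>)) 0 < \<delta>"
    proof eventually_elim
      case (elim \<epsilon>)
      have \<eta>: "0 < \<eta> \<epsilon>" using \<eta>_pos[OF elim(1)] .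
      have "(s \<epsilon> \<alpha> 1 - center \<alpha>) / of_real (\<eta> \<epsilon>) - shift \<alpha> (lam \<alpha> \<epsilon>) = (s \<epsilon> \<alpha> 1 - predicted \<alpha> \<epsilon>) / of_real (\<eta> \<epsilon>)"
        using \<eta> by (simp add: field_simps)
      then have "dist ((s \<epsilon> \<alpha> 1 - center \<alpha>) / of_real (\<eta> \<epsilon>) - shift \<alpha> (lam \<alpha> \<epsilon>)) 0 = cmod (s \<epsilon> \<alpha> 1 - predicted \<alpha> \<epsilon>) / \<eta> \<epsilon>"
        using \<eta> by (simp add: norm_divide)
      also have "\<dots> \<le> \<delta> / 2"
        using elim(2) \<eta> by (simp add: divide_le_eq)
      finally show ?case using \<delta> by simp
    qed
  qed
  then show ?thesis using s(1) unfolding cluster_resonances_iff by blast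
qed

section \<open>Reduction of the transfer matrix to the resolvent of \<open>P\<close>\<close>

lemma D_entry_holomorphic: "(\<lambda>s. D_mat \<omega> s $ i $ j) holomorphic_on UNIV"
  using \<omega>_pos[of i] unfolding D_mat_def by (cases "i = j") (auto intro!: holomorphic_intros)

lemma detD_0: "detD 0 \<noteq> 0"
  by (simp add: detD_eq)

lemma K_dyn_eq:
  assumes "det (D_mat \<omega> s) \<noteq> 0"
  shows "K_dyn c\<^sub>0 \<omega> C (z \<epsilon>) \<epsilon> s = matrix_inv (D_mat \<omega> s) ** P \<epsilon> s"
  unfolding K_dyn_def P_def P_mat_def matrix_add_ldistrib
  by (simp add: matrix_inv_inverse[OF assms] matrix_mul_assoc)

lemma det_matrix_inv:
  assumes "det (D_mat \<omega> s) \<noteq> 0"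
  shows "det (matrix_inv (D_mat \<omega> s)) \<noteq> 0"
  using arg_cong[OF matrix_inv_inverse(1)[OF assms], of det] by (auto simp: det_mul)

lemma invertible_K_dyn_iff:
  assumes "det (D_mat \<omega> s) \<noteq> 0"
  shows "invertible (K_dyn c\<^sub>0 \<omega> C (z \<epsilon>) \<epsilon> s) \<longleftrightarrow> det (P \<epsilon> s) \<noteq> 0"
  unfolding invertible_det_nz K_dyn_eq[OF assms] det_mul using det_matrix_inv[OF assms] by simp

text \<open>The factor \<open>D\<close> that appears on inverting \<open>K_dyn\<close> cancels the
  inverse of \<open>D\<close> in \<open>B_mat\<close>, so the formula extends across zeros of
  \<open>det D\<close>.\<close>

lemma H_mat_eq:
  assumes D: "det (D_mat \<omega> s) \<noteq> 0" and P: "det (P \<epsilon> s) \<noteq> 0"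
  shows "H_mat c\<^sub>0 \<omega> C (z \<epsilon>) \<epsilon> B s = A_mat C \<epsilon> ** matrix_inv (P \<epsilon> s) ** (mat (s\<^sup>2) ** B s)"
proof -
  have "matrix_inv (K_dyn c\<^sub>0 \<omega> C (z \<epsilon>) \<epsilon> s) = matrix_inv (P \<epsilon> s) ** matrix_inv (matrix_inv (D_mat \<omega> s))"
    unfolding K_dyn_eq[OF D] by (rule matrix_inv_mult[OF det_matrix_inv[OF D] P])
  also have "matrix_inv (matrix_inv (D_mat \<omega> s)) = D_mat \<omega> s"
    by (rule matrix_inv_unique) (rule matrix_inv_inverse(2)[OF D])
  finally have K: "matrix_inv (K_dyn c\<^sub>0 \<omega> C (z \<epsilon>) \<epsilon> s) = matrix_inv (P \<epsilon> s) ** D_mat \<omega> s" .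
  have "H_mat c\<^sub>0 \<omega> C (z \<epsilon>) \<epsilon> B s = A_mat C \<epsilon> ** matrix_inv (P \<epsilon> s) ** (D_mat \<omega> s ** matrix_inv (D_mat \<omega> s)) ** (mat (s\<^sup>2) ** B s)"
    unfolding H_mat_def B_mat_def K by (simp only: matrix_mul_assoc)
  then show ?thesis by (simp add: matrix_inv_inverse(1)[OF D])
qed

lemma det_A_mat:
  assumes "\<epsilon> \<in> {0<..\<epsilon>\<^sub>1}"
  shows "det (A_mat C \<epsilon>) \<noteq> 0"
proof -
  have "det (A_mat C \<epsilon>) = (\<Prod>i\<in>UNIV. - complex_of_real (\<epsilon> * C i))"
    unfolding A_mat_def by (subst det_diagonal) auto
  then show ?thesis using assms C_pos by (auto simp: less_imp_neq[symmetric])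
qed

lemma input_holomorphic:
  fixes B :: "complex \<Rightarrow> complex ^ 'm ^ 'm"
  assumes "\<And>i j. (\<lambda>s. B s $ i $ j) analytic_on UNIV"
  shows "(\<lambda>s. (mat (s\<^sup>2) ** B s) $ i $ j) holomorphic_on UNIV"
  unfolding mat_mult_entry using analytic_imp_holomorphic[OF assms] by (intro holomorphic_intros)

lemma H_mat_meromorphic:
  fixes \<epsilon> :: real
  assumes B: "\<And>i j. (\<lambda>s. B s $ i $ j) analytic_on UNIV"
  defines "H \<equiv> H_mat c\<^sub>0 \<omega> C (z \<epsilon>) \<epsilon> B"
  shows "\<exists>F. (\<forall>s. invertible (D_mat \<omega> s) \<and> invertible (K_dyn c\<^sub>0 \<omega> C (z \<epsilon>) \<epsilon> s) \<longrightarrow> F s = H s) \<and>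
             (\<forall>i j. (\<lambda>s. F s $ i $ j) nicely_meromorphic_on UNIV) \<and>
             (\<forall>s. mat_pole F s \<longrightarrow> det (P \<epsilon> s) = 0)"
    and "(\<lambda>s. H s $ i $ j) meromorphic_on UNIV"
    and "{s. mat_pole H s} \<subseteq> {s. det (P \<epsilon> s) = 0}"
    and "{s. mat_pole H s} sparse_in UNIV"
proof -
  have D0: "det (D_mat \<omega> 0) \<noteq> 0" using detD_0 by (simp add: detD_def)
  note res = meromorphic_resolvent[where P = "P \<epsilon>" and D = "D_mat \<omega>" and H = H and X = "\<lambda>s. mat (s\<^sup>2) ** B s",
    OF P_entry_holomorphic det_P_0 input_holomorphic[OF B] D_entry_holomorphic D0 H_mat_eq[of _ \<epsilon> B, folded H_def]]
  have iff: "invertible (D_mat \<omega> s) \<and> invertible (K_dyn c\<^sub>0 \<omega> C (z \<epsilon>) \<epsilon> s) \<longleftrightarrow> det (D_mat \<omega> s) \<noteq> 0 \<and> det (P \<epsilon> s) \<noteq> 0" for s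
    using invertible_K_dyn_iff[of s \<epsilon>] by (auto simp: invertible_det_nz[of "D_mat \<omega> s"])
  show "\<exists>F. (\<forall>s. invertible (D_mat \<omega> s) \<and> invertible (K_dyn c\<^sub>0 \<omega> C (z \<epsilon>) \<epsilon> s) \<longrightarrow> F s = H s) \<and>
             (\<forall>i j. (\<lambda>s. F s $ i $ j) nicely_meromorphic_on UNIV) \<and>
             (\<forall>s. mat_pole F s \<longrightarrow> det (P \<epsilon> s) = 0)"
    unfolding iff by (rule res(1))
  show "(\<lambda>s. H s $ i $ j) meromorphic_on UNIV" by (rule res(2))
  show "{s. mat_pole H s} \<subseteq> {s. det (P \<epsilon> s) = 0}" by (rule res(3))
  show "{s. mat_pole H s} sparse_in UNIV" by (rule res(4))
qed

text \<open>The kernel is nontrivial and its dimension is bounded by the order 1, so both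
  multiplicities are 1.\<close>

lemma semisimple_if_simple:
  assumes "zorder (\<lambda>u. det (P \<epsilon> u)) a = 1"
  shows "semisimple_at (P \<epsilon>) a"
proof -
  let ?S = "{v. P \<epsilon> a *v v = 0}"
  have "det (P \<epsilon> a) = 0" using assms zorder_det_P_pos[of \<epsilon> a] by simp
  then obtain x where x: "x \<noteq> 0" "P \<epsilon> a *v x = 0" unfolding det_eq_0_iff_kernel by blast
  then have "\<not> ?S \<subseteq> {0}" by blast
  then have "vec.dim ?S \<noteq> 0" using vec.dim_eq_0[of ?S] by blast
  moreover have "int (vec.dim ?S) \<le> 1"
    using zorder_det_ge_kernel_dim[OF P_entry_holomorphic det_P_0, of \<epsilon> a] assms by simp
  ultimately show ?thesis unfolding semisimple_at_def assms by linarith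
qed

text \<open>The effective input is \<open>s\<^sup>2 B s\<close>, so \<open>a \<noteq> 0\<close>
  turns \<open>w B \<noteq> 0\<close> into the condition under which the residue is nonzero.\<close>

lemma residue_expansion:
  assumes \<epsilon>: "\<epsilon> \<in> {0<..\<epsilon>\<^sub>1}" and B: "\<And>i j. (\<lambda>s. B s $ i $ j) analytic_on UNIV"
    and a: "a \<noteq> 0" and ss: "semisimple_at (P \<epsilon>) a" and na: "not_annihilated (A_mat C \<epsilon>) (P \<epsilon> a) (B a)"
  obtains U R Hreg where "open U" "a \<in> U" "R \<noteq> 0" "\<And>i j. (\<lambda>u. Hreg u $ i $ j) analytic_on U"
    "bounded (Hreg ` U)" "\<And>u. u \<in> U - {a} \<Longrightarrow> H_mat c\<^sub>0 \<omega> C (z \<epsilon>) \<epsilon> B u = mat (1 / (u - a)) ** R + Hreg u"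
proof -
  obtain w where w: "w v* P \<epsilon> a = 0" "w v* B a \<noteq> 0" using na unfolding not_annihilated_def by blast
  have wX: "w v* (mat (a\<^sup>2) ** B a) \<noteq> 0"
  proof -
    have "(w v* (mat (a\<^sup>2) ** B a)) $ j = a\<^sup>2 * (w v* B a) $ j" for j
      unfolding vector_matrix_mult_entry mat_mult_entry by (simp add: sum_distrib_left mult_ac)
    then show ?thesis using w(2) a by (auto simp: vec_eq_iff)
  qed
  have "\<forall>\<^sub>F s in at a. detD s \<noteq> 0"
    by (rule eventually_nonzero_entire[OF detD_holomorphic detD_0])
  \<comment> \<open>The resolvent formula for \<open>H\<close> holds where \<open>D\<close> is
    invertible; \<open>r0\<close> bounds a punctured disc free of zeros of \<open>det D\<close>,
    even if \<open>a\<close> is one of them.\<close>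
  then obtain r0 where r0: "0 < r0" "\<And>s. s \<noteq> a \<Longrightarrow> dist s a < r0 \<Longrightarrow> det (D_mat \<omega> s) \<noteq> 0"
    unfolding eventually_at detD_def by blast
  obtain R Hreg \<rho> where E: "0 < \<rho>" "\<rho> \<le> r0" "R \<noteq> 0"
    "\<And>i j. (\<lambda>u. Hreg u $ i $ j) analytic_on ball a \<rho>" "bounded (Hreg ` ball a \<rho>)"
    "\<And>u. u \<in> ball a \<rho> - {a} \<Longrightarrow> det (P \<epsilon> u) \<noteq> 0"
    "\<And>u. u \<in> ball a \<rho> - {a} \<Longrightarrow> A_mat C \<epsilon> ** matrix_inv (P \<epsilon> u) ** (mat (u\<^sup>2) ** B u) = mat (1 / (u - a)) ** R + Hreg u"
    by (rule simple_pole_expansion[OF P_entry_holomorphic det_P_0 ss[unfolded semisimple_at_def]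
      input_holomorphic[OF B] det_A_mat[OF \<epsilon>] w(1) wX r0(1)]) blast
  have "H_mat c\<^sub>0 \<omega> C (z \<epsilon>) \<epsilon> B u = mat (1 / (u - a)) ** R + Hreg u" if u: "u \<in> ball a \<rho> - {a}" for u
  proof -
    have "det (D_mat \<omega> u) \<noteq> 0" using u E(2) by (intro r0(2)) (auto simp: dist_commute)
    from H_mat_eq[OF this E(6)[OF u], of B] show ?thesis unfolding E(7)[OF u] .
  qed
  then show ?thesis
    using that[OF open_ball _ E(3) E(4) E(5)] E(1) by simp
qed

text \<open>The factor 1/2 in the definition makes the second inequality strict, which leaves room
  for the error of order \<eta>.\<close>

lemma detuning_gap:
  assumes "\<alpha> \<noteq> \<beta>"
  shows "0 < detuning_gap \<omega>\<^sub>c" "detuning_gap \<omega>\<^sub>c < \<bar>\<omega>\<^sub>c \<alpha> - \<omega>\<^sub>c \<beta>\<bar>"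
proof -
  let ?S = "{\<bar>\<omega>\<^sub>c \<alpha> - \<omega>\<^sub>c \<beta>\<bar> | \<alpha> \<beta>. \<omega>\<^sub>c \<beta> \<noteq> \<omega>\<^sub>c \<alpha>}"
  have "?S \<subseteq> (\<lambda>(\<alpha>, \<beta>). \<bar>\<omega>\<^sub>c \<alpha> - \<omega>\<^sub>c \<beta>\<bar>) ` UNIV" by auto
  then have fin: "finite ?S" by (rule finite_subset) simp
  have mem: "\<bar>\<omega>\<^sub>c \<alpha> - \<omega>\<^sub>c \<beta>\<bar> \<in> ?S" using assms inj_\<omega> by (auto simp: inj_eq)
  then have "Min ?S \<in> ?S" using fin by (intro Min_in) auto
  then have pos: "0 < Min ?S" by auto
  then show "0 < detuning_gap \<omega>\<^sub>c" by (simp add: detuning_gap_def)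
  have "Min ?S \<le> \<bar>\<omega>\<^sub>c \<alpha> - \<omega>\<^sub>c \<beta>\<bar>" by (rule Min_le[OF fin mem])
  then show "detuning_gap \<omega>\<^sub>c < \<bar>\<omega>\<^sub>c \<alpha> - \<omega>\<^sub>c \<beta>\<bar>" using pos by (simp add: detuning_gap_def)
qed

text \<open>The constant is the uniform bound of the shift plus 1, the latter for the vanishing
  error.\<close>

lemma leading_order_close:
  assumes "leading_order \<alpha> a"
  obtains B where "\<forall>\<^sub>F \<epsilon> in at_right 0. cmod (a \<epsilon> - center \<alpha>) \<le> B * \<eta> \<epsilon>"
proof -
  define B where "B = \<omega>\<^sub>c \<alpha> ^ 3 * (real CARD('m) * K\<^sub>m\<^sub>a\<^sub>x)"
  have "\<forall>\<^sub>F \<epsilon> in at_right 0. dist ((a \<epsilon> - center \<alpha>) / of_real (\<eta> \<epsilon>) - shift \<alpha> (lam \<alpha> \<epsilon>)) 0 < 1"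
    using assms unfolding leading_order_def by (rule tendstoD) simp
  with eventually_in_range have "\<forall>\<^sub>F \<epsilon> in at_right 0. cmod (a \<epsilon> - center \<alpha>) \<le> (B + 1) * \<eta> \<epsilon>"
  proof eventually_elim
    case (elim \<epsilon>)
    have \<eta>: "0 < \<eta> \<epsilon>" using \<eta>_pos[OF elim(1)] .
    have "cmod ((a \<epsilon> - center \<alpha>) / of_real (\<eta> \<epsilon>)) \<le> cmod ((a \<epsilon> - center \<alpha>) / of_real (\<eta> \<epsilon>) - shift \<alpha> (lam \<alpha> \<epsilon>)) + cmod (shift \<alpha> (lam \<alpha> \<epsilon>))"
      using norm_triangle_sub[of "(a \<epsilon> - center \<alpha>) / of_real (\<eta> \<epsilon>)" "shift \<alpha> (lam \<alpha> \<epsilon>)"] by (simp only: add.commute)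
    also have "\<dots> \<le> 1 + B"
      using elim(2) shift_bound[OF elim(1), of \<alpha>] by (intro add_mono) (auto simp: B_def)
    finally show ?case using \<eta> by (simp add: norm_divide divide_le_eq add.commute)
  qed
  then show ?thesis by (rule that)
qed

lemma leading_order_tendsto_center:
  assumes "leading_order \<alpha> a"
  shows "(a \<longlongrightarrow> center \<alpha>) (at_right 0)"
proof -
  obtain B where B: "\<forall>\<^sub>F \<epsilon> in at_right 0. cmod (a \<epsilon> - center \<alpha>) \<le> B * \<eta> \<epsilon>"
    using leading_order_close[OF assms] .
  have "((\<lambda>\<epsilon>. a \<epsilon> - center \<alpha>) \<longlongrightarrow> 0) (at_right 0)"
    by (rule tendsto_norm_zero_cancel, rule tendsto_sandwich[OF _ B tendsto_const tendsto_mult_right_zero[OF \<eta>_tendsto]]) simp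
  then show ?thesis using LIM_zero_iff by blast
qed

text \<open>\<open>eventually\<close> provides an interval open at \<open>b\<close>, while
  thresholds are included in their interval; hence \<open>b / 2\<close>.\<close>

lemma eventually_threshold:
  assumes "\<forall>\<^sub>F \<epsilon> in at_right 0. Q \<epsilon>"
  shows "\<exists>\<epsilon>\<^sub>0. 0 < \<epsilon>\<^sub>0 \<and> \<epsilon>\<^sub>0 \<le> \<epsilon>\<^sub>1 \<and> (\<forall>\<epsilon>\<in>{0<..\<epsilon>\<^sub>0}. Q \<epsilon>)"
proof -
  obtain b where b: "0 < b" "\<And>y. 0 < y \<Longrightarrow> y < b \<Longrightarrow> Q y"
    using assms unfolding eventually_at_right_field by blast
  show ?thesis
    by (rule exI[of _ "min \<epsilon>\<^sub>1 (b / 2)"]) (use b \<epsilon>\<^sub>1 in auto)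
qed

lemma leading_order_separation:
  assumes a: "leading_order \<alpha> a" and b: "leading_order \<beta> b"
  shows "(\<lambda>\<epsilon>. cmod (a \<epsilon> - b \<epsilon>) - \<bar>\<omega>\<^sub>c \<alpha> - \<omega>\<^sub>c \<beta>\<bar>) \<in> O[at_right 0](\<lambda>\<epsilon>. \<epsilon> powr (1 - p))"
    and "((\<lambda>\<epsilon>. cmod (a \<epsilon> - b \<epsilon>)) \<longlongrightarrow> \<bar>\<omega>\<^sub>c \<alpha> - \<omega>\<^sub>c \<beta>\<bar>) (at_right 0)"
proof -
  have dist: "cmod (center \<alpha> - center \<beta>) = \<bar>\<omega>\<^sub>c \<alpha> - \<omega>\<^sub>c \<beta>\<bar>"
    using dist_center unfolding dist_norm .
  obtain B1 where B1: "\<forall>\<^sub>F \<epsilon> in at_right 0. cmod (a \<epsilon> - center \<alpha>) \<le> B1 * \<eta> \<epsilon>"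
    using leading_order_close[OF a] .
  obtain B2 where B2: "\<forall>\<^sub>F \<epsilon> in at_right 0. cmod (b \<epsilon> - center \<beta>) \<le> B2 * \<eta> \<epsilon>"
    using leading_order_close[OF b] .
  show "(\<lambda>\<epsilon>. cmod (a \<epsilon> - b \<epsilon>) - \<bar>\<omega>\<^sub>c \<alpha> - \<omega>\<^sub>c \<beta>\<bar>) \<in> O[at_right 0](\<lambda>\<epsilon>. \<epsilon> powr (1 - p))"
  proof (rule bigoI[of _ "B1 + B2"])
    show "\<forall>\<^sub>F \<epsilon> in at_right 0. norm (cmod (a \<epsilon> - b \<epsilon>) - \<bar>\<omega>\<^sub>c \<alpha> - \<omega>\<^sub>c \<beta>\<bar>) \<le> (B1 + B2) * norm (\<epsilon> powr (1 - p))"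
      using B1 B2
    proof eventually_elim
      case (elim \<epsilon>)
      have "\<bar>cmod (a \<epsilon> - b \<epsilon>) - cmod (center \<alpha> - center \<beta>)\<bar> \<le> cmod ((a \<epsilon> - b \<epsilon>) - (center \<alpha> - center \<beta>))"
        by (rule norm_triangle_ineq3)
      also have "(a \<epsilon> - b \<epsilon>) - (center \<alpha> - center \<beta>) = (a \<epsilon> - center \<alpha>) - (b \<epsilon> - center \<beta>)" by simp
      also have "cmod \<dots> \<le> cmod (a \<epsilon> - center \<alpha>) + cmod (b \<epsilon> - center \<beta>)" by (rule norm_triangle_ineq4)
      also have "\<dots> \<le> B1 * \<eta> \<epsilon> + B2 * \<eta> \<epsilon>" using elim by (rule add_mono)
      finally show ?case unfolding dist by (simp add: \<eta>_def distrib_right)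
    qed
  qed
  have "((\<lambda>\<epsilon>. cmod (a \<epsilon> - b \<epsilon>)) \<longlongrightarrow> cmod (center \<alpha> - center \<beta>)) (at_right 0)"
    by (intro tendsto_intros leading_order_tendsto_center a b)
  then show "((\<lambda>\<epsilon>. cmod (a \<epsilon> - b \<epsilon>)) \<longlongrightarrow> \<bar>\<omega>\<^sub>c \<alpha> - \<omega>\<^sub>c \<beta>\<bar>) (at_right 0)"
    unfolding dist .
qed

text \<open>The index \<open>m\<close> is counted in its own fibre, so the order at
  \<open>f m\<close> is positive. The point 0 is excluded because the radius of the disc is smaller
  than the modulus of its centre.\<close>

lemma enumeration_zero:
  assumes "is_enumeration \<alpha> \<epsilon> f" "m \<in> {1..card (cluster_of \<alpha>)}"
  shows "det (P \<epsilon> (f m)) = 0" "f m \<noteq> 0"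
proof -
  have m: "f m \<in> ball (center \<alpha>) r" using assms unfolding is_enumeration_def by blast
  have "{m' \<in> {1..card (cluster_of \<alpha>)}. f m' = f m} \<noteq> {}" using assms(2) by blast
  then have "0 < card {m' \<in> {1..card (cluster_of \<alpha>)}. f m' = f m}" by (simp add: card_gt_0_iff)
  moreover have "int (card {m' \<in> {1..card (cluster_of \<alpha>)}. f m' = f m}) = zorder (\<lambda>u. det (P \<epsilon> u)) (f m)"
    using assms(1) m unfolding is_enumeration_def by blast
  ultimately show "det (P \<epsilon> (f m)) = 0" unfolding zorder_det_P_pos by linarith
  show "f m \<noteq> 0"
  proof
    assume "f m = 0"
    then have "\<omega>\<^sub>c \<alpha> < r" using m \<omega>c_pos[of \<alpha>] by (simp add: norm_mult)
    then show False using r_less[of \<alpha>] by simp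
  qed
qed

lemma one_in_cluster_range: "1 \<in> {1..card (cluster_of \<alpha>)}"
  using cluster_nonempty[of \<alpha>] by (simp add: Suc_le_eq card_gt_0_iff)

text \<open>The gap is stated against zeros of \<open>det P\<close>; it covers the poles of the
  transfer matrix because every pole is such a zero.\<close>

lemma principal_eventually:
  assumes \<sigma>: "0 < \<sigma>\<^sub>0" and s: "cluster_resonances p c\<^sub>0 cl \<omega> \<omega>\<^sub>c C z r s"
  shows "\<exists>g>0. \<forall>\<^sub>F \<epsilon> in at_right 0. s \<epsilon> \<alpha> 1 \<in> half_plane \<sigma>\<^sub>0 \<and> det (P \<epsilon> (s \<epsilon> \<alpha> 1)) = 0 \<and>
     zorder (\<lambda>u. det (P \<epsilon> u)) (s \<epsilon> \<alpha> 1) = 1 \<and> (2 \<le> card (cluster_of \<alpha>) \<longrightarrow> Re (s \<epsilon> \<alpha> 1) < 0) \<and>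
     0 < Im (s \<epsilon> \<alpha> 1) \<and> (\<forall>b. det (P \<epsilon> b) = 0 \<and> b \<noteq> s \<epsilon> \<alpha> 1 \<longrightarrow> g * \<eta> \<epsilon> \<le> dist (s \<epsilon> \<alpha> 1) b)"
proof -
  define a where "a = (\<lambda>\<epsilon>. s \<epsilon> \<alpha> 1)"
  have lo: "leading_order \<alpha> a" and en: "\<forall>\<^sub>F \<epsilon> in at_right 0. \<forall>\<alpha>. is_enumeration \<alpha> \<epsilon> (s \<epsilon> \<alpha>)"
    using s unfolding cluster_resonances_iff a_def by auto
  have zero: "\<forall>\<^sub>F \<epsilon> in at_right 0. det (P \<epsilon> (a \<epsilon>)) = 0"
    using en
  proof eventually_elim
    case (elim \<epsilon>)
    then show ?case unfolding a_def using enumeration_zero(1)[OF _ one_in_cluster_range] by blast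
  qed
  note lim = leading_order_tendsto_center[OF lo]
  have re: "\<forall>\<^sub>F \<epsilon> in at_right 0. - \<sigma>\<^sub>0 < Re (a \<epsilon>)"
    using order_tendstoD(1)[OF tendsto_Re[OF lim], of "- \<sigma>\<^sub>0"] \<sigma> by simp
  have im: "\<forall>\<^sub>F \<epsilon> in at_right 0. 0 < Im (a \<epsilon>)"
    using order_tendstoD(1)[OF tendsto_Im[OF lim], of 0] \<omega>c_pos[of \<alpha>] by simp
  have damped: "\<forall>\<^sub>F \<epsilon> in at_right 0. det (P \<epsilon> (a \<epsilon>)) = 0 \<longrightarrow> 2 \<le> card (cluster_of \<alpha>) \<longrightarrow> Re (a \<epsilon>) < 0"
  proof (cases "2 \<le> card (cluster_of \<alpha>)")
    case True
    show ?thesis using eventually_damped[OF lo True] by eventually_elim blast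
  qed simp
  obtain g where g: "0 < g" "\<forall>\<^sub>F \<epsilon> in at_right 0. det (P \<epsilon> (a \<epsilon>)) = 0 \<longrightarrow>
    (\<forall>b. det (P \<epsilon> b) = 0 \<and> b \<noteq> a \<epsilon> \<longrightarrow> g * \<eta> \<epsilon> \<le> dist (a \<epsilon>) b)"
    using eventually_gap[OF lo] by blast
  have "\<forall>\<^sub>F \<epsilon> in at_right 0. a \<epsilon> \<in> half_plane \<sigma>\<^sub>0 \<and> det (P \<epsilon> (a \<epsilon>)) = 0 \<and>
     zorder (\<lambda>u. det (P \<epsilon> u)) (a \<epsilon>) = 1 \<and> (2 \<le> card (cluster_of \<alpha>) \<longrightarrow> Re (a \<epsilon>) < 0) \<and>
     0 < Im (a \<epsilon>) \<and> (\<forall>b. det (P \<epsilon> b) = 0 \<and> b \<noteq> a \<epsilon> \<longrightarrow> g * \<eta> \<epsilon> \<le> dist (a \<epsilon>) b)"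
    using zero re im damped g(2) eventually_simple_zero[OF lo]
    by eventually_elim (simp add: half_plane_def)
  then show ?thesis using g(1) unfolding a_def by blast
qed

end

theorem proposition2p1:
  fixes p c\<^sub>0 \<sigma>\<^sub>0 \<epsilon>\<^sub>1 c\<^sub>1 c\<^sub>2 D\<^sub>m\<^sub>i\<^sub>n D\<^sub>m\<^sub>a\<^sub>x r :: real
    and cl :: "'m::finite \<Rightarrow> 'n::finite"
    and \<omega> C :: "'m \<Rightarrow> real"
    and \<omega>\<^sub>c :: "'n \<Rightarrow> real"
    and z :: "real \<Rightarrow> 'm \<Rightarrow> real ^ 3"
    and B\<^sub>i\<^sub>n :: "real \<Rightarrow> complex \<Rightarrow> complex ^ 'm ^ 'm"
    and P H :: "real \<Rightarrow> complex \<Rightarrow> complex ^ 'm ^ 'm"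
  assumes "0 < p" "p < 1" "0 < c\<^sub>0" "0 < \<sigma>\<^sub>0" "0 < \<epsilon>\<^sub>1"
    and "0 < c\<^sub>1" "0 < c\<^sub>2" "0 < D\<^sub>m\<^sub>i\<^sub>n" "0 < D\<^sub>m\<^sub>a\<^sub>x"
    and "surj cl"
    and "\<And>i. 0 < \<omega> i" and "\<And>i. \<omega> i = \<omega>\<^sub>c (cl i)" and "inj \<omega>\<^sub>c"
    and "dual_scale_geometry p \<epsilon>\<^sub>1 c\<^sub>1 c\<^sub>2 D\<^sub>m\<^sub>i\<^sub>n D\<^sub>m\<^sub>a\<^sub>x cl z"
    and "\<And>i. 0 < C i"
    and "\<And>\<epsilon> i j. \<epsilon> \<in> {0<..\<epsilon>\<^sub>1} \<Longrightarrow> (\<lambda>s. B\<^sub>i\<^sub>n \<epsilon> s $ i $ j) analytic_on UNIV"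
    and "0 < r" and "\<And>\<alpha>. r < \<omega>\<^sub>c \<alpha>" and "\<And>\<alpha> \<beta>. \<alpha> \<noteq> \<beta> \<Longrightarrow> 2 * r \<le> \<bar>\<omega>\<^sub>c \<alpha> - \<omega>\<^sub>c \<beta>\<bar>"
    and P_eq: "\<And>\<epsilon>. P \<epsilon> = P_mat c\<^sub>0 \<omega> C (z \<epsilon>) \<epsilon>"
    and H_eq: "\<And>\<epsilon>. H \<epsilon> = H_mat c\<^sub>0 \<omega> C (z \<epsilon>) \<epsilon> (B\<^sub>i\<^sub>n \<epsilon>)"
  shows
    \<comment> \<open>(i), and discreteness of the set of poles in (ii)\<close>
    "(\<forall>\<epsilon>\<in>{0<..\<epsilon>\<^sub>1}.
        (\<exists>F. (\<forall>s. invertible (D_mat \<omega> s) \<and> invertible (K_dyn c\<^sub>0 \<omega> C (z \<epsilon>) \<epsilon> s) \<longrightarrow> F s = H \<epsilon> s) \<and>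
             (\<forall>i j. (\<lambda>s. F s $ i $ j) nicely_meromorphic_on UNIV) \<and>
             (\<forall>s. mat_pole F s \<longrightarrow> det (P \<epsilon> s) = 0)) \<and>
        (\<forall>i j. (\<lambda>s. H \<epsilon> s $ i $ j) meromorphic_on half_plane \<sigma>\<^sub>0) \<and>
        {s. mat_pole (H \<epsilon>) s} \<subseteq> {s. det (P \<epsilon> s) = 0} \<and>
        {s \<in> half_plane \<sigma>\<^sub>0. mat_pole (H \<epsilon>) s} sparse_in half_plane \<sigma>\<^sub>0) \<and>
     (\<exists>s. cluster_resonances p c\<^sub>0 cl \<omega> \<omega>\<^sub>c C z r s) \<and>
     (\<forall>s. cluster_resonances p c\<^sub>0 cl \<omega> \<omega>\<^sub>c C z r s \<longrightarrow>
        \<comment> \<open>(ii)\<close>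
        (\<exists>\<epsilon>\<^sub>0 g\<^sub>0. 0 < \<epsilon>\<^sub>0 \<and> \<epsilon>\<^sub>0 \<le> \<epsilon>\<^sub>1 \<and> 0 < g\<^sub>0 \<and>
          (\<forall>\<epsilon>\<in>{0<..\<epsilon>\<^sub>0}. \<forall>\<alpha>.
             s \<epsilon> \<alpha> 1 \<in> half_plane \<sigma>\<^sub>0 \<and>
             det (P \<epsilon> (s \<epsilon> \<alpha> 1)) = 0 \<and> zorder (\<lambda>u. det (P \<epsilon> u)) (s \<epsilon> \<alpha> 1) = 1 \<and>
             (not_annihilated (A_mat C \<epsilon>) (P \<epsilon> (s \<epsilon> \<alpha> 1)) (B\<^sub>i\<^sub>n \<epsilon> (s \<epsilon> \<alpha> 1)) \<longrightarrow>
                mat_simple_pole (H \<epsilon>) (s \<epsilon> \<alpha> 1)) \<and>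
             (2 \<le> card (cluster cl \<alpha>) \<longrightarrow> Re (s \<epsilon> \<alpha> 1) < 0) \<and> 0 < Im (s \<epsilon> \<alpha> 1) \<and>
             (\<forall>q\<in>{q \<in> half_plane \<sigma>\<^sub>0. mat_pole (H \<epsilon>) q} - {s \<epsilon> \<alpha> 1}.
                g\<^sub>0 * \<epsilon> powr (1 - p) \<le> dist (s \<epsilon> \<alpha> 1) q)) \<and>
          (\<forall>\<alpha> \<beta>. \<alpha> \<noteq> \<beta> \<longrightarrow>
             (\<lambda>\<epsilon>. cmod (s \<epsilon> \<alpha> 1 - s \<epsilon> \<beta> 1) - \<bar>\<omega>\<^sub>c \<alpha> - \<omega>\<^sub>c \<beta>\<bar>)
               \<in> O[at_right 0](\<lambda>\<epsilon>. \<epsilon> powr (1 - p)) \<and>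
             0 < detuning_gap \<omega>\<^sub>c \<and>
             (\<forall>\<epsilon>\<in>{0<..\<epsilon>\<^sub>0}. detuning_gap \<omega>\<^sub>c \<le> cmod (s \<epsilon> \<alpha> 1 - s \<epsilon> \<beta> 1)))) \<and>
        \<comment> \<open>(iii)\<close>
        (\<exists>\<epsilon>\<^sub>0. 0 < \<epsilon>\<^sub>0 \<and> \<epsilon>\<^sub>0 \<le> \<epsilon>\<^sub>1 \<and>
          (\<forall>\<epsilon>\<in>{0<..\<epsilon>\<^sub>0}. \<forall>\<alpha>. \<forall>m\<in>{1..card (cluster cl \<alpha>)}.
             (m = 1 \<or> semisimple_at (P \<epsilon>) (s \<epsilon> \<alpha> m)) \<and>
             not_annihilated (A_mat C \<epsilon>) (P \<epsilon> (s \<epsilon> \<alpha> m)) (B\<^sub>i\<^sub>n \<epsilon> (s \<epsilon> \<alpha> m)) \<longrightarrow>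
             (\<exists>U R H\<^sub>r\<^sub>e\<^sub>g. open U \<and> s \<epsilon> \<alpha> m \<in> U \<and> R \<noteq> 0 \<and>
                (\<forall>i j. (\<lambda>u. H\<^sub>r\<^sub>e\<^sub>g u $ i $ j) analytic_on U) \<and> bounded (H\<^sub>r\<^sub>e\<^sub>g ` U) \<and>
                (\<forall>u\<in>U - {s \<epsilon> \<alpha> m}. H \<epsilon> u = mat (1 / (u - s \<epsilon> \<alpha> m)) ** R + H\<^sub>r\<^sub>e\<^sub>g u)))))"
proof -
  interpret bubble_clusters p c\<^sub>0 \<epsilon>\<^sub>1 c\<^sub>1 c\<^sub>2 D\<^sub>m\<^sub>i\<^sub>n D\<^sub>m\<^sub>a\<^sub>x r cl \<omega> C \<omega>\<^sub>c z
    by unfold_locales (use assms in auto)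
  \<comment> \<open>The variable \<open>P\<close> fixed by the theorem hides the locale constant of
    the same name; \<open>?Q\<close> refers to the latter, and \<open>PQ\<close> identifies the
    two.\<close>
  let ?Q = "bubble_clusters.P c\<^sub>0 \<omega> C z"
  have PQ: "P \<epsilon> = ?Q \<epsilon>" for \<epsilon>
    by (simp add: P_eq P_def)
  have B: "(\<lambda>s. B\<^sub>i\<^sub>n \<epsilon> s $ i $ j) analytic_on UNIV" if "\<epsilon> \<in> {0<..\<epsilon>\<^sub>1}" for \<epsilon> i j
    using assms(16) that .
  note H = H_mat_meromorphic[of "B\<^sub>i\<^sub>n \<epsilon>" \<epsilon> for \<epsilon>, OF B, folded H_eq PQ]
  let "?i \<and> ?ex \<and> (\<forall>s. ?res s \<longrightarrow> ?ii s \<and> ?iii s)" = ?thesis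
  have part_i: ?i
  proof (intro ballI conjI allI)
    fix \<epsilon> i j assume \<epsilon>: "\<epsilon> \<in> {0<..\<epsilon>\<^sub>1}"
    show "(\<lambda>s. H \<epsilon> s $ i $ j) meromorphic_on half_plane \<sigma>\<^sub>0"
      by (rule meromorphic_on_subset[OF H(2)[OF \<epsilon>]]) simp
    have "{s. mat_pole (H \<epsilon>) s} sparse_in half_plane \<sigma>\<^sub>0"
      by (rule sparse_in_subset[OF H(4)[OF \<epsilon>]]) simp
    then show "{s \<in> half_plane \<sigma>\<^sub>0. mat_pole (H \<epsilon>) s} sparse_in half_plane \<sigma>\<^sub>0"
      by (rule sparse_in_subset2) auto
  qed (use H(1,3) in blast)+
  have expansion: "\<exists>U R H\<^sub>r\<^sub>e\<^sub>g. open U \<and> a \<in> U \<and> R \<noteq> 0 \<and>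
       (\<forall>i j. (\<lambda>u. H\<^sub>r\<^sub>e\<^sub>g u $ i $ j) analytic_on U) \<and> bounded (H\<^sub>r\<^sub>e\<^sub>g ` U) \<and>
       (\<forall>u\<in>U - {a}. H \<epsilon> u = mat (1 / (u - a)) ** R + H\<^sub>r\<^sub>e\<^sub>g u)"
    if prem: "\<epsilon> \<in> {0<..\<epsilon>\<^sub>1}" "a \<noteq> 0" "semisimple_at (P \<epsilon>) a" "not_annihilated (A_mat C \<epsilon>) (P \<epsilon> a) (B\<^sub>i\<^sub>n \<epsilon> a)" for \<epsilon> a
  proof -
    obtain U R Hreg where "open U" "a \<in> U" "R \<noteq> 0" "\<And>i j. (\<lambda>u. Hreg u $ i $ j) analytic_on U"
      "bounded (Hreg ` U)" "\<And>u. u \<in> U - {a} \<Longrightarrow> H_mat c\<^sub>0 \<omega> C (z \<epsilon>) \<epsilon> (B\<^sub>i\<^sub>n \<epsilon>) u = mat (1 / (u - a)) ** R + Hreg u"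
      by (rule residue_expansion[OF prem(1) B[OF prem(1)] prem(2) prem(3,4)[unfolded PQ]]) blast
    then show ?thesis unfolding H_eq by blast
  qed
  have simple: "mat_simple_pole (H \<epsilon>) a"
    if prem: "\<epsilon> \<in> {0<..\<epsilon>\<^sub>1}" "a \<noteq> 0" "semisimple_at (P \<epsilon>) a" "not_annihilated (A_mat C \<epsilon>) (P \<epsilon> a) (B\<^sub>i\<^sub>n \<epsilon> a)" for \<epsilon> a
  proof -
    obtain U R H\<^sub>r\<^sub>e\<^sub>g where E: "open U \<and> a \<in> U \<and> R \<noteq> 0 \<and>
       (\<forall>i j. (\<lambda>u. H\<^sub>r\<^sub>e\<^sub>g u $ i $ j) analytic_on U) \<and> bounded (H\<^sub>r\<^sub>e\<^sub>g ` U) \<and>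
       (\<forall>u\<in>U - {a}. H \<epsilon> u = mat (1 / (u - a)) ** R + H\<^sub>r\<^sub>e\<^sub>g u)"
      using expansion[OF prem] by blast
    show ?thesis
      by (rule mat_simple_pole_expansion[of U a R "H\<^sub>r\<^sub>e\<^sub>g"]) (use E in auto)
  qed
  have part_ii: "?ii s" if s: "cluster_resonances p c\<^sub>0 cl \<omega> \<omega>\<^sub>c C z r s" for s
  proof -
    have lo: "leading_order \<alpha> (\<lambda>\<epsilon>. s \<epsilon> \<alpha> 1)" for \<alpha>
      using s unfolding cluster_resonances_iff by blast
    define good where "good = (\<lambda>g \<alpha> \<epsilon>. s \<epsilon> \<alpha> 1 \<in> half_plane \<sigma>\<^sub>0 \<and> det (?Q \<epsilon> (s \<epsilon> \<alpha> 1)) = 0 \<and>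
       zorder (\<lambda>u. det (?Q \<epsilon> u)) (s \<epsilon> \<alpha> 1) = 1 \<and> (2 \<le> card (cluster cl \<alpha>) \<longrightarrow> Re (s \<epsilon> \<alpha> 1) < 0) \<and>
       0 < Im (s \<epsilon> \<alpha> 1) \<and> (\<forall>b. det (?Q \<epsilon> b) = 0 \<and> b \<noteq> s \<epsilon> \<alpha> 1 \<longrightarrow> g * \<eta> \<epsilon> \<le> dist (s \<epsilon> \<alpha> 1) b))"
    have "\<exists>g>0. \<forall>\<^sub>F \<epsilon> in at_right 0. good g \<alpha> \<epsilon>" for \<alpha>
      unfolding good_def by (rule principal_eventually[OF assms(4) s])
    then obtain g where g: "\<And>\<alpha>. 0 < g \<alpha>" "\<And>\<alpha>. \<forall>\<^sub>F \<epsilon> in at_right 0. good (g \<alpha>) \<alpha> \<epsilon>" by metis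
    define g\<^sub>0 where "g\<^sub>0 = Min (range g)"
    \<comment> \<open>There are finitely many clusters, so the minimum of their gap constants is
      positive and serves all of them.\<close>
    have g0: "0 < g\<^sub>0" "g\<^sub>0 \<le> g \<alpha>" for \<alpha> using g(1) by (auto simp: g\<^sub>0_def)
    have sep: "\<forall>\<^sub>F \<epsilon> in at_right 0. \<alpha> \<noteq> \<beta> \<longrightarrow> detuning_gap \<omega>\<^sub>c \<le> cmod (s \<epsilon> \<alpha> 1 - s \<epsilon> \<beta> 1)" for \<alpha> \<beta>
    proof (cases "\<alpha> = \<beta>")
      case False
      have "\<forall>\<^sub>F \<epsilon> in at_right 0. detuning_gap \<omega>\<^sub>c < cmod (s \<epsilon> \<alpha> 1 - s \<epsilon> \<beta> 1)"
        by (rule order_tendstoD(1)[OF leading_order_separation(2)[OF lo lo] detuning_gap(2)[OF False]])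
      then show ?thesis by eventually_elim simp
    qed simp
    define Q where "Q = (\<lambda>\<epsilon>. (\<forall>\<alpha>. good (g \<alpha>) \<alpha> \<epsilon>) \<and> (\<forall>\<alpha> \<beta>. \<alpha> \<noteq> \<beta> \<longrightarrow> detuning_gap \<omega>\<^sub>c \<le> cmod (s \<epsilon> \<alpha> 1 - s \<epsilon> \<beta> 1)))"
    have "\<forall>\<^sub>F \<epsilon> in at_right 0. Q \<epsilon>"
      unfolding Q_def by (intro eventually_conj eventually_all_finite g(2) sep)
    from eventually_threshold[OF this]
    obtain \<epsilon>\<^sub>0 where \<epsilon>\<^sub>0': "0 < \<epsilon>\<^sub>0" "\<epsilon>\<^sub>0 \<le> \<epsilon>\<^sub>1" "\<forall>\<epsilon>\<in>{0<..\<epsilon>\<^sub>0}. Q \<epsilon>"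
      by blast
    note \<epsilon>\<^sub>0 = \<epsilon>\<^sub>0'(1,2) bspec[OF \<epsilon>\<^sub>0'(3), unfolded Q_def]
    have pole_simple: "mat_simple_pole (H \<epsilon>) (s \<epsilon> \<alpha> 1)"
      if "\<epsilon> \<in> {0<..\<epsilon>\<^sub>0}" "not_annihilated (A_mat C \<epsilon>) (P \<epsilon> (s \<epsilon> \<alpha> 1)) (B\<^sub>i\<^sub>n \<epsilon> (s \<epsilon> \<alpha> 1))" for \<epsilon> \<alpha>
    proof (rule simple[OF _ _ _ that(2)])
      have good: "good (g \<alpha>) \<alpha> \<epsilon>" using \<epsilon>\<^sub>0(3)[OF that(1)] by blast
      show "\<epsilon> \<in> {0<..\<epsilon>\<^sub>1}" using that(1) \<epsilon>\<^sub>0(2) by auto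
      show "s \<epsilon> \<alpha> 1 \<noteq> 0" using good unfolding good_def by auto
      show "semisimple_at (P \<epsilon>) (s \<epsilon> \<alpha> 1)"
        unfolding PQ using good unfolding good_def by (intro semisimple_if_simple) blast
    qed
    have pole_gap: "g\<^sub>0 * \<epsilon> powr (1 - p) \<le> dist (s \<epsilon> \<alpha> 1) q"
      if "\<epsilon> \<in> {0<..\<epsilon>\<^sub>0}" "mat_pole (H \<epsilon>) q" "q \<noteq> s \<epsilon> \<alpha> 1" for \<epsilon> \<alpha> q
    proof -
      have \<epsilon>: "\<epsilon> \<in> {0<..\<epsilon>\<^sub>1}" using that(1) \<epsilon>\<^sub>0(2) by auto
      have "det (?Q \<epsilon> q) = 0" using H(3)[OF \<epsilon>] that(2) unfolding PQ by blast
      then have "g \<alpha> * \<eta> \<epsilon> \<le> dist (s \<epsilon> \<alpha> 1) q"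
        using \<epsilon>\<^sub>0(3)[OF that(1)] that(3) unfolding good_def by blast
      moreover have "g\<^sub>0 * \<eta> \<epsilon> \<le> g \<alpha> * \<eta> \<epsilon>"
        using g0(2) \<eta>_pos[OF \<epsilon>] by (simp add: mult_right_mono)
      ultimately show ?thesis by (simp add: \<eta>_def)
    qed
    show ?thesis
    proof (rule exI[of _ \<epsilon>\<^sub>0], rule exI[of _ g\<^sub>0], intro conjI ballI allI impI)
      fix \<epsilon> \<alpha> assume \<epsilon>: "\<epsilon> \<in> {0<..\<epsilon>\<^sub>0}"
      have good: "good (g \<alpha>) \<alpha> \<epsilon>" using \<epsilon>\<^sub>0(3)[OF \<epsilon>] by blast
      show "s \<epsilon> \<alpha> 1 \<in> half_plane \<sigma>\<^sub>0" "det (P \<epsilon> (s \<epsilon> \<alpha> 1)) = 0" "zorder (\<lambda>u. det (P \<epsilon> u)) (s \<epsilon> \<alpha> 1) = 1"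
        "0 < Im (s \<epsilon> \<alpha> 1)"
        using good unfolding good_def PQ by blast+
      show "Re (s \<epsilon> \<alpha> 1) < 0" if "2 \<le> card (cluster cl \<alpha>)"
        using good that unfolding good_def by blast
      show "mat_simple_pole (H \<epsilon>) (s \<epsilon> \<alpha> 1)"
        if "not_annihilated (A_mat C \<epsilon>) (P \<epsilon> (s \<epsilon> \<alpha> 1)) (B\<^sub>i\<^sub>n \<epsilon> (s \<epsilon> \<alpha> 1))"
        using pole_simple[OF \<epsilon> that] .
      show "g\<^sub>0 * \<epsilon> powr (1 - p) \<le> dist (s \<epsilon> \<alpha> 1) q"
        if "q \<in> {q \<in> half_plane \<sigma>\<^sub>0. mat_pole (H \<epsilon>) q} - {s \<epsilon> \<alpha> 1}" for q
        using pole_gap[OF \<epsilon>] that by blast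
    next
      fix \<alpha> \<beta> :: 'n assume ne: "\<alpha> \<noteq> \<beta>"
      show "(\<lambda>\<epsilon>. cmod (s \<epsilon> \<alpha> 1 - s \<epsilon> \<beta> 1) - \<bar>\<omega>\<^sub>c \<alpha> - \<omega>\<^sub>c \<beta>\<bar>) \<in> O[at_right 0](\<lambda>\<epsilon>. \<epsilon> powr (1 - p))"
        by (rule leading_order_separation(1)[OF lo lo])
      show "0 < detuning_gap \<omega>\<^sub>c" by (rule detuning_gap(1)[OF ne])
      show "detuning_gap \<omega>\<^sub>c \<le> cmod (s \<epsilon> \<alpha> 1 - s \<epsilon> \<beta> 1)" if "\<epsilon> \<in> {0<..\<epsilon>\<^sub>0}" for \<epsilon>
        using \<epsilon>\<^sub>0(3)[OF that] ne by blast
    qed (use \<epsilon>\<^sub>0 g0 in auto)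
  qed
  have part_iii: "?iii s" if s: "cluster_resonances p c\<^sub>0 cl \<omega> \<omega>\<^sub>c C z r s" for s
  proof -
    have en: "\<forall>\<^sub>F \<epsilon> in at_right 0. \<forall>\<alpha>. is_enumeration \<alpha> \<epsilon> (s \<epsilon> \<alpha>)"
      and lo: "leading_order \<alpha> (\<lambda>\<epsilon>. s \<epsilon> \<alpha> 1)" for \<alpha>
      using s unfolding cluster_resonances_iff by blast+
    define Q where "Q = (\<lambda>\<epsilon>. (\<forall>\<alpha>. is_enumeration \<alpha> \<epsilon> (s \<epsilon> \<alpha>)) \<and>
      (\<forall>\<alpha>. det (?Q \<epsilon> (s \<epsilon> \<alpha> 1)) = 0 \<longrightarrow> zorder (\<lambda>u. det (?Q \<epsilon> u)) (s \<epsilon> \<alpha> 1) = 1))"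
    have "\<forall>\<^sub>F \<epsilon> in at_right 0. Q \<epsilon>"
      unfolding Q_def by (rule eventually_conj[OF en eventually_all_finite[OF eventually_simple_zero[OF lo]]])
    from eventually_threshold[OF this]
    obtain \<epsilon>\<^sub>0 where \<epsilon>\<^sub>0: "0 < \<epsilon>\<^sub>0" "\<epsilon>\<^sub>0 \<le> \<epsilon>\<^sub>1" "\<forall>\<epsilon>\<in>{0<..\<epsilon>\<^sub>0}. Q \<epsilon>"
      by blast
    show ?thesis
    proof (rule exI[of _ \<epsilon>\<^sub>0], intro conjI ballI allI impI)
      fix \<epsilon> \<alpha> m assume \<epsilon>: "\<epsilon> \<in> {0<..\<epsilon>\<^sub>0}" and m: "m \<in> {1..card (cluster cl \<alpha>)}"
        and prem: "(m = 1 \<or> semisimple_at (P \<epsilon>) (s \<epsilon> \<alpha> m)) \<and>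
             not_annihilated (A_mat C \<epsilon>) (P \<epsilon> (s \<epsilon> \<alpha> m)) (B\<^sub>i\<^sub>n \<epsilon> (s \<epsilon> \<alpha> m))"
      have Q: "is_enumeration \<alpha> \<epsilon> (s \<epsilon> \<alpha>)"
        "det (?Q \<epsilon> (s \<epsilon> \<alpha> 1)) = 0 \<Longrightarrow> zorder (\<lambda>u. det (?Q \<epsilon> u)) (s \<epsilon> \<alpha> 1) = 1"
        using bspec[OF \<epsilon>\<^sub>0(3) \<epsilon>] unfolding Q_def by blast+
      show "\<exists>U R H\<^sub>r\<^sub>e\<^sub>g. open U \<and> s \<epsilon> \<alpha> m \<in> U \<and> R \<noteq> 0 \<and>
                (\<forall>i j. (\<lambda>u. H\<^sub>r\<^sub>e\<^sub>g u $ i $ j) analytic_on U) \<and> bounded (H\<^sub>r\<^sub>e\<^sub>g ` U) \<and>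
                (\<forall>u\<in>U - {s \<epsilon> \<alpha> m}. H \<epsilon> u = mat (1 / (u - s \<epsilon> \<alpha> m)) ** R + H\<^sub>r\<^sub>e\<^sub>g u)"
      proof (rule expansion)
        show "\<epsilon> \<in> {0<..\<epsilon>\<^sub>1}" using \<epsilon> \<epsilon>\<^sub>0(2) by auto
        show "s \<epsilon> \<alpha> m \<noteq> 0" by (rule enumeration_zero(2)[OF Q(1) m])
        show "semisimple_at (P \<epsilon>) (s \<epsilon> \<alpha> m)"
        \<comment> \<open>For the principal mode semisimplicity follows from simplicity of the zero;
          for the other modes it is the premise.\<close>
        proof (cases "m = 1")
          case True
          have "zorder (\<lambda>u. det (?Q \<epsilon> u)) (s \<epsilon> \<alpha> 1) = 1"
            by (rule Q(2)[OF enumeration_zero(1)[OF Q(1) one_in_cluster_range]])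
          then show ?thesis unfolding PQ True by (rule semisimple_if_simple)
        qed (use prem in blast)
      qed (use prem in blast)
    qed (use \<epsilon>\<^sub>0 in auto)
  qed
  show ?thesis
    by (rule conjI[OF part_i conjI[OF cluster_resonances_exist]], intro allI impI, rule conjI[OF part_ii part_iii])
qed

end
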